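(* Let $(\mathcal{A},\Box,I)$ be an abelian monoidal category which admits sequential colimits and whose monoidal product preserves sequential colimits and reflexive coequalizers. Then, for every object $V$ of $\mathcal{A}$, the monoid $(\mathcal{F}(V),\bar\mu,\bar\eta)$ is the free monoid on $V$.
   Context: That the monoidal product preserves a type of colimit means that for every object $A$ the functors $N\mapsto A\Box N$ and $N\mapsto N\Box A$ preserve it. A reflexive coequalizer is a coequalizer of a pair $d_0,d_1:X_1\to X_0$ admitting a common section $s_0:X_0\to X_1$, $d_0s_0=d_1s_0=\mathrm{id}$. Construction of $\mathcal{F}(V)$. Put $V_+=I\oplus V$, with inclusions $i_I:I\to V_+$ (also denoted $\eta$) and $i_V:V\to V_+$, and $V_n=(V_+)^{\Box n}$, $V_0=I$. Let $\tau:V\to V_2$ be $\tau=(i_I\Box i_V)\circ\lambda_V^{-1}-(i_V\Box i_I)\circ\rho_V^{-1}$, where $\lambda_V:I\Box V\cong V$, $\rho_V:V\Box I\cong V$ are the unit isomorphisms. For objects $A,B,X,Y$ the multilinear part in $X$, denoted $A\Box(\underline{X}\oplus Y)\Box B$, is the cokernel of $A\Box Y\Box B\to A\Box(X\oplus Y)\Box B$; equivalently it is the kernel of the projection $A\Box(X\oplus Y)\Box B\to A\Box Y\Box B$, and is regarded as a subobject of $A\Box(X\oplus Y)\Box B$. Define $$R_{A,B}=\mathrm{im}\Big(A\Box(V_2\oplus\underline{V})\Box B\hookrightarrow A\Box(V\oplus V_2)\Box B\xrightarrow{A\Box(\tau+\mathrm{id}_{V_2})\Box B}A\Box V_2\Box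 B\Big)$$ and $\widetilde V_n=\mathrm{coker}\big(\bigoplus_{i=0}^{n-2}R_{V_i,V_{n-i-2}}\to V_n\big)$. The maps $\eta_i=V_i\Box\eta\Box V_{n-i}:V_n\to V_{n+1}$ induce maps $\widetilde V_n\to\widetilde V_{n+1}$ that do not depend on $i$, denoted $\widetilde\eta$. Put $\mathcal{F}(V)=\mathrm{Colim}(\widetilde V_0=I\xrightarrow{\widetilde\eta}\widetilde V_1=V_+\xrightarrow{\widetilde\eta}\widetilde V_2\xrightarrow{\widetilde\eta}\cdots)$, with structure maps $j_n:\widetilde V_n\to\mathcal{F}(V)$. The unit is $\bar\eta=j_0:I\to\mathcal{F}(V)$, and the product $\bar\mu:\mathcal{F}(V)\Box\mathcal{F}(V)\to\mathcal{F}(V)$ is the unique map induced, by passage to quotients and to the colimits, by the maps $V_n\Box V_m\cong V_{n+m}\twoheadrightarrow\widetilde V_{n+m}\xrightarrow{j_{n+m}}\mathcal{F}(V)$; these make $\mathcal{F}(V)$ a monoid. "Free monoid on $V$": with $u_V:V\hookrightarrow V_+\xrightarrow{j_1}\mathcal{F}(V)$, for every monoid $M$ and every morphism $f:V\to M$ in $\mathcal{A}$ there is a unique morphism of monoids $\widetilde f:\mathcal{F}(V)\to M$ with $\widetilde f\circ u_V=f$. *)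

theory Defs
  imports Main
begin

section \<open>Categories\<close>

record ('o, 'm) category =
  Obj :: "'o set"
  Arr :: "'m set"
  Dom :: "'m \<Rightarrow> 'o"
  Cod :: "'m \<Rightarrow> 'o"
  Id :: "'o \<Rightarrow> 'm"
  Comp :: "'m \<Rightarrow> 'm \<Rightarrow> 'm"  (infixr \<open>\<cdot>\<index>\<close> 70)

definition hom :: "('o, 'm, 'x) category_scheme \<Rightarrow> 'o \<Rightarrow> 'o \<Rightarrow> 'm set"
  where "hom C X Y = {f \<in> Arr C. Dom C f = X \<and> Cod C f = Y}"

locale category =
  fixes C :: "('o, 'm, 'x) category_scheme" (structure)
  assumes dom_obj: "f \<in> Arr C \<Longrightarrow> Dom C f \<in> Obj C"
    and cod_obj: "f \<in> Arr C \<Longrightarrow> Cod C f \<in> Obj C"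
    and id_hom: "X \<in> Obj C \<Longrightarrow> Id C X \<in> hom C X X"
    and comp_hom: "f \<in> hom C X Y \<Longrightarrow> g \<in> hom C Y Z \<Longrightarrow> g \<cdot> f \<in> hom C X Z"
    and comp_id: "f \<in> hom C X Y \<Longrightarrow> f \<cdot> Id C X = f"
    and id_comp: "f \<in> hom C X Y \<Longrightarrow> Id C Y \<cdot> f = f"
    and comp_assoc: "f \<in> hom C W X \<Longrightarrow> g \<in> hom C X Y \<Longrightarrow> h \<in> hom C Y Z \<Longrightarrow>
      (h \<cdot> g) \<cdot> f = h \<cdot> (g \<cdot> f)"

definition is_inverse :: "('o, 'm, 'x) category_scheme \<Rightarrow> 'm \<Rightarrow> 'm \<Rightarrow> bool"
  where "is_inverse C f g \<longleftrightarrow> f \<in> Arr C \<and> g \<in> hom C (Cod C f) (Dom C f) \<and>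
    g \<cdot>\<^bsub>C\<^esub> f = Id C (Dom C f) \<and> f \<cdot>\<^bsub>C\<^esub> g = Id C (Cod C f)"

definition is_iso :: "('o, 'm, 'x) category_scheme \<Rightarrow> 'm \<Rightarrow> bool"
  where "is_iso C f \<longleftrightarrow> (\<exists>g. is_inverse C f g)"

definition inverse_arr :: "('o, 'm, 'x) category_scheme \<Rightarrow> 'm \<Rightarrow> 'm"
  where "inverse_arr C f = (THE g. is_inverse C f g)"

definition is_mono :: "('o, 'm, 'x) category_scheme \<Rightarrow> 'm \<Rightarrow> bool"
  where "is_mono C f \<longleftrightarrow> f \<in> Arr C \<and>
    (\<forall>W. \<forall>g\<in>hom C W (Dom C f). \<forall>h\<in>hom C W (Dom C f). f \<cdot>\<^bsub>C\<^esub> g = f \<cdot>\<^bsub>C\<^esub> h \<longrightarrow> g = h)"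

definition is_epi :: "('o, 'm, 'x) category_scheme \<Rightarrow> 'm \<Rightarrow> bool"
  where "is_epi C f \<longleftrightarrow> f \<in> Arr C \<and>
    (\<forall>Z. \<forall>g\<in>hom C (Cod C f) Z. \<forall>h\<in>hom C (Cod C f) Z. g \<cdot>\<^bsub>C\<^esub> f = h \<cdot>\<^bsub>C\<^esub> f \<longrightarrow> g = h)"

definition is_zero_object :: "('o, 'm, 'x) category_scheme \<Rightarrow> 'o \<Rightarrow> bool"
  where "is_zero_object C Z \<longleftrightarrow> Z \<in> Obj C \<and>
    (\<forall>X\<in>Obj C. (\<exists>!f. f \<in> hom C X Z) \<and> (\<exists>!f. f \<in> hom C Z X))"

text \<open>The coproduct of the family \<open>X\<close> over the index set \<open>J\<close>: object \<open>S\<close>, injections \<open>\<iota>\<close>.\<close>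

definition is_coproduct ::
    "('o, 'm, 'x) category_scheme \<Rightarrow> 'i set \<Rightarrow> ('i \<Rightarrow> 'o) \<Rightarrow> 'o \<Rightarrow> ('i \<Rightarrow> 'm) \<Rightarrow> bool"
  where "is_coproduct C J X S \<iota> \<longleftrightarrow> S \<in> Obj C \<and> (\<forall>i\<in>J. \<iota> i \<in> hom C (X i) S) \<and>
    (\<forall>Y\<in>Obj C. \<forall>g. (\<forall>i\<in>J. g i \<in> hom C (X i) Y) \<longrightarrow>
      (\<exists>!h. h \<in> hom C S Y \<and> (\<forall>i\<in>J. h \<cdot>\<^bsub>C\<^esub> \<iota> i = g i)))"

definition is_coequalizer :: "('o, 'm, 'x) category_scheme \<Rightarrow> 'm \<Rightarrow> 'm \<Rightarrow> 'm \<Rightarrow> bool"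
  where "is_coequalizer C d0 d1 q \<longleftrightarrow>
    d0 \<in> Arr C \<and> d1 \<in> hom C (Dom C d0) (Cod C d0) \<and>
    q \<in> Arr C \<and> Dom C q = Cod C d0 \<and> q \<cdot>\<^bsub>C\<^esub> d0 = q \<cdot>\<^bsub>C\<^esub> d1 \<and>
    (\<forall>Y\<in>Obj C. \<forall>g\<in>hom C (Cod C d0) Y. g \<cdot>\<^bsub>C\<^esub> d0 = g \<cdot>\<^bsub>C\<^esub> d1 \<longrightarrow>
      (\<exists>!h. h \<in> hom C (Cod C q) Y \<and> h \<cdot>\<^bsub>C\<^esub> q = g))"

definition is_reflexive_coequalizer ::
    "('o, 'm, 'x) category_scheme \<Rightarrow> 'm \<Rightarrow> 'm \<Rightarrow> 'm \<Rightarrow> bool"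
  where "is_reflexive_coequalizer C d0 d1 q \<longleftrightarrow> is_coequalizer C d0 d1 q \<and>
    (\<exists>s0\<in>hom C (Cod C d0) (Dom C d0).
      d0 \<cdot>\<^bsub>C\<^esub> s0 = Id C (Cod C d0) \<and> d1 \<cdot>\<^bsub>C\<^esub> s0 = Id C (Cod C d0))"

definition is_sequence ::
    "('o, 'm, 'x) category_scheme \<Rightarrow> (nat \<Rightarrow> 'o) \<Rightarrow> (nat \<Rightarrow> 'm) \<Rightarrow> bool"
  where "is_sequence C X f \<longleftrightarrow>
    (\<forall>n. X n \<in> Obj C) \<and> (\<forall>n. f n \<in> hom C (X n) (X (Suc n)))"

definition is_cocone ::
    "('o, 'm, 'x) category_scheme \<Rightarrow> (nat \<Rightarrow> 'o) \<Rightarrow> (nat \<Rightarrow> 'm) \<Rightarrow> 'o \<Rightarrow> (nat \<Rightarrow> 'm) \<Rightarrow> bool"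
  where "is_cocone C X f Y g \<longleftrightarrow> Y \<in> Obj C \<and>
    (\<forall>n. g n \<in> hom C (X n) Y) \<and> (\<forall>n. g (Suc n) \<cdot>\<^bsub>C\<^esub> f n = g n)"

definition is_seq_colimit ::
    "('o, 'm, 'x) category_scheme \<Rightarrow> (nat \<Rightarrow> 'o) \<Rightarrow> (nat \<Rightarrow> 'm) \<Rightarrow> 'o \<Rightarrow> (nat \<Rightarrow> 'm) \<Rightarrow> bool"
  where "is_seq_colimit C X f L j \<longleftrightarrow> is_sequence C X f \<and> is_cocone C X f L j \<and>
    (\<forall>Y g. is_cocone C X f Y g \<longrightarrow>
      (\<exists>!h. h \<in> hom C L Y \<and> (\<forall>n. h \<cdot>\<^bsub>C\<^esub> j n = g n)))"

definition has_seq_colimits :: "('o, 'm, 'x) category_scheme \<Rightarrow> bool"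
  where "has_seq_colimits C \<longleftrightarrow>
    (\<forall>X f. is_sequence C X f \<longrightarrow> (\<exists>L j. is_seq_colimit C X f L j))"


section \<open>Abelian categories\<close>

record ('o, 'm) preadditive_category = "('o, 'm) category" +
  Add :: "'m \<Rightarrow> 'm \<Rightarrow> 'm"  (infixl \<open>\<oplus>\<index>\<close> 65)
  Zero :: "'o \<Rightarrow> 'o \<Rightarrow> 'm"

locale preadditive_category = category C
  for C :: "('o, 'm, 'x) preadditive_category_scheme" (structure) +
  assumes add_hom: "f \<in> hom C X Y \<Longrightarrow> g \<in> hom C X Y \<Longrightarrow> f \<oplus> g \<in> hom C X Y"
    and add_assoc: "f \<in> hom C X Y \<Longrightarrow> g \<in> hom C X Y \<Longrightarrow> h \<in> hom C X Y \<Longrightarrow>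
      (f \<oplus> g) \<oplus> h = f \<oplus> (g \<oplus> h)"
    and add_comm: "f \<in> hom C X Y \<Longrightarrow> g \<in> hom C X Y \<Longrightarrow> f \<oplus> g = g \<oplus> f"
    and zero_hom: "X \<in> Obj C \<Longrightarrow> Y \<in> Obj C \<Longrightarrow> Zero C X Y \<in> hom C X Y"
    and add_zero: "f \<in> hom C X Y \<Longrightarrow> f \<oplus> Zero C X Y = f"
    and add_neg: "f \<in> hom C X Y \<Longrightarrow> \<exists>g\<in>hom C X Y. f \<oplus> g = Zero C X Y"
    and comp_add: "f \<in> hom C X Y \<Longrightarrow> g \<in> hom C X Y \<Longrightarrow> h \<in> hom C Y Z \<Longrightarrow>
      h \<cdot> (f \<oplus> g) = (h \<cdot> f) \<oplus> (h \<cdot> g)"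
    and add_comp: "f \<in> hom C Y Z \<Longrightarrow> g \<in> hom C Y Z \<Longrightarrow> h \<in> hom C X Y \<Longrightarrow>
      (f \<oplus> g) \<cdot> h = (f \<cdot> h) \<oplus> (g \<cdot> h)"

definition neg :: "('o, 'm, 'x) preadditive_category_scheme \<Rightarrow> 'm \<Rightarrow> 'm"
  where "neg C f =
    (THE g. g \<in> hom C (Dom C f) (Cod C f) \<and> f \<oplus>\<^bsub>C\<^esub> g = Zero C (Dom C f) (Cod C f))"

definition is_kernel :: "('o, 'm, 'x) preadditive_category_scheme \<Rightarrow> 'm \<Rightarrow> 'm \<Rightarrow> bool"
  where "is_kernel C f k \<longleftrightarrow> f \<in> Arr C \<and> k \<in> Arr C \<and> Cod C k = Dom C f \<and>
    f \<cdot>\<^bsub>C\<^esub> k = Zero C (Dom C k) (Cod C f) \<and>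
    (\<forall>W\<in>Obj C. \<forall>g\<in>hom C W (Dom C f). f \<cdot>\<^bsub>C\<^esub> g = Zero C W (Cod C f) \<longrightarrow>
      (\<exists>!h. h \<in> hom C W (Dom C k) \<and> k \<cdot>\<^bsub>C\<^esub> h = g))"

definition is_cokernel :: "('o, 'm, 'x) preadditive_category_scheme \<Rightarrow> 'm \<Rightarrow> 'm \<Rightarrow> bool"
  where "is_cokernel C f c \<longleftrightarrow> f \<in> Arr C \<and> c \<in> Arr C \<and> Dom C c = Cod C f \<and>
    c \<cdot>\<^bsub>C\<^esub> f = Zero C (Dom C f) (Cod C c) \<and>
    (\<forall>Z\<in>Obj C. \<forall>g\<in>hom C (Cod C f) Z. g \<cdot>\<^bsub>C\<^esub> f = Zero C (Dom C f) Z \<longrightarrow>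
      (\<exists>!h. h \<in> hom C (Cod C c) Z \<and> h \<cdot>\<^bsub>C\<^esub> c = g))"

definition is_biproduct ::
    "('o, 'm, 'x) preadditive_category_scheme \<Rightarrow> 'o \<Rightarrow> 'o \<Rightarrow> 'o \<times> 'm \<times> 'm \<times> 'm \<times> 'm \<Rightarrow> bool"
  where "is_biproduct C X Y = (\<lambda>(S, i1, i2, p1, p2).
    S \<in> Obj C \<and> i1 \<in> hom C X S \<and> i2 \<in> hom C Y S \<and> p1 \<in> hom C S X \<and> p2 \<in> hom C S Y \<and>
    p1 \<cdot>\<^bsub>C\<^esub> i1 = Id C X \<and> p2 \<cdot>\<^bsub>C\<^esub> i2 = Id C Y \<and>
    p1 \<cdot>\<^bsub>C\<^esub> i2 = Zero C Y X \<and> p2 \<cdot>\<^bsub>C\<^esub> i1 = Zero C X Y \<and>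
    (i1 \<cdot>\<^bsub>C\<^esub> p1) \<oplus>\<^bsub>C\<^esub> (i2 \<cdot>\<^bsub>C\<^esub> p2) = Id C S)"

locale abelian_category = preadditive_category C
  for C :: "('o, 'm, 'x) preadditive_category_scheme" (structure) +
  assumes ex_zero: "\<exists>Z. is_zero_object C Z"
    and ex_biproduct: "X \<in> Obj C \<Longrightarrow> Y \<in> Obj C \<Longrightarrow> \<exists>d. is_biproduct C X Y d"
    and ex_kernel: "f \<in> Arr C \<Longrightarrow> \<exists>k. is_kernel C f k"
    and ex_cokernel: "f \<in> Arr C \<Longrightarrow> \<exists>c. is_cokernel C f c"
    and mono_normal: "is_mono C k \<Longrightarrow> \<exists>f. is_kernel C f k"
    and epi_normal: "is_epi C c \<Longrightarrow> \<exists>f. is_cokernel C f c"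

text \<open>
  Universal objects are determined only up to isomorphism; the following operations pick one
  representative by Hilbert choice.  A kernel, cokernel or image is represented by its
  structure morphism, so the kernel and image objects are its domain and the cokernel object
  is its codomain.
\<close>

definition ker :: "('o, 'm, 'x) preadditive_category_scheme \<Rightarrow> 'm \<Rightarrow> 'm"
  where "ker C f = (SOME k. is_kernel C f k)"

definition coker :: "('o, 'm, 'x) preadditive_category_scheme \<Rightarrow> 'm \<Rightarrow> 'm"
  where "coker C f = (SOME c. is_cokernel C f c)"

definition im :: "('o, 'm, 'x) preadditive_category_scheme \<Rightarrow> 'm \<Rightarrow> 'm"
  where "im C f = ker C (coker C f)"

definition biproduct ::
    "('o, 'm, 'x) preadditive_category_scheme \<Rightarrow> 'o \<Rightarrow> 'o \<Rightarrow> 'o \<times> 'm \<times> 'm \<times> 'm \<times> 'm"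
  where "biproduct C X Y = (SOME d. is_biproduct C X Y d)"

definition bi_obj :: "('o, 'm, 'x) preadditive_category_scheme \<Rightarrow> 'o \<Rightarrow> 'o \<Rightarrow> 'o"
  where "bi_obj C X Y = (case biproduct C X Y of (S, i1, i2, p1, p2) \<Rightarrow> S)"

definition bi_in1 :: "('o, 'm, 'x) preadditive_category_scheme \<Rightarrow> 'o \<Rightarrow> 'o \<Rightarrow> 'm"
  where "bi_in1 C X Y = (case biproduct C X Y of (S, i1, i2, p1, p2) \<Rightarrow> i1)"

definition bi_in2 :: "('o, 'm, 'x) preadditive_category_scheme \<Rightarrow> 'o \<Rightarrow> 'o \<Rightarrow> 'm"
  where "bi_in2 C X Y = (case biproduct C X Y of (S, i1, i2, p1, p2) \<Rightarrow> i2)"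

definition bi_pr1 :: "('o, 'm, 'x) preadditive_category_scheme \<Rightarrow> 'o \<Rightarrow> 'o \<Rightarrow> 'm"
  where "bi_pr1 C X Y = (case biproduct C X Y of (S, i1, i2, p1, p2) \<Rightarrow> p1)"

definition bi_pr2 :: "('o, 'm, 'x) preadditive_category_scheme \<Rightarrow> 'o \<Rightarrow> 'o \<Rightarrow> 'm"
  where "bi_pr2 C X Y = (case biproduct C X Y of (S, i1, i2, p1, p2) \<Rightarrow> p2)"

definition coproduct ::
    "('o, 'm, 'x) category_scheme \<Rightarrow> 'i set \<Rightarrow> ('i \<Rightarrow> 'o) \<Rightarrow> 'o \<times> ('i \<Rightarrow> 'm)"
  where "coproduct C J X = (SOME (S, \<iota>). is_coproduct C J X S \<iota>)"

definition copair ::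
    "('o, 'm, 'x) category_scheme \<Rightarrow> 'i set \<Rightarrow> ('i \<Rightarrow> 'o) \<Rightarrow> 'o \<Rightarrow> ('i \<Rightarrow> 'm) \<Rightarrow> 'm"
  where "copair C J X Y g = (case coproduct C J X of (S, \<iota>) \<Rightarrow>
    (THE h. h \<in> hom C S Y \<and> (\<forall>i\<in>J. h \<cdot>\<^bsub>C\<^esub> \<iota> i = g i)))"

definition seq_colimit ::
    "('o, 'm, 'x) category_scheme \<Rightarrow> (nat \<Rightarrow> 'o) \<Rightarrow> (nat \<Rightarrow> 'm) \<Rightarrow> 'o \<times> (nat \<Rightarrow> 'm)"
  where "seq_colimit C X f = (SOME (L, j). is_seq_colimit C X f L j)"


section \<open>Abelian monoidal categories\<close>

record ('o, 'm) abelian_monoidal_category = "('o, 'm) preadditive_category" +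
  Ten :: "'o \<Rightarrow> 'o \<Rightarrow> 'o"  (infixr \<open>\<box>\<^sub>o\<index>\<close> 75)
  TenA :: "'m \<Rightarrow> 'm \<Rightarrow> 'm"  (infixr \<open>\<box>\<index>\<close> 75)
  Unit :: "'o"
  Assoc :: "'o \<Rightarrow> 'o \<Rightarrow> 'o \<Rightarrow> 'm"
  Lunit :: "'o \<Rightarrow> 'm"
  Runit :: "'o \<Rightarrow> 'm"

text \<open>The product is only a bifunctor: it is not assumed to be additive in either variable.\<close>

locale abelian_monoidal_category = abelian_category C
  for C :: "('o, 'm, 'x) abelian_monoidal_category_scheme" (structure) +
  assumes ten_obj: "X \<in> Obj C \<Longrightarrow> Y \<in> Obj C \<Longrightarrow> X \<box>\<^sub>o Y \<in> Obj C"
    and unit_obj: "Unit C \<in> Obj C"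
    and ten_hom: "f \<in> hom C X X' \<Longrightarrow> g \<in> hom C Y Y' \<Longrightarrow> f \<box> g \<in> hom C (X \<box>\<^sub>o Y) (X' \<box>\<^sub>o Y')"
    and ten_id: "X \<in> Obj C \<Longrightarrow> Y \<in> Obj C \<Longrightarrow> Id C X \<box> Id C Y = Id C (X \<box>\<^sub>o Y)"
    and ten_comp: "f \<in> hom C X X' \<Longrightarrow> f' \<in> hom C X' X'' \<Longrightarrow>
      g \<in> hom C Y Y' \<Longrightarrow> g' \<in> hom C Y' Y'' \<Longrightarrow>
      (f' \<cdot> f) \<box> (g' \<cdot> g) = (f' \<box> g') \<cdot> (f \<box> g)"
    and assoc_hom: "X \<in> Obj C \<Longrightarrow> Y \<in> Obj C \<Longrightarrow> Z \<in> Obj C \<Longrightarrow>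
      Assoc C X Y Z \<in> hom C ((X \<box>\<^sub>o Y) \<box>\<^sub>o Z) (X \<box>\<^sub>o (Y \<box>\<^sub>o Z))"
    and assoc_iso: "X \<in> Obj C \<Longrightarrow> Y \<in> Obj C \<Longrightarrow> Z \<in> Obj C \<Longrightarrow> is_iso C (Assoc C X Y Z)"
    and assoc_nat: "f \<in> hom C X X' \<Longrightarrow> g \<in> hom C Y Y' \<Longrightarrow> h \<in> hom C Z Z' \<Longrightarrow>
      Assoc C X' Y' Z' \<cdot> ((f \<box> g) \<box> h) = (f \<box> (g \<box> h)) \<cdot> Assoc C X Y Z"
    and lunit_hom: "X \<in> Obj C \<Longrightarrow> Lunit C X \<in> hom C (Unit C \<box>\<^sub>o X) X"
    and lunit_iso: "X \<in> Obj C \<Longrightarrow> is_iso C (Lunit C X)"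
    and lunit_nat: "f \<in> hom C X Y \<Longrightarrow>
      Lunit C Y \<cdot> (Id C (Unit C) \<box> f) = f \<cdot> Lunit C X"
    and runit_hom: "X \<in> Obj C \<Longrightarrow> Runit C X \<in> hom C (X \<box>\<^sub>o Unit C) X"
    and runit_iso: "X \<in> Obj C \<Longrightarrow> is_iso C (Runit C X)"
    and runit_nat: "f \<in> hom C X Y \<Longrightarrow>
      Runit C Y \<cdot> (f \<box> Id C (Unit C)) = f \<cdot> Runit C X"
    and pentagon: "W \<in> Obj C \<Longrightarrow> X \<in> Obj C \<Longrightarrow> Y \<in> Obj C \<Longrightarrow> Z \<in> Obj C \<Longrightarrow>
      (Id C W \<box> Assoc C X Y Z) \<cdot> Assoc C W (X \<box>\<^sub>o Y) Z \<cdot> (Assoc C W X Y \<box> Id C Z) =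
      Assoc C W X (Y \<box>\<^sub>o Z) \<cdot> Assoc C (W \<box>\<^sub>o X) Y Z"
    and triangle: "X \<in> Obj C \<Longrightarrow> Y \<in> Obj C \<Longrightarrow>
      (Id C X \<box> Lunit C Y) \<cdot> Assoc C X (Unit C) Y = Runit C X \<box> Id C Y"

definition ten_preserves_seq_colimits ::
    "('o, 'm, 'x) abelian_monoidal_category_scheme \<Rightarrow> bool"
  where "ten_preserves_seq_colimits C \<longleftrightarrow>
    (\<forall>A\<in>Obj C. \<forall>X f L j. is_seq_colimit C X f L j \<longrightarrow>
      is_seq_colimit C (\<lambda>n. A \<box>\<^sub>o\<^bsub>C\<^esub> X n) (\<lambda>n. Id C A \<box>\<^bsub>C\<^esub> f n)
        (A \<box>\<^sub>o\<^bsub>C\<^esub> L) (\<lambda>n. Id C A \<box>\<^bsub>C\<^esub> j n) \<and>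
      is_seq_colimit C (\<lambda>n. X n \<box>\<^sub>o\<^bsub>C\<^esub> A) (\<lambda>n. f n \<box>\<^bsub>C\<^esub> Id C A)
        (L \<box>\<^sub>o\<^bsub>C\<^esub> A) (\<lambda>n. j n \<box>\<^bsub>C\<^esub> Id C A))"

text \<open>Functors preserve the common section, so only the coequalizer property is at stake.\<close>

definition ten_preserves_reflexive_coequalizers ::
    "('o, 'm, 'x) abelian_monoidal_category_scheme \<Rightarrow> bool"
  where "ten_preserves_reflexive_coequalizers C \<longleftrightarrow>
    (\<forall>A\<in>Obj C. \<forall>d0 d1 q. is_reflexive_coequalizer C d0 d1 q \<longrightarrow>
      is_coequalizer C (Id C A \<box>\<^bsub>C\<^esub> d0) (Id C A \<box>\<^bsub>C\<^esub> d1) (Id C A \<box>\<^bsub>C\<^esub> q) \<and>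
      is_coequalizer C (d0 \<box>\<^bsub>C\<^esub> Id C A) (d1 \<box>\<^bsub>C\<^esub> Id C A) (q \<box>\<^bsub>C\<^esub> Id C A))"


section \<open>Monoids\<close>

definition is_monoid ::
    "('o, 'm, 'x) abelian_monoidal_category_scheme \<Rightarrow> 'o \<Rightarrow> 'm \<Rightarrow> 'm \<Rightarrow> bool"
  where "is_monoid C M \<mu> \<eta> \<longleftrightarrow>
    M \<in> Obj C \<and> \<mu> \<in> hom C (M \<box>\<^sub>o\<^bsub>C\<^esub> M) M \<and> \<eta> \<in> hom C (Unit C) M \<and>
    \<mu> \<cdot>\<^bsub>C\<^esub> (\<mu> \<box>\<^bsub>C\<^esub> Id C M) = \<mu> \<cdot>\<^bsub>C\<^esub> (Id C M \<box>\<^bsub>C\<^esub> \<mu>) \<cdot>\<^bsub>C\<^esub> Assoc C M M M \<and>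
    \<mu> \<cdot>\<^bsub>C\<^esub> (\<eta> \<box>\<^bsub>C\<^esub> Id C M) = Lunit C M \<and>
    \<mu> \<cdot>\<^bsub>C\<^esub> (Id C M \<box>\<^bsub>C\<^esub> \<eta>) = Runit C M"

definition is_monoid_hom ::
    "('o, 'm, 'x) abelian_monoidal_category_scheme \<Rightarrow>
      'o \<Rightarrow> 'm \<Rightarrow> 'm \<Rightarrow> 'o \<Rightarrow> 'm \<Rightarrow> 'm \<Rightarrow> 'm \<Rightarrow> bool"
  where "is_monoid_hom C M \<mu> \<eta> M' \<mu>' \<eta>' h \<longleftrightarrow> h \<in> hom C M M' \<and>
    h \<cdot>\<^bsub>C\<^esub> \<mu> = \<mu>' \<cdot>\<^bsub>C\<^esub> (h \<box>\<^bsub>C\<^esub> h) \<and> h \<cdot>\<^bsub>C\<^esub> \<eta> = \<eta>'"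

definition is_free_monoid ::
    "('o, 'm, 'x) abelian_monoidal_category_scheme \<Rightarrow> 'o \<Rightarrow> 'o \<Rightarrow> 'm \<Rightarrow> 'm \<Rightarrow> 'm \<Rightarrow> bool"
  where "is_free_monoid C V F \<mu> \<eta> u \<longleftrightarrow> is_monoid C F \<mu> \<eta> \<and> u \<in> hom C V F \<and>
    (\<forall>M \<mu>' \<eta>'. is_monoid C M \<mu>' \<eta>' \<longrightarrow> (\<forall>f\<in>hom C V M.
      \<exists>!h. is_monoid_hom C F \<mu> \<eta> M \<mu>' \<eta>' h \<and> h \<cdot>\<^bsub>C\<^esub> u = f))"


section \<open>The construction\<close>

text \<open>
  The powers of an object are bracketed to the right, with first power the object itself and
  second power \<open>P \<box>\<^sub>o P\<close>.
\<close>

fun tpow :: "('o, 'm, 'x) abelian_monoidal_category_scheme \<Rightarrow> 'o \<Rightarrow> nat \<Rightarrow> 'o"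
  where
    "tpow C P 0 = Unit C"
  | "tpow C P (Suc 0) = P"
  | "tpow C P (Suc (Suc n)) = P \<box>\<^sub>o\<^bsub>C\<^esub> tpow C P (Suc n)"

text \<open>The canonical isomorphism from \<open>tpow C P n \<box>\<^sub>o tpow C P m\<close> to \<open>tpow C P (n + m)\<close>.\<close>

fun tcat :: "('o, 'm, 'x) abelian_monoidal_category_scheme \<Rightarrow> 'o \<Rightarrow> nat \<Rightarrow> nat \<Rightarrow> 'm"
  where
    "tcat C P 0 m = Lunit C (tpow C P m)"
  | "tcat C P (Suc 0) 0 = Runit C P"
  | "tcat C P (Suc 0) (Suc m) = Id C (tpow C P (Suc (Suc m)))"
  | "tcat C P (Suc (Suc n)) m =
      (Id C P \<box>\<^bsub>C\<^esub> tcat C P (Suc n) m) \<cdot>\<^bsub>C\<^esub> Assoc C P (tpow C P (Suc n)) (tpow C P m)"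

text \<open>The triple product of \<open>A\<close>, \<open>X\<close>, \<open>B\<close> is bracketed as \<open>A \<box>\<^sub>o (X \<box>\<^sub>o B)\<close>.\<close>

definition sandwich ::
    "('o, 'm, 'x) abelian_monoidal_category_scheme \<Rightarrow> 'o \<Rightarrow> 'm \<Rightarrow> 'o \<Rightarrow> 'm"
  where "sandwich C A f B = Id C A \<box>\<^bsub>C\<^esub> (f \<box>\<^bsub>C\<^esub> Id C B)"

text \<open>
  The multilinear part in \<open>X\<close>, as the subobject of the product of \<open>A\<close>, \<open>bi_obj C X Y\<close>, \<open>B\<close>
  that is the kernel of the projection onto the product of \<open>A\<close>, \<open>Y\<close>, \<open>B\<close>.
\<close>

definition multilinear ::
    "('o, 'm, 'x) abelian_monoidal_category_scheme \<Rightarrow> 'o \<Rightarrow> 'o \<Rightarrow> 'o \<Rightarrow> 'o \<Rightarrow> 'm"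
  where "multilinear C A X Y B = ker C (sandwich C A (bi_pr2 C X Y) B)"

definition Vplus :: "('o, 'm, 'x) abelian_monoidal_category_scheme \<Rightarrow> 'o \<Rightarrow> 'o"
  where "Vplus C V = bi_obj C (Unit C) V"

definition in_unit :: "('o, 'm, 'x) abelian_monoidal_category_scheme \<Rightarrow> 'o \<Rightarrow> 'm"
  where "in_unit C V = bi_in1 C (Unit C) V"

definition in_V :: "('o, 'm, 'x) abelian_monoidal_category_scheme \<Rightarrow> 'o \<Rightarrow> 'm"
  where "in_V C V = bi_in2 C (Unit C) V"

definition Vn :: "('o, 'm, 'x) abelian_monoidal_category_scheme \<Rightarrow> 'o \<Rightarrow> nat \<Rightarrow> 'o"
  where "Vn C V n = tpow C (Vplus C V) n"

definition Vcat :: "('o, 'm, 'x) abelian_monoidal_category_scheme \<Rightarrow> 'o \<Rightarrow> nat \<Rightarrow> nat \<Rightarrow> 'm"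
  where "Vcat C V n m = tcat C (Vplus C V) n m"

definition tau :: "('o, 'm, 'x) abelian_monoidal_category_scheme \<Rightarrow> 'o \<Rightarrow> 'm"
  where "tau C V =
    ((in_unit C V \<box>\<^bsub>C\<^esub> in_V C V) \<cdot>\<^bsub>C\<^esub> inverse_arr C (Lunit C V)) \<oplus>\<^bsub>C\<^esub>
    neg C ((in_V C V \<box>\<^bsub>C\<^esub> in_unit C V) \<cdot>\<^bsub>C\<^esub> inverse_arr C (Runit C V))"

text \<open>The inclusion of the relation object of \<open>A\<close>, \<open>B\<close> into \<open>A \<box>\<^sub>o (Vn C V 2 \<box>\<^sub>o B)\<close>.\<close>

definition Rel :: "('o, 'm, 'x) abelian_monoidal_category_scheme \<Rightarrow> 'o \<Rightarrow> 'o \<Rightarrow> 'o \<Rightarrow> 'm"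
  where "Rel C V A B = im C
    (sandwich C A
      ((tau C V \<cdot>\<^bsub>C\<^esub> bi_pr1 C V (Vn C V 2)) \<oplus>\<^bsub>C\<^esub> bi_pr2 C V (Vn C V 2)) B \<cdot>\<^bsub>C\<^esub>
     multilinear C A V (Vn C V 2) B)"

text \<open>The inclusion of the \<open>i\<close>-th relation object into \<open>Vn C V n\<close>, for \<open>i + 2 \<le> n\<close>.\<close>

definition RelV :: "('o, 'm, 'x) abelian_monoidal_category_scheme \<Rightarrow> 'o \<Rightarrow> nat \<Rightarrow> nat \<Rightarrow> 'm"
  where "RelV C V n i =
    Vcat C V i (n - i) \<cdot>\<^bsub>C\<^esub> (Id C (Vn C V i) \<box>\<^bsub>C\<^esub> Vcat C V 2 (n - i - 2)) \<cdot>\<^bsub>C\<^esub>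
    Rel C V (Vn C V i) (Vn C V (n - i - 2))"

text \<open>
  The quotient map from \<open>Vn C V n\<close> onto its quotient by the relations.  For \<open>n < 2\<close> the direct
  sum is empty and the map is an isomorphism: the quotients of \<open>Unit C\<close> and \<open>Vplus C V\<close> are
  these objects up to \<open>quot C V 0\<close> and \<open>quot C V 1\<close>.
\<close>

definition quot :: "('o, 'm, 'x) abelian_monoidal_category_scheme \<Rightarrow> 'o \<Rightarrow> nat \<Rightarrow> 'm"
  where "quot C V n = coker C
    (copair C {i. i + 2 \<le> n} (\<lambda>i. Dom C (RelV C V n i)) (Vn C V n) (RelV C V n))"

definition Vtilde :: "('o, 'm, 'x) abelian_monoidal_category_scheme \<Rightarrow> 'o \<Rightarrow> nat \<Rightarrow> 'o"
  where "Vtilde C V n = Cod C (quot C V n)"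

text \<open>The map from \<open>Vn C V n\<close> to \<open>Vn C V (Suc n)\<close> inserting the unit after \<open>i\<close> factors.\<close>

definition eta :: "('o, 'm, 'x) abelian_monoidal_category_scheme \<Rightarrow> 'o \<Rightarrow> nat \<Rightarrow> nat \<Rightarrow> 'm"
  where "eta C V n i =
    Vcat C V i (Suc (n - i)) \<cdot>\<^bsub>C\<^esub>
    (Id C (Vn C V i) \<box>\<^bsub>C\<^esub>
      (Vcat C V 1 (n - i) \<cdot>\<^bsub>C\<^esub> (in_unit C V \<box>\<^bsub>C\<^esub> Id C (Vn C V (n - i))) \<cdot>\<^bsub>C\<^esub>
       inverse_arr C (Lunit C (Vn C V (n - i))))) \<cdot>\<^bsub>C\<^esub>
    inverse_arr C (Vcat C V i (n - i))"

definition eta_tilde :: "('o, 'm, 'x) abelian_monoidal_category_scheme \<Rightarrow> 'o \<Rightarrow> nat \<Rightarrow> 'm"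
  where "eta_tilde C V n =
    (THE g. g \<in> hom C (Vtilde C V n) (Vtilde C V (Suc n)) \<and>
      (\<forall>i\<le>n. g \<cdot>\<^bsub>C\<^esub> quot C V n = quot C V (Suc n) \<cdot>\<^bsub>C\<^esub> eta C V n i))"

definition free_obj :: "('o, 'm, 'x) abelian_monoidal_category_scheme \<Rightarrow> 'o \<Rightarrow> 'o"
  where "free_obj C V = fst (seq_colimit C (Vtilde C V) (eta_tilde C V))"

definition free_in :: "('o, 'm, 'x) abelian_monoidal_category_scheme \<Rightarrow> 'o \<Rightarrow> nat \<Rightarrow> 'm"
  where "free_in C V = snd (seq_colimit C (Vtilde C V) (eta_tilde C V))"

definition free_unit :: "('o, 'm, 'x) abelian_monoidal_category_scheme \<Rightarrow> 'o \<Rightarrow> 'm"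
  where "free_unit C V = free_in C V 0 \<cdot>\<^bsub>C\<^esub> quot C V 0"

definition free_mult :: "('o, 'm, 'x) abelian_monoidal_category_scheme \<Rightarrow> 'o \<Rightarrow> 'm"
  where "free_mult C V =
    (THE m. m \<in> hom C (free_obj C V \<box>\<^sub>o\<^bsub>C\<^esub> free_obj C V) (free_obj C V) \<and>
      (\<forall>n k. m \<cdot>\<^bsub>C\<^esub> ((free_in C V n \<cdot>\<^bsub>C\<^esub> quot C V n) \<box>\<^bsub>C\<^esub> (free_in C V k \<cdot>\<^bsub>C\<^esub> quot C V k)) =
        free_in C V (n + k) \<cdot>\<^bsub>C\<^esub> quot C V (n + k) \<cdot>\<^bsub>C\<^esub> Vcat C V n k))"

definition free_gen :: "('o, 'm, 'x) abelian_monoidal_category_scheme \<Rightarrow> 'o \<Rightarrow> 'm"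
  where "free_gen C V = free_in C V 1 \<cdot>\<^bsub>C\<^esub> quot C V 1 \<cdot>\<^bsub>C\<^esub> in_V C V"

end

theory Submission
  imports Defs
begin

text \<open>
  Let \<open>P = Vplus C V\<close>.  Words in \<open>V\<close> and the unit are multiplied by
  concatenation, and \<open>tau C V\<close> declares that the position of the unit in a word is immaterial.  So a
  monoid homomorphism out of the free monoid should be nothing but an arrow \<open>f\<close> out of \<open>V\<close>, extended
  to a word by multiplying the values of its letters.  The difficulty is that the monoidal product
  need not be additive.  Tensoring then need not preserve direct sums and cokernels, and it is not
  clear that a quotient of tensor powers has a tensor product that is again such a quotient, as is
  necessary for concatenation to pass to the quotient.

  The way out is to describe all quotients by reflexive coequalizers, which tensoring preserves.
  The cokernel of an arrow \<open>f\<close> is the coequalizer of \<open>f \<cdot> p1 \<oplus> p2\<close> and \<open>p2\<close>, a pair with the second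
  injection as common section (\<open>cokernel_is_reflexive_coequalizer\<close>).  For \<open>f = tau C V\<close> call this pair
  \<open>rel0\<close>, \<open>rel1\<close>.  The multilinear part is the kernel of the split epimorphism \<open>rel1\<close> tensored on both
  sides, and therefore killing the relation object of \<open>A\<close> and \<open>B\<close> is the same as coequalizing \<open>rel0\<close> and
  \<open>rel1\<close> tensored with \<open>A\<close> and \<open>B\<close> (\<open>Rel_kills_iff\<close>).  This explains the form of the relations.

  The key step is \<open>quot_extend\<close>: for every functor \<open>T\<close> preserving reflexive coequalizers, an arrow
  out of \<open>T\<close> of a tensor power factors through \<open>T\<close> of the quotient as soon as it coequalizes the pair
  at each position separately.  Adding the sequential colimit, an arrow out of \<open>T\<close> of the free monoid
  is the same as a family of arrows out of \<open>T\<close> of the tensor powers that respects the relations and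
  the insertion of the unit (\<open>word_extend\<close>, \<open>word_jointly_epi\<close>).

  The rest applies this universal property to functors \<open>T\<close> composed of tensorings.  Applied once in
  each variable it yields the multiplication (\<open>ex_mult\<close>), and equations between arrows out of products
  of the free monoid may be checked on words.  There the monoid laws become the coherence of the
  concatenation isomorphisms \<open>tcat\<close>, which follows from the pentagon and Kelly's unit equations
  (\<open>tcat_assoc\<close>, \<open>tcat_0_right\<close>).  With \<open>T\<close> the identity it yields the extension of \<open>f\<close>, whose
  value on words respects the relations by the unit laws of the target (\<open>mult_pow_kills_tau\<close>).
\<close>


section \<open>Calculating with arrows\<close>

context category
begin

text \<open>
  Typing is carried by equations for domains and codomains: with them as rewrite rules the
  simplifier decides by itself which arrows are composable.
\<close>

lemma mem_hom [simp]: "f \<in> hom C X Y \<longleftrightarrow> f \<in> Arr C \<and> Dom C f = X \<and> Cod C f = Y"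
  by (simp add: hom_def)

lemma dom_cod_obj [simp]:
  "f \<in> Arr C \<Longrightarrow> Dom C f \<in> Obj C" "f \<in> Arr C \<Longrightarrow> Cod C f \<in> Obj C"
  by (auto intro: dom_obj cod_obj)

lemma Id_typing [simp]:
  "X \<in> Obj C \<Longrightarrow> Id C X \<in> Arr C"
  "X \<in> Obj C \<Longrightarrow> Dom C (Id C X) = X"
  "X \<in> Obj C \<Longrightarrow> Cod C (Id C X) = X"
  using id_hom[of X] by auto

lemma comp_typing [simp]:
  assumes "f \<in> Arr C" "g \<in> Arr C" "Dom C g = Cod C f"
  shows "g \<cdot> f \<in> Arr C" "Dom C (g \<cdot> f) = Dom C f" "Cod C (g \<cdot> f) = Cod C g"
  using comp_hom[of f "Dom C f" "Cod C f" g "Cod C g"] assms by auto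

lemma comp_Id [simp]:
  "f \<in> Arr C \<Longrightarrow> Dom C f = X \<Longrightarrow> f \<cdot> Id C X = f"
  "f \<in> Arr C \<Longrightarrow> Cod C f = X \<Longrightarrow> Id C X \<cdot> f = f"
  using comp_id[of f X "Cod C f"] id_comp[of f "Dom C f" X] by auto

lemma comp_reassoc [simp]:
  assumes "f \<in> Arr C" "g \<in> Arr C" "h \<in> Arr C" "Dom C g = Cod C f" "Dom C h = Cod C g"
  shows "(h \<cdot> g) \<cdot> f = h \<cdot> g \<cdot> f"
  using comp_assoc[of f "Dom C f" "Cod C f" g "Cod C g" h "Cod C h"] assms by auto

text \<open>
  Composites are normalised by bracketing to the right, which hides a factor \<open>h \<cdot> g\<close> in front of
  a further arrow; this rule reaches it there.
\<close>

lemma comp_precomp: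
  assumes "h \<cdot> g = k" "f \<in> Arr C" "g \<in> Arr C" "h \<in> Arr C" "Dom C g = Cod C f" "Dom C h = Cod C g"
  shows "h \<cdot> g \<cdot> f = k \<cdot> f"
  using assms comp_reassoc by metis

lemma is_inverse_unique:
  assumes "is_inverse C f g" "is_inverse C f h"
  shows "g = h"
proof -
  note assms' = assms[unfolded is_inverse_def]
  have "g = g \<cdot> f \<cdot> h"
    using assms' by simp
  also have "\<dots> = (g \<cdot> f) \<cdot> h"
    using assms' by (subst comp_reassoc) auto
  also have "\<dots> = h"
    using assms' by (simp del: comp_reassoc)
  finally show ?thesis .
qed

lemma inverse_arr_eq: "is_inverse C f g \<Longrightarrow> inverse_arr C f = g"
  unfolding inverse_arr_def by (blast intro: the_equality is_inverse_unique)

lemma is_iso_arr: "is_iso C f \<Longrightarrow> f \<in> Arr C"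
  by (auto simp: is_iso_def is_inverse_def)

lemma inverse_arr_is_inverse: "is_iso C f \<Longrightarrow> is_inverse C f (inverse_arr C f)"
  using inverse_arr_eq by (auto simp: is_iso_def)

lemma inverse_typing [simp]:
  assumes "is_iso C f"
  shows "inverse_arr C f \<in> Arr C" "Dom C (inverse_arr C f) = Cod C f"
    "Cod C (inverse_arr C f) = Dom C f"
    "inverse_arr C f \<cdot> f = Id C (Dom C f)" "f \<cdot> inverse_arr C f = Id C (Cod C f)"
  using inverse_arr_is_inverse[OF assms] by (auto simp: is_inverse_def)

lemma inverse_cancel [simp]:
  assumes "is_iso C f" "g \<in> Arr C"
  shows "Cod C g = Dom C f \<Longrightarrow> inverse_arr C f \<cdot> f \<cdot> g = g"
    "Cod C g = Cod C f \<Longrightarrow> f \<cdot> inverse_arr C f \<cdot> g = g"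
  using assms is_iso_arr[OF assms(1)]
  by (simp_all flip: comp_reassoc)

lemma is_isoI:
  assumes "f \<in> Arr C" "g \<in> hom C (Cod C f) (Dom C f)" "g \<cdot> f = Id C (Dom C f)"
    "f \<cdot> g = Id C (Cod C f)"
  shows "is_iso C f"
  using assms unfolding is_iso_def is_inverse_def by auto

lemma is_iso_Id [simp]: "X \<in> Obj C \<Longrightarrow> is_iso C (Id C X)"
  by (rule is_isoI[where g = "Id C X"]) auto

lemma is_iso_comp [simp]:
  assumes "is_iso C f" "is_iso C g" "Dom C g = Cod C f"
  shows "is_iso C (g \<cdot> f)"
  using assms is_iso_arr[OF assms(1)] is_iso_arr[OF assms(2)]
  by (intro is_isoI[where g = "inverse_arr C f \<cdot> inverse_arr C g"]) auto

lemma iso_cancel_right: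
  assumes "is_iso C f" "g \<in> Arr C" "h \<in> Arr C" "Dom C g = Cod C f" "Dom C h = Cod C f"
    and "g \<cdot> f = h \<cdot> f"
  shows "g = h"
proof -
  note [simp] = assms(1-5) is_iso_arr[OF assms(1)]
  have "g = (g \<cdot> f) \<cdot> inverse_arr C f" by simp
  also have "\<dots> = (h \<cdot> f) \<cdot> inverse_arr C f" by (simp only: assms(6))
  also have "\<dots> = h" by simp
  finally show ?thesis .
qed

lemma iso_cancel_left:
  assumes "is_iso C f" "g \<in> Arr C" "h \<in> Arr C" "Cod C g = Dom C f" "Cod C h = Dom C f"
    and "f \<cdot> g = f \<cdot> h"
  shows "g = h"
proof -
  note [simp] = assms(1-5) is_iso_arr[OF assms(1)]
  have "g = inverse_arr C f \<cdot> (f \<cdot> g)" by simp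
  also have "\<dots> = inverse_arr C f \<cdot> (f \<cdot> h)" by (simp only: assms(6))
  also have "\<dots> = h" by simp
  finally show ?thesis .
qed

lemma coequalizer_factor:
  assumes "is_coequalizer C d0 d1 q" "g \<in> Arr C" "Dom C g = Cod C d0" "g \<cdot> d0 = g \<cdot> d1"
  obtains h where "h \<in> hom C (Cod C q) (Cod C g)" "h \<cdot> q = g"
proof -
  have "g \<in> hom C (Cod C d0) (Cod C g)" "Cod C g \<in> Obj C"
    using assms(2,3) by simp_all
  moreover have "\<forall>Y\<in>Obj C. \<forall>g\<in>hom C (Cod C d0) Y. g \<cdot> d0 = g \<cdot> d1 \<longrightarrow>
      (\<exists>!h. h \<in> hom C (Cod C q) Y \<and> h \<cdot> q = g)"
    using assms(1) unfolding is_coequalizer_def by (elim conjE)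
  ultimately have "\<exists>!h. h \<in> hom C (Cod C q) (Cod C g) \<and> h \<cdot> q = g"
    using assms(4) by (simp del: mem_hom)
  then show thesis using that by blast
qed

lemma coequalizer_epi:
  assumes "is_coequalizer C d0 d1 q" "g \<in> hom C (Cod C q) Z" "h \<in> hom C (Cod C q) Z"
    "g \<cdot> q = h \<cdot> q"
  shows "g = h"
proof -
  have [simp]: "q \<in> Arr C" "d0 \<in> Arr C" "d1 \<in> Arr C" "Dom C q = Cod C d0" "q \<cdot> d0 = q \<cdot> d1"
    "Dom C d1 = Dom C d0" "Cod C d1 = Cod C d0"
    using assms(1) unfolding is_coequalizer_def by simp_all
  have "h \<cdot> q \<in> hom C (Cod C d0) Z" "Z \<in> Obj C" "(h \<cdot> q) \<cdot> d0 = (h \<cdot> q) \<cdot> d1"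
    using assms(3) by auto
  moreover have "\<forall>Y\<in>Obj C. \<forall>g\<in>hom C (Cod C d0) Y. g \<cdot> d0 = g \<cdot> d1 \<longrightarrow>
      (\<exists>!h. h \<in> hom C (Cod C q) Y \<and> h \<cdot> q = g)"
    using assms(1) unfolding is_coequalizer_def by (elim conjE)
  ultimately have "\<exists>!k. k \<in> hom C (Cod C q) Z \<and> k \<cdot> q = h \<cdot> q"
    by (simp del: mem_hom)
  then show ?thesis using assms(2-4) by blast
qed

lemma seq_colimit_factor:
  assumes "is_seq_colimit C X f L j" "is_cocone C X f Y g"
  obtains h where "h \<in> hom C L Y" "\<And>n. h \<cdot> j n = g n"
  using assms unfolding is_seq_colimit_def by blast

lemma seq_colimit_jointly_epi:
  assumes "is_seq_colimit C X f L j" "g \<in> hom C L Y" "h \<in> hom C L Y" "\<And>n. g \<cdot> j n = h \<cdot> j n"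
  shows "g = h"
proof -
  have [simp]: "j n \<in> Arr C" "Cod C (j n) = L" "Dom C (j n) = X n" for n
    using assms(1) by (auto simp: is_seq_colimit_def is_cocone_def)
  have [simp]: "f n \<in> Arr C" "Cod C (f n) = X (Suc n)" "Dom C (f n) = X n" "j (Suc n) \<cdot> f n = j n" for n
    using assms(1) by (auto simp: is_seq_colimit_def is_cocone_def is_sequence_def)
  have "is_cocone C X f Y (\<lambda>n. h \<cdot> j n)"
    using assms(3) unfolding is_cocone_def by auto
  then have "\<exists>!k. k \<in> hom C L Y \<and> (\<forall>n. k \<cdot> j n = h \<cdot> j n)"
    using assms(1) unfolding is_seq_colimit_def by blast
  then show ?thesis using assms by blast
qed

end


section \<open>Preadditive categories\<close>

context preadditive_category
begin

lemma add_typing [simp]: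
  assumes "f \<in> Arr C" "g \<in> Arr C" "Dom C g = Dom C f" "Cod C g = Cod C f"
  shows "f \<oplus> g \<in> Arr C" "Dom C (f \<oplus> g) = Dom C f" "Cod C (f \<oplus> g) = Cod C f"
  using add_hom[of f "Dom C f" "Cod C f" g] assms by auto

lemma Zero_typing [simp]:
  assumes "X \<in> Obj C" "Y \<in> Obj C"
  shows "Zero C X Y \<in> Arr C" "Dom C (Zero C X Y) = X" "Cod C (Zero C X Y) = Y"
  using zero_hom[OF assms] by auto

lemma add_Zero [simp]:
  "f \<in> Arr C \<Longrightarrow> Dom C f = X \<Longrightarrow> Cod C f = Y \<Longrightarrow> f \<oplus> Zero C X Y = f"
  "f \<in> Arr C \<Longrightarrow> Dom C f = X \<Longrightarrow> Cod C f = Y \<Longrightarrow> Zero C X Y \<oplus> f = f"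
  using add_zero[of f X Y] add_comm[of f X Y "Zero C X Y"] zero_hom[of X Y] by auto

lemma comp_distrib:
  assumes "f \<in> Arr C" "g \<in> Arr C" "Dom C g = Dom C f" "Cod C g = Cod C f" "h \<in> Arr C"
  shows "Dom C h = Cod C f \<Longrightarrow> h \<cdot> (f \<oplus> g) = h \<cdot> f \<oplus> h \<cdot> g"
    "Cod C h = Dom C f \<Longrightarrow> (f \<oplus> g) \<cdot> h = f \<cdot> h \<oplus> g \<cdot> h"
  using comp_add[of f "Dom C f" "Cod C f" g h "Cod C h"]
    add_comp[of f "Dom C f" "Cod C f" g h "Dom C h"] assms by auto

lemma add_cancel_left:
  assumes "f \<in> hom C X Y" "g \<in> hom C X Y" "h \<in> hom C X Y" "f \<oplus> g = f \<oplus> h"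
  shows "g = h"
proof -
  obtain n where n: "n \<in> hom C X Y" "f \<oplus> n = Zero C X Y"
    using add_neg[OF assms(1)] by blast
  have "(n \<oplus> f) \<oplus> g = (n \<oplus> f) \<oplus> h"
    using add_assoc[OF n(1) assms(1,2)] add_assoc[OF n(1) assms(1,3)] assms(4) by simp
  then show ?thesis using n assms add_comm[OF n(1) assms(1)] by auto
qed

lemma add_idem_Zero:
  assumes "f \<in> hom C X Y" "f \<oplus> f = f"
  shows "f = Zero C X Y"
  using add_cancel_left[of f X Y f "Zero C X Y"] assms dom_cod_obj[of f] by auto

text \<open>
  By distributivity each of these composites is its own double.
\<close>

lemma comp_Zero [simp]:
  assumes "f \<in> Arr C" "W \<in> Obj C"
  shows "Dom C f = Y \<Longrightarrow> f \<cdot> Zero C W Y = Zero C W (Cod C f)"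
    "Cod C f = X \<Longrightarrow> Zero C X W \<cdot> f = Zero C (Dom C f) W"
proof -
  show "f \<cdot> Zero C W Y = Zero C W (Cod C f)" if "Dom C f = Y"
    using assms that comp_distrib(1)[of "Zero C W Y" "Zero C W Y" f]
    by (intro add_idem_Zero) auto
  show "Zero C X W \<cdot> f = Zero C (Dom C f) W" if "Cod C f = X"
    using assms that comp_distrib(2)[of "Zero C X W" "Zero C X W" f]
    by (intro add_idem_Zero) auto
qed

lemma neg_props:
  assumes "f \<in> Arr C"
  shows "neg C f \<in> Arr C" "Dom C (neg C f) = Dom C f" "Cod C (neg C f) = Cod C f"
    "f \<oplus> neg C f = Zero C (Dom C f) (Cod C f)"
proof -
  have f: "f \<in> hom C (Dom C f) (Cod C f)" using assms by simp
  obtain g where g: "g \<in> hom C (Dom C f) (Cod C f)" "f \<oplus> g = Zero C (Dom C f) (Cod C f)"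
    using add_neg[OF f] by blast
  have "\<exists>!g. g \<in> hom C (Dom C f) (Cod C f) \<and> f \<oplus> g = Zero C (Dom C f) (Cod C f)"
    using g add_cancel_left[OF f] by (metis (no_types, lifting))
  from theI'[OF this] show "neg C f \<in> Arr C" "Dom C (neg C f) = Dom C f"
    "Cod C (neg C f) = Cod C f" "f \<oplus> neg C f = Zero C (Dom C f) (Cod C f)"
    unfolding neg_def by auto
qed

lemmas neg_typing [simp] = neg_props(1-3)

lemma add_sub:
  assumes "f \<in> Arr C" "g \<in> Arr C" "Dom C g = Dom C f" "Cod C g = Cod C f"
  shows "f \<oplus> (g \<oplus> neg C f) = g"
proof -
  have f: "f \<in> hom C (Dom C f) (Cod C f)" and g: "g \<in> hom C (Dom C f) (Cod C f)"
    and n: "neg C f \<in> hom C (Dom C f) (Cod C f)"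
    using assms by auto
  have "f \<oplus> (g \<oplus> neg C f) = (g \<oplus> neg C f) \<oplus> f"
    by (rule add_comm[OF f add_hom[OF g n]])
  also have "\<dots> = g \<oplus> (neg C f \<oplus> f)"
    by (rule add_assoc[OF g n f])
  also have "neg C f \<oplus> f = Zero C (Dom C f) (Cod C f)"
    using add_comm[OF n f] neg_props(4)[OF assms(1)] by simp
  finally show ?thesis using assms by simp
qed

lemma biproduct_cases:
  assumes "is_biproduct C X Y (S, i1, i2, p1, p2)"
  shows "S \<in> Obj C" "i1 \<in> Arr C" "Dom C i1 = X" "Cod C i1 = S"
    "i2 \<in> Arr C" "Dom C i2 = Y" "Cod C i2 = S"
    "p1 \<in> Arr C" "Dom C p1 = S" "Cod C p1 = X"
    "p2 \<in> Arr C" "Dom C p2 = S" "Cod C p2 = Y"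
    "p1 \<cdot> i1 = Id C X" "p2 \<cdot> i2 = Id C Y" "p1 \<cdot> i2 = Zero C Y X" "p2 \<cdot> i1 = Zero C X Y"
    "i1 \<cdot> p1 \<oplus> i2 \<cdot> p2 = Id C S"
  using assms unfolding is_biproduct_def prod.case mem_hom by blast+

end


section \<open>Abelian categories\<close>

context abelian_category
begin

lemma ker_is_kernel: "f \<in> Arr C \<Longrightarrow> is_kernel C f (ker C f)"
  unfolding ker_def by (rule someI_ex) (rule ex_kernel)

lemma coker_is_cokernel: "f \<in> Arr C \<Longrightarrow> is_cokernel C f (coker C f)"
  unfolding coker_def by (rule someI_ex) (rule ex_cokernel)

lemma ker_typing [simp]:
  assumes "f \<in> Arr C"
  shows "ker C f \<in> Arr C" "Cod C (ker C f) = Dom C f"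
    "f \<cdot> ker C f = Zero C (Dom C (ker C f)) (Cod C f)"
  using ker_is_kernel[OF assms] unfolding is_kernel_def by simp_all

lemma coker_typing [simp]:
  assumes "f \<in> Arr C"
  shows "coker C f \<in> Arr C" "Dom C (coker C f) = Cod C f"
    "coker C f \<cdot> f = Zero C (Dom C f) (Cod C (coker C f))"
  using coker_is_cokernel[OF assms] unfolding is_cokernel_def by simp_all

lemma kernel_factor:
  assumes "is_kernel C f k" "g \<in> Arr C" "Cod C g = Dom C f" "f \<cdot> g = Zero C (Dom C g) (Cod C f)"
  obtains h where "h \<in> hom C (Dom C g) (Dom C k)" "k \<cdot> h = g"
proof -
  have "g \<in> hom C (Dom C g) (Dom C f)" "Dom C g \<in> Obj C"
    using assms(2,3) by simp_all
  moreover have "\<forall>W\<in>Obj C. \<forall>g\<in>hom C W (Dom C f). f \<cdot> g = Zero C W (Cod C f) \<longrightarrow>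
      (\<exists>!h. h \<in> hom C W (Dom C k) \<and> k \<cdot> h = g)"
    using assms(1) unfolding is_kernel_def by (elim conjE)
  ultimately have "\<exists>!h. h \<in> hom C (Dom C g) (Dom C k) \<and> k \<cdot> h = g"
    using assms(4) by (simp del: mem_hom)
  then show thesis using that by blast
qed

lemma cokernel_factor:
  assumes "is_cokernel C f c" "g \<in> Arr C" "Dom C g = Cod C f" "g \<cdot> f = Zero C (Dom C f) (Cod C g)"
  obtains h where "h \<in> hom C (Cod C c) (Cod C g)" "h \<cdot> c = g"
proof -
  have "g \<in> hom C (Cod C f) (Cod C g)" "Cod C g \<in> Obj C"
    using assms(2,3) by simp_all
  moreover have "\<forall>Z\<in>Obj C. \<forall>g\<in>hom C (Cod C f) Z. g \<cdot> f = Zero C (Dom C f) Z \<longrightarrow>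
      (\<exists>!h. h \<in> hom C (Cod C c) Z \<and> h \<cdot> c = g)"
    using assms(1) unfolding is_cokernel_def by (elim conjE)
  ultimately have "\<exists>!h. h \<in> hom C (Cod C c) (Cod C g) \<and> h \<cdot> c = g"
    using assms(4) by (simp del: mem_hom)
  then show thesis using that by blast
qed

lemma biproduct_is_biproduct:
  assumes "X \<in> Obj C" "Y \<in> Obj C"
  shows "is_biproduct C X Y
    (bi_obj C X Y, bi_in1 C X Y, bi_in2 C X Y, bi_pr1 C X Y, bi_pr2 C X Y)"
proof -
  have "is_biproduct C X Y (biproduct C X Y)"
    unfolding biproduct_def by (rule someI_ex) (rule ex_biproduct[OF assms])
  then show ?thesis
    unfolding bi_obj_def bi_in1_def bi_in2_def bi_pr1_def bi_pr2_def
    by (cases "biproduct C X Y") simp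
qed

lemmas bi_typing [simp] = biproduct_cases[OF biproduct_is_biproduct]

lemma bi_hom_ext:
  assumes "X \<in> Obj C" "Y \<in> Obj C" "g \<in> hom C (bi_obj C X Y) Z" "h \<in> hom C (bi_obj C X Y) Z"
    and "g \<cdot> bi_in1 C X Y = h \<cdot> bi_in1 C X Y" "g \<cdot> bi_in2 C X Y = h \<cdot> bi_in2 C X Y"
  shows "g = h"
proof -
  have *: "k = (k \<cdot> bi_in1 C X Y) \<cdot> bi_pr1 C X Y \<oplus> (k \<cdot> bi_in2 C X Y) \<cdot> bi_pr2 C X Y"
    if "k \<in> hom C (bi_obj C X Y) Z" for k
  proof -
    have "k = k \<cdot> (bi_in1 C X Y \<cdot> bi_pr1 C X Y \<oplus> bi_in2 C X Y \<cdot> bi_pr2 C X Y)"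
      using that assms(1,2) by simp
    also have "\<dots> = (k \<cdot> bi_in1 C X Y) \<cdot> bi_pr1 C X Y \<oplus> (k \<cdot> bi_in2 C X Y) \<cdot> bi_pr2 C X Y"
      using that assms(1,2) by (subst comp_distrib) simp_all
    finally show ?thesis .
  qed
  show ?thesis
    using *[OF assms(3)] *[OF assms(4)] assms(5,6) by simp
qed

lemma reflexive_pair_of_arrow:
  assumes "f \<in> Arr C"
  shows "f \<cdot> bi_pr1 C (Dom C f) (Cod C f) \<oplus> bi_pr2 C (Dom C f) (Cod C f)
      \<in> hom C (bi_obj C (Dom C f) (Cod C f)) (Cod C f)"
    and "(f \<cdot> bi_pr1 C (Dom C f) (Cod C f) \<oplus> bi_pr2 C (Dom C f) (Cod C f))
      \<cdot> bi_in2 C (Dom C f) (Cod C f) = Id C (Cod C f)"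
  using assms by (simp_all add: comp_distrib)

text \<open>
  Composing with the first injection turns the coequalizing condition into the killing of \<open>f\<close>,
  and the second injection is a common section.  This exhibits a cokernel as a kind of colimit
  that the monoidal product preserves, although tensoring need not be additive and need
  not preserve the cokernel diagram itself.
\<close>

lemma cokernel_is_reflexive_coequalizer:
  assumes "is_cokernel C f c"
  defines "p1 \<equiv> bi_pr1 C (Dom C f) (Cod C f)" and "p2 \<equiv> bi_pr2 C (Dom C f) (Cod C f)"
  shows "is_reflexive_coequalizer C (f \<cdot> p1 \<oplus> p2) p2 c"
proof -
  let ?i1 = "bi_in1 C (Dom C f) (Cod C f)"
  have [simp]: "f \<in> Arr C" "c \<in> Arr C" "Dom C c = Cod C f" "c \<cdot> f = Zero C (Dom C f) (Cod C c)"
    using assms(1) unfolding is_cokernel_def by simp_all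
  note pair [simp] = reflexive_pair_of_arrow[of f, folded p1_def p2_def, unfolded mem_hom]
  have [simp]: "p1 \<in> Arr C" "p2 \<in> Arr C" "Dom C p1 = bi_obj C (Dom C f) (Cod C f)"
    "Dom C p2 = bi_obj C (Dom C f) (Cod C f)" "Cod C p1 = Dom C f" "Cod C p2 = Cod C f"
    "p2 \<cdot> bi_in2 C (Dom C f) (Cod C f) = Id C (Cod C f)"
    "p1 \<cdot> ?i1 = Id C (Dom C f)" "p2 \<cdot> ?i1 = Zero C (Dom C f) (Cod C f)"
    by (simp_all add: p1_def p2_def)
  have c: "c \<cdot> (f \<cdot> p1 \<oplus> p2) = c \<cdot> p2"
    by (simp add: comp_distrib comp_precomp[of c f])
  have ex1: "\<exists>!h. h \<in> hom C (Cod C c) Y \<and> h \<cdot> c = g"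
    if Y: "Y \<in> Obj C" and g: "g \<in> hom C (Cod C f) Y" and eq: "g \<cdot> (f \<cdot> p1 \<oplus> p2) = g \<cdot> p2" for Y g
  proof -
    have [simp]: "g \<in> Arr C" "Dom C g = Cod C f" "Cod C g = Y" "Y \<in> Obj C"
      using g Y by simp_all
    have "g \<cdot> f = g \<cdot> ((f \<cdot> p1 \<oplus> p2) \<cdot> ?i1)"
      by (simp add: comp_distrib)
    also have "\<dots> = (g \<cdot> (f \<cdot> p1 \<oplus> p2)) \<cdot> ?i1"
      by simp
    also have "\<dots> = (g \<cdot> p2) \<cdot> ?i1"
      by (simp only: eq)
    also have "\<dots> = Zero C (Dom C f) Y"
      by simp
    finally show ?thesis
      using assms(1) Y g unfolding is_cokernel_def by blast
  qed
  have [simp]: "Dom C (f \<cdot> p1 \<oplus> p2) = bi_obj C (Dom C f) (Cod C f)"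
    "Cod C (f \<cdot> p1 \<oplus> p2) = Cod C f" "f \<cdot> p1 \<oplus> p2 \<in> Arr C"
    by simp_all
  show ?thesis
    unfolding is_reflexive_coequalizer_def is_coequalizer_def
    using c ex1 pair
    by (intro conjI bexI[where x = "bi_in2 C (Dom C f) (Cod C f)"] ballI impI) (simp_all del: mem_hom, simp_all)
qed

lemma comp_im_eq_Zero_iff:
  assumes "f \<in> Arr C" "g \<in> Arr C" "Dom C g = Cod C f"
  shows "g \<cdot> im C f = Zero C (Dom C (im C f)) (Cod C g) \<longleftrightarrow> g \<cdot> f = Zero C (Dom C f) (Cod C g)"
proof
  note [simp] = assms
  have im: "is_kernel C (coker C f) (im C f)"
    unfolding im_def by (rule ker_is_kernel) simp
  then have [simp]: "im C f \<in> Arr C" "Cod C (im C f) = Cod C f"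
    "coker C f \<cdot> im C f = Zero C (Dom C (im C f)) (Cod C (coker C f))"
    unfolding is_kernel_def by simp_all
  {
    assume *: "g \<cdot> im C f = Zero C (Dom C (im C f)) (Cod C g)"
    obtain h where "h \<in> hom C (Dom C f) (Dom C (im C f))" "im C f \<cdot> h = f"
      using kernel_factor[OF im, of f] by auto
    then have "h \<in> Arr C" "Dom C h = Dom C f" "Cod C h = Dom C (im C f)" "g \<cdot> f = (g \<cdot> im C f) \<cdot> h"
      by auto
    then show "g \<cdot> f = Zero C (Dom C f) (Cod C g)"
      by (simp add: * del: comp_reassoc)
  }
  {
    assume *: "g \<cdot> f = Zero C (Dom C f) (Cod C g)"
    obtain h where "h \<in> hom C (Cod C (coker C f)) (Cod C g)" "h \<cdot> coker C f = g"
      using cokernel_factor[OF coker_is_cokernel, of f g] * by auto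
    then have "h \<in> Arr C" "Dom C h = Cod C (coker C f)" "Cod C h = Cod C g"
      and eq: "g \<cdot> im C f = (h \<cdot> coker C f) \<cdot> im C f"
      by auto
    then show "g \<cdot> im C f = Zero C (Dom C (im C f)) (Cod C g)"
      unfolding eq by simp
  }
qed

text \<open>
  The section splits \<open>X\<close> into the image of \<open>s\<close>, where \<open>d0\<close> and \<open>d1\<close> agree anyway, and the kernel of
  \<open>d1\<close>; so all that remains is the vanishing of \<open>g \<cdot> d0\<close> on that kernel.  If \<open>d1\<close> is a projection
  tensored on both sides, its kernel is the multilinear part and the image is a relation object.
\<close>

lemma coequalizes_iff_kills_im:
  assumes "d0 \<in> hom C X Y" "d1 \<in> hom C X Y" "s \<in> hom C Y X"
    and "d0 \<cdot> s = Id C Y" "d1 \<cdot> s = Id C Y" and "g \<in> hom C Y Z"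
  defines "r \<equiv> im C (d0 \<cdot> ker C d1)"
  shows "g \<cdot> d0 = g \<cdot> d1 \<longleftrightarrow> g \<cdot> r = Zero C (Dom C r) Z"
proof -
  have [simp]: "d0 \<in> Arr C" "Dom C d0 = X" "Cod C d0 = Y" "d1 \<in> Arr C" "Dom C d1 = X" "Cod C d1 = Y"
    "s \<in> Arr C" "Dom C s = Y" "Cod C s = X" "g \<in> Arr C" "Dom C g = Y" "Cod C g = Z"
    "X \<in> Obj C" "Y \<in> Obj C" "Z \<in> Obj C"
    using assms(1-3,6) by auto
  let ?k = "ker C d1"
  have "g \<cdot> r = Zero C (Dom C r) Z \<longleftrightarrow> g \<cdot> (d0 \<cdot> ?k) = Zero C (Dom C ?k) Z"
    unfolding r_def using comp_im_eq_Zero_iff[of "d0 \<cdot> ?k" g] by simp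
  also have "\<dots> \<longleftrightarrow> g \<cdot> d0 = g \<cdot> d1"
  proof
    assume "g \<cdot> d0 = g \<cdot> d1"
    then have "(g \<cdot> d0) \<cdot> ?k = (g \<cdot> d1) \<cdot> ?k" by simp
    then show "g \<cdot> (d0 \<cdot> ?k) = Zero C (Dom C ?k) Z" by simp
  next
    assume gk: "g \<cdot> (d0 \<cdot> ?k) = Zero C (Dom C ?k) Z"
    define m where "m = Id C X \<oplus> neg C (s \<cdot> d1)"
    have [simp]: "m \<in> Arr C" "Dom C m = X" "Cod C m = X"
      by (simp_all add: m_def)
    have split: "s \<cdot> d1 \<oplus> m = Id C X"
      unfolding m_def by (rule add_sub) simp_all
    have "d1 \<oplus> d1 \<cdot> m = d1 \<cdot> (s \<cdot> d1 \<oplus> m)"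
      using assms(5) by (simp add: comp_distrib comp_precomp[of d1 s])
    then have "d1 \<oplus> d1 \<cdot> m = d1 \<oplus> Zero C X Y"
      by (simp add: split)
    then have "d1 \<cdot> m = Zero C X Y"
      using add_cancel_left[of d1 X Y "d1 \<cdot> m" "Zero C X Y"] by simp
    then obtain t where t: "t \<in> hom C X (Dom C ?k)" "?k \<cdot> t = m"
      using kernel_factor[OF ker_is_kernel, of d1 m] by auto
    then have [simp]: "t \<in> Arr C" "Dom C t = X" "Cod C t = Dom C ?k" by simp_all
    have "g \<cdot> (d0 \<cdot> m) = (g \<cdot> (d0 \<cdot> ?k)) \<cdot> t"
      by (simp add: t(2))
    also have "\<dots> = Zero C X Z"
      unfolding gk by simp
    finally have gm: "g \<cdot> (d0 \<cdot> m) = Zero C X Z" .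
    have "d0 = d0 \<cdot> (s \<cdot> d1 \<oplus> m)"
      by (simp add: split)
    also have "\<dots> = d1 \<oplus> d0 \<cdot> m"
      using assms(4) by (simp add: comp_distrib comp_precomp[of d0 s])
    finally have "g \<cdot> d0 = g \<cdot> (d1 \<oplus> d0 \<cdot> m)"
      by simp
    then show "g \<cdot> d0 = g \<cdot> d1"
      by (simp add: comp_distrib gm)
  qed
  finally show ?thesis by simp
qed


section \<open>Finite coproducts\<close>

text \<open>
  The typical example is the set of all arrows into \<open>Y\<close> that a given test cannot see.  Closure
  under sums lets such a test pass from the summands of a finite coproduct to the coproduct.
\<close>

definition arrow_ideal :: "'o \<Rightarrow> 'm set \<Rightarrow> bool"
  where "arrow_ideal Y N \<longleftrightarrow>
    (\<forall>f\<in>N. f \<in> Arr C \<and> Cod C f = Y) \<and> (\<forall>X\<in>Obj C. Zero C X Y \<in> N) \<and>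
    (\<forall>f\<in>N. \<forall>k\<in>Arr C. Cod C k = Dom C f \<longrightarrow> f \<cdot> k \<in> N) \<and>
    (\<forall>f\<in>N. \<forall>g\<in>N. Dom C g = Dom C f \<longrightarrow> f \<oplus> g \<in> N)"

lemma arrow_ideal_closed:
  assumes "arrow_ideal Y N" "f \<in> N"
  shows "k \<in> Arr C \<Longrightarrow> Cod C k = Dom C f \<Longrightarrow> f \<cdot> k \<in> N"
    and "g \<in> N \<Longrightarrow> Dom C g = Dom C f \<Longrightarrow> f \<oplus> g \<in> N"
  using assms unfolding arrow_ideal_def by blast+

text \<open>
  Finite coproducts are iterated biproducts.  An arrow out of a biproduct is the sum of its two
  components, each composed with a projection, so its membership in an ideal can be tested on
  the components.
\<close>

lemma ex_finite_coproduct: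
  assumes "finite J" "\<And>i. i \<in> J \<Longrightarrow> X i \<in> Obj C"
  shows "\<exists>S \<iota>. is_coproduct C J X S \<iota> \<and>
    (\<forall>Y N h. arrow_ideal Y N \<longrightarrow> h \<in> hom C S Y \<longrightarrow> (\<forall>i\<in>J. h \<cdot> \<iota> i \<in> N) \<longrightarrow> h \<in> N)"
  using assms
proof (induction J rule: finite_induct)
  case empty
  obtain Z where Z: "is_zero_object C Z" using ex_zero by blast
  then have ZO: "Z \<in> Obj C" unfolding is_zero_object_def by blast
  have uniq: "\<exists>!h. h \<in> hom C Z Y" if "Y \<in> Obj C" for Y
    using Z that unfolding is_zero_object_def by blast
  have "h \<in> N" if "arrow_ideal Y N" "h \<in> hom C Z Y" for Y N h
  proof -
    have Y: "Y \<in> Obj C" using that(2) by auto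
    then have "h = Zero C Z Y" using uniq[OF Y] that(2) zero_hom[OF ZO Y] by blast
    then show ?thesis using that(1) ZO unfolding arrow_ideal_def by blast
  qed
  moreover have "is_coproduct C {} X Z undefined"
    unfolding is_coproduct_def using ZO uniq by auto
  ultimately show ?case by blast
next
  case (insert j J)
  obtain S \<iota> where cop: "is_coproduct C J X S \<iota>"
    and ideal: "\<And>Y N h. arrow_ideal Y N \<Longrightarrow> h \<in> hom C S Y \<Longrightarrow> (\<forall>i\<in>J. h \<cdot> \<iota> i \<in> N) \<Longrightarrow> h \<in> N"
    using insert.IH insert.prems by blast
  have [simp]: "S \<in> Obj C" "X j \<in> Obj C"
    using cop insert.prems unfolding is_coproduct_def by auto
  have \<iota> [simp]: "\<iota> i \<in> Arr C" "Dom C (\<iota> i) = X i" "Cod C (\<iota> i) = S" if "i \<in> J" for i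
    using cop that unfolding is_coproduct_def by auto
  let ?S = "bi_obj C S (X j)"
  let ?i1 = "bi_in1 C S (X j)" let ?i2 = "bi_in2 C S (X j)"
  let ?p1 = "bi_pr1 C S (X j)" let ?p2 = "bi_pr2 C S (X j)"
  define \<kappa> where "\<kappa> = (\<lambda>i. if i = j then ?i2 else ?i1 \<cdot> \<iota> i)"
  have \<kappa>_j: "\<kappa> j = ?i2" by (simp add: \<kappa>_def)
  have \<kappa>_J: "\<kappa> i = ?i1 \<cdot> \<iota> i" if "i \<in> J" for i
    using that insert.hyps by (auto simp: \<kappa>_def)
  have "is_coproduct C (insert j J) X ?S \<kappa>"
    unfolding is_coproduct_def
  proof (intro conjI ballI allI impI)
    show "?S \<in> Obj C" by simp
    show "\<kappa> i \<in> hom C (X i) ?S" if "i \<in> insert j J" for i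
      using that \<kappa>_j \<kappa>_J by (cases "i = j") simp_all
    fix Y g assume Y: "Y \<in> Obj C" and g: "\<forall>i\<in>insert j J. g i \<in> hom C (X i) Y"
    then have "\<exists>!h. h \<in> hom C S Y \<and> (\<forall>i\<in>J. h \<cdot> \<iota> i = g i)"
      using cop unfolding is_coproduct_def by (simp del: mem_hom)
    then obtain h where h: "h \<in> Arr C" "Dom C h = S" "Cod C h = Y" "\<And>i. i \<in> J \<Longrightarrow> h \<cdot> \<iota> i = g i"
      and h_uniq: "\<And>h'. h' \<in> hom C S Y \<Longrightarrow> (\<forall>i\<in>J. h' \<cdot> \<iota> i = g i) \<Longrightarrow> h' = h"
      by auto
    have gj: "g j \<in> Arr C" "Dom C (g j) = X j" "Cod C (g j) = Y" using g by simp_all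
    let ?k = "h \<cdot> ?p1 \<oplus> g j \<cdot> ?p2"
    have k: "?k \<in> hom C ?S Y" "?k \<cdot> ?i1 = h" "?k \<cdot> ?i2 = g j"
      using h gj Y by (simp_all add: comp_distrib)
    show "\<exists>!k. k \<in> hom C ?S Y \<and> (\<forall>i\<in>insert j J. k \<cdot> \<kappa> i = g i)"
    proof (rule ex1I[of _ ?k])
      have "?k \<cdot> ?i1 \<cdot> \<iota> i = g i" if "i \<in> J" for i
        using comp_precomp[OF k(2), of "\<iota> i"] k(1) h(4) that by simp
      then show "?k \<in> hom C ?S Y \<and> (\<forall>i\<in>insert j J. ?k \<cdot> \<kappa> i = g i)"
        using k \<kappa>_j \<kappa>_J by (simp del: mem_hom)
      fix k' assume k': "k' \<in> hom C ?S Y \<and> (\<forall>i\<in>insert j J. k' \<cdot> \<kappa> i = g i)"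
      then have "k' \<in> Arr C" "Dom C k' = ?S" "Cod C k' = Y" by simp_all
      moreover have "k' \<cdot> \<kappa> i = g i" if "i \<in> J" for i
        using k' that by blast
      then have "(k' \<cdot> ?i1) \<cdot> \<iota> i = g i" if "i \<in> J" for i
        using calculation that by (simp add: \<kappa>_J)
      ultimately have "k' \<cdot> ?i1 = h"
        by (intro h_uniq) simp_all
      moreover have "k' \<cdot> ?i2 = g j" using k' \<kappa>_j by simp
      ultimately show "k' = ?k"
        using bi_hom_ext[of S "X j" k' Y ?k] k k' by simp
    qed
  qed
  moreover have "h \<in> N" if N: "arrow_ideal Y N" and h: "h \<in> hom C ?S Y"
    and hN: "\<forall>i\<in>insert j J. h \<cdot> \<kappa> i \<in> N" for Y N h
  proof -
    have [simp]: "h \<in> Arr C" "Dom C h = ?S" "Cod C h = Y" using h by simp_all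
    have "h \<cdot> \<kappa> i \<in> N" if "i \<in> J" for i
      using hN that by blast
    then have "(h \<cdot> ?i1) \<cdot> \<iota> i \<in> N" if "i \<in> J" for i
      using that by (simp add: \<kappa>_J)
    then have 1: "h \<cdot> ?i1 \<in> N" by (intro ideal[OF N]) simp_all
    have 2: "h \<cdot> ?i2 \<in> N" using hN \<kappa>_j by simp
    have "(h \<cdot> ?i1) \<cdot> ?p1 \<oplus> (h \<cdot> ?i2) \<cdot> ?p2 \<in> N"
      by (rule arrow_ideal_closed(2)[OF N arrow_ideal_closed(1)[OF N 1]
            arrow_ideal_closed(1)[OF N 2]]) simp_all
    also have "(h \<cdot> ?i1) \<cdot> ?p1 \<oplus> (h \<cdot> ?i2) \<cdot> ?p2 = h \<cdot> (?i1 \<cdot> ?p1 \<oplus> ?i2 \<cdot> ?p2)"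
      by (subst comp_distrib) simp_all
    finally show "h \<in> N" by simp
  qed
  ultimately show ?case by blast
qed

text \<open>
  The chosen coproduct need not be the iterated biproduct, but ideals are closed under
  precomposition and the comparison isomorphism carries the test on components across.
\<close>

lemma copair_props:
  assumes "finite J" "Y \<in> Obj C" "\<And>i. i \<in> J \<Longrightarrow> g i \<in> hom C (X i) Y"
  defines "h \<equiv> copair C J X Y g"
  shows "h \<in> Arr C" "Cod C h = Y"
    and "i \<in> J \<Longrightarrow> \<exists>k\<in>hom C (X i) (Dom C h). h \<cdot> k = g i"
    and "arrow_ideal Y N \<Longrightarrow> (\<And>i. i \<in> J \<Longrightarrow> g i \<in> N) \<Longrightarrow> h \<in> N"
proof -
  have X: "X i \<in> Obj C" if "i \<in> J" for i using assms(3)[OF that] dom_cod_obj(1)[of "g i"] by simp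
  from ex_finite_coproduct[OF assms(1), of X] X obtain S0 \<iota>0 where S0: "is_coproduct C J X S0 \<iota>0"
    and ideal: "\<And>Y N h. arrow_ideal Y N \<Longrightarrow> h \<in> hom C S0 Y \<Longrightarrow> (\<forall>i\<in>J. h \<cdot> \<iota>0 i \<in> N) \<Longrightarrow> h \<in> N"
    by blast
  obtain S \<iota> where cop: "coproduct C J X = (S, \<iota>)" by (cases "coproduct C J X")
  have "\<exists>d. (case d of (S, \<iota>) \<Rightarrow> is_coproduct C J X S \<iota>)" using S0 by auto
  from someI_ex[OF this] have S: "is_coproduct C J X S \<iota>"
    using cop unfolding coproduct_def by simp
  have [simp]: "S \<in> Obj C" "S0 \<in> Obj C" using S S0 unfolding is_coproduct_def by blast+
  have \<iota> [simp]: "\<iota> i \<in> Arr C" "Dom C (\<iota> i) = X i" "Cod C (\<iota> i) = S" if "i \<in> J" for i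
    using S that unfolding is_coproduct_def by auto
  have \<iota>0 [simp]: "\<iota>0 i \<in> Arr C" "Dom C (\<iota>0 i) = X i" "Cod C (\<iota>0 i) = S0" if "i \<in> J" for i
    using S0 that unfolding is_coproduct_def by auto
  have univ: "\<exists>!h. h \<in> hom C S Z \<and> (\<forall>i\<in>J. h \<cdot> \<iota> i = f i)"
    if "Z \<in> Obj C" "\<And>i. i \<in> J \<Longrightarrow> f i \<in> hom C (X i) Z" for Z f
    using S that unfolding is_coproduct_def by (simp del: mem_hom)
  have "h \<in> hom C S Y \<and> (\<forall>i\<in>J. h \<cdot> \<iota> i = g i)"
    unfolding h_def copair_def cop prod.case by (rule theI') (rule univ[OF assms(2,3)])
  then have h: "h \<in> Arr C" "Dom C h = S" "Cod C h = Y" and hg: "\<And>i. i \<in> J \<Longrightarrow> h \<cdot> \<iota> i = g i"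
    by simp_all
  show "h \<in> Arr C" "Cod C h = Y" by (fact h)+
  show "\<exists>k\<in>hom C (X i) (Dom C h). h \<cdot> k = g i" if "i \<in> J"
    using hg[OF that] h that by (intro bexI[of _ "\<iota> i"]) simp_all
  assume N: "arrow_ideal Y N" and gN: "\<And>i. i \<in> J \<Longrightarrow> g i \<in> N"
  have "\<exists>!u. u \<in> hom C S0 S \<and> (\<forall>i\<in>J. u \<cdot> \<iota>0 i = \<iota> i)"
    using S0 unfolding is_coproduct_def by simp
  then obtain u where u: "u \<in> Arr C" "Dom C u = S0" "Cod C u = S" "\<And>i. i \<in> J \<Longrightarrow> u \<cdot> \<iota>0 i = \<iota> i"
    by auto
  obtain v where v: "v \<in> Arr C" "Dom C v = S" "Cod C v = S0" "\<And>i. i \<in> J \<Longrightarrow> v \<cdot> \<iota> i = \<iota>0 i"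
    using univ[of S0 \<iota>0] by auto
  have "u \<cdot> v = Id C S"
  proof -
    have "(u \<cdot> v) \<cdot> \<iota> i = \<iota> i" if "i \<in> J" for i
      using u v that by simp
    moreover have "u \<cdot> v \<in> hom C S S"
      using u v by simp
    moreover have "\<exists>!w. w \<in> hom C S S \<and> (\<forall>i\<in>J. w \<cdot> \<iota> i = \<iota> i)"
      by (rule univ) simp_all
    moreover have "Id C S \<in> hom C S S \<and> (\<forall>i\<in>J. Id C S \<cdot> \<iota> i = \<iota> i)"
      by simp
    ultimately show ?thesis by blast
  qed
  moreover have hu: "h \<cdot> u \<in> N"
    using u h hg gN by (intro ideal[OF N]) simp_all
  have "(h \<cdot> u) \<cdot> v \<in> N"
    by (rule arrow_ideal_closed(1)[OF N hu]) (use u v h in simp_all)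
  ultimately show "h \<in> N" using u v h by simp
qed

end


section \<open>Coherence in a monoidal category\<close>

context abelian_monoidal_category
begin

lemma ten_obj_simp [simp]: "X \<in> Obj C \<Longrightarrow> Y \<in> Obj C \<Longrightarrow> X \<box>\<^sub>o Y \<in> Obj C"
  by (rule ten_obj)

lemma unit_obj_simp [simp]: "Unit C \<in> Obj C"
  by (rule unit_obj)

lemma ten_typing [simp]:
  assumes "f \<in> Arr C" "g \<in> Arr C"
  shows "f \<box> g \<in> Arr C" "Dom C (f \<box> g) = Dom C f \<box>\<^sub>o Dom C g" "Cod C (f \<box> g) = Cod C f \<box>\<^sub>o Cod C g"
  using ten_hom[of f "Dom C f" "Cod C f" g "Dom C g" "Cod C g"] assms by simp_all

lemma ten_Id [simp]: "X \<in> Obj C \<Longrightarrow> Y \<in> Obj C \<Longrightarrow> Id C X \<box> Id C Y = Id C (X \<box>\<^sub>o Y)"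
  by (rule ten_id)

lemma interchange [simp]:
  assumes "f \<in> Arr C" "f' \<in> Arr C" "g \<in> Arr C" "g' \<in> Arr C" "Dom C f' = Cod C f" "Dom C g' = Cod C g"
  shows "(f' \<box> g') \<cdot> (f \<box> g) = (f' \<cdot> f) \<box> (g' \<cdot> g)"
  using ten_comp[of f "Dom C f" "Cod C f" f' "Cod C f'" g "Dom C g" "Cod C g" g' "Cod C g'"] assms
  by simp

lemma interchange_reassoc [simp]:
  assumes "f \<in> Arr C" "f' \<in> Arr C" "g \<in> Arr C" "g' \<in> Arr C" "Dom C f' = Cod C f" "Dom C g' = Cod C g"
    "h \<in> Arr C" "Cod C h = Dom C f \<box>\<^sub>o Dom C g"
  shows "(f' \<box> g') \<cdot> (f \<box> g) \<cdot> h = ((f' \<cdot> f) \<box> (g' \<cdot> g)) \<cdot> h"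
  using assms by (intro comp_precomp) simp_all

lemma Assoc_typing [simp]:
  assumes "X \<in> Obj C" "Y \<in> Obj C" "Z \<in> Obj C"
  shows "Assoc C X Y Z \<in> Arr C" "Dom C (Assoc C X Y Z) = (X \<box>\<^sub>o Y) \<box>\<^sub>o Z"
    "Cod C (Assoc C X Y Z) = X \<box>\<^sub>o (Y \<box>\<^sub>o Z)" "is_iso C (Assoc C X Y Z)"
  using assoc_hom[OF assms] assoc_iso[OF assms] by simp_all

lemma unitor_typing [simp]:
  assumes "X \<in> Obj C"
  shows "Lunit C X \<in> Arr C" "Dom C (Lunit C X) = Unit C \<box>\<^sub>o X" "Cod C (Lunit C X) = X"
    "is_iso C (Lunit C X)"
    "Runit C X \<in> Arr C" "Dom C (Runit C X) = X \<box>\<^sub>o Unit C" "Cod C (Runit C X) = X"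
    "is_iso C (Runit C X)"
  using lunit_hom[OF assms] lunit_iso[OF assms] runit_hom[OF assms] runit_iso[OF assms] by simp_all

lemma Assoc_natural:
  assumes "f \<in> hom C X X'" "g \<in> hom C Y Y'" "h \<in> hom C Z Z'"
  shows "Assoc C X' Y' Z' \<cdot> ((f \<box> g) \<box> h) = (f \<box> (g \<box> h)) \<cdot> Assoc C X Y Z"
  using assms by (rule assoc_nat)

lemma is_iso_ten [simp]:
  assumes "is_iso C f" "is_iso C g"
  shows "is_iso C (f \<box> g)"
  using assms is_iso_arr[OF assms(1)] is_iso_arr[OF assms(2)]
  by (intro is_isoI[where g = "inverse_arr C f \<box> inverse_arr C g"]) simp_all

text \<open>
  By naturality of the unit isomorphisms, tensoring with the unit object is isomorphic to the
  identity functor.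
\<close>

lemma unit_ten_faithful:
  assumes "f \<in> hom C X Y" "g \<in> hom C X Y"
  shows "Id C (Unit C) \<box> f = Id C (Unit C) \<box> g \<Longrightarrow> f = g"
    and "f \<box> Id C (Unit C) = g \<box> Id C (Unit C) \<Longrightarrow> f = g"
proof -
  have [simp]: "X \<in> Obj C" "Y \<in> Obj C" using assms(1) by auto
  show "f = g" if "Id C (Unit C) \<box> f = Id C (Unit C) \<box> g"
    by (rule iso_cancel_right[of "Lunit C X"])
      (use assms lunit_nat[OF assms(1)] lunit_nat[OF assms(2)] that in simp_all)
  show "f = g" if "f \<box> Id C (Unit C) = g \<box> Id C (Unit C)"
    by (rule iso_cancel_right[of "Runit C X"])
      (use assms runit_nat[OF assms(1)] runit_nat[OF assms(2)] that in simp_all)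
qed

text \<open>
  Kelly's argument: after tensoring with the unit object on the left, the pentagon for two units
  and the triangle (used twice) give the equation up to an isomorphism, and tensoring with the
  unit is faithful.
\<close>

lemma Lunit_ten:
  assumes [simp]: "X \<in> Obj C" "Y \<in> Obj C"
  shows "Lunit C (X \<box>\<^sub>o Y) \<cdot> Assoc C (Unit C) X Y = Lunit C X \<box> Id C Y"
proof (rule unit_ten_faithful(1))
  let ?I = "Unit C"
  let ?a = "Assoc C ?I (?I \<box>\<^sub>o X) Y \<cdot> (Assoc C ?I ?I X \<box> Id C Y)"
  have "(Id C ?I \<box> (Lunit C (X \<box>\<^sub>o Y) \<cdot> Assoc C ?I X Y)) \<cdot> ?a =
      (Id C ?I \<box> Lunit C (X \<box>\<^sub>o Y)) \<cdot> ((Id C ?I \<box> Assoc C ?I X Y) \<cdot> ?a)"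
    by simp
  also have "\<dots> = ((Id C ?I \<box> Lunit C (X \<box>\<^sub>o Y)) \<cdot> Assoc C ?I ?I (X \<box>\<^sub>o Y)) \<cdot> Assoc C (?I \<box>\<^sub>o ?I) X Y"
    by (subst pentagon) simp_all
  also have "\<dots> = (Runit C ?I \<box> Id C (X \<box>\<^sub>o Y)) \<cdot> Assoc C (?I \<box>\<^sub>o ?I) X Y"
    by (subst triangle) simp_all
  also have "\<dots> = Assoc C ?I X Y \<cdot> ((Runit C ?I \<box> Id C X) \<box> Id C Y)"
    using Assoc_natural[of "Runit C ?I" "?I \<box>\<^sub>o ?I" ?I "Id C X" X X "Id C Y" Y Y] by simp
  also have "\<dots> = Assoc C ?I X Y \<cdot> (((Id C ?I \<box> Lunit C X) \<cdot> Assoc C ?I ?I X) \<box> Id C Y)"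
    by (subst triangle) simp_all
  also have "\<dots> = (Assoc C ?I X Y \<cdot> ((Id C ?I \<box> Lunit C X) \<box> Id C Y)) \<cdot> (Assoc C ?I ?I X \<box> Id C Y)"
    by simp
  also have "\<dots> = (Id C ?I \<box> (Lunit C X \<box> Id C Y)) \<cdot> ?a"
    by (subst Assoc_natural[of _ ?I _ _ "?I \<box>\<^sub>o X" _ _ Y]) simp_all
  finally show "Id C ?I \<box> (Lunit C (X \<box>\<^sub>o Y) \<cdot> Assoc C ?I X Y) = Id C ?I \<box> (Lunit C X \<box> Id C Y)"
    by (rule iso_cancel_right[rotated -1]) simp_all
qed simp_all

text \<open>
  The mirror image of the preceding argument, with both units on the right.
\<close>

lemma Runit_ten:
  assumes [simp]: "X \<in> Obj C" "Y \<in> Obj C"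
  shows "(Id C X \<box> Runit C Y) \<cdot> Assoc C X Y (Unit C) = Runit C (X \<box>\<^sub>o Y)"
proof (rule unit_ten_faithful(2))
  let ?I = "Unit C"
  let ?a = "Assoc C X Y ?I"
  have "?a \<cdot> (((Id C X \<box> Runit C Y) \<cdot> ?a) \<box> Id C ?I) =
      (?a \<cdot> ((Id C X \<box> Runit C Y) \<box> Id C ?I)) \<cdot> (?a \<box> Id C ?I)"
    by simp
  also have "\<dots> = (Id C X \<box> (Runit C Y \<box> Id C ?I)) \<cdot> Assoc C X (Y \<box>\<^sub>o ?I) ?I \<cdot> (?a \<box> Id C ?I)"
    by (subst Assoc_natural[of _ X _ _ "Y \<box>\<^sub>o ?I" _ _ ?I]) simp_all
  also have "\<dots> = (Id C X \<box> (Id C Y \<box> Lunit C ?I)) \<cdot>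
      (Id C X \<box> Assoc C Y ?I ?I) \<cdot> Assoc C X (Y \<box>\<^sub>o ?I) ?I \<cdot> (?a \<box> Id C ?I)"
    by (simp add: triangle)
  also have "\<dots> = ((Id C X \<box> (Id C Y \<box> Lunit C ?I)) \<cdot> Assoc C X Y (?I \<box>\<^sub>o ?I)) \<cdot> Assoc C (X \<box>\<^sub>o Y) ?I ?I"
    by (subst pentagon) simp_all
  also have "\<dots> = (?a \<cdot> ((Id C X \<box> Id C Y) \<box> Lunit C ?I)) \<cdot> Assoc C (X \<box>\<^sub>o Y) ?I ?I"
    by (subst Assoc_natural[of _ X _ _ Y _ _ "?I \<box>\<^sub>o ?I"]) simp_all
  also have "\<dots> = ?a \<cdot> (Runit C (X \<box>\<^sub>o Y) \<box> Id C ?I)"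
    by (simp add: triangle)
  finally show "((Id C X \<box> Runit C Y) \<cdot> ?a) \<box> Id C ?I = Runit C (X \<box>\<^sub>o Y) \<box> Id C ?I"
    by (rule iso_cancel_left[rotated -1]) simp_all
qed simp_all

lemma Lunit_Unit: "Lunit C (Unit C) = Runit C (Unit C)"
proof (rule unit_ten_faithful(2))
  let ?I = "Unit C"
  have "Lunit C (?I \<box>\<^sub>o ?I) = Id C ?I \<box> Lunit C ?I"
    by (rule iso_cancel_left[of "Lunit C ?I"])
      (use lunit_nat[of "Lunit C ?I" "?I \<box>\<^sub>o ?I" ?I] in simp_all)
  then show "Lunit C ?I \<box> Id C ?I = Runit C ?I \<box> Id C ?I"
    using Lunit_ten[of ?I ?I] triangle[of ?I ?I] by simp
qed simp_all

lemma tpow_obj [simp]: "P \<in> Obj C \<Longrightarrow> tpow C P n \<in> Obj C"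
  by (induction n rule: induct_nat_012) simp_all

lemma tpow_2: "tpow C P 2 = P \<box>\<^sub>o P"
  by (simp add: numeral_2_eq_2)

lemma tcat_typing [simp]:
  assumes [simp]: "P \<in> Obj C"
  shows "tcat C P n m \<in> Arr C" "Dom C (tcat C P n m) = tpow C P n \<box>\<^sub>o tpow C P m"
    "Cod C (tcat C P n m) = tpow C P (n + m)" "is_iso C (tcat C P n m)"
proof -
  have "tcat C P n m \<in> hom C (tpow C P n \<box>\<^sub>o tpow C P m) (tpow C P (n + m)) \<and> is_iso C (tcat C P n m)"
  proof (induction n arbitrary: m rule: induct_nat_012)
    case 1 then show ?case by (cases m) simp_all
  qed simp_all
  then show "tcat C P n m \<in> Arr C" "Dom C (tcat C P n m) = tpow C P n \<box>\<^sub>o tpow C P m"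
    "Cod C (tcat C P n m) = tpow C P (n + m)" "is_iso C (tcat C P n m)"
    by simp_all
qed

lemma tcat_0_right: "P \<in> Obj C \<Longrightarrow> tcat C P n 0 = Runit C (tpow C P n)"
  by (induction n rule: induct_nat_012) (simp_all add: Lunit_Unit Runit_ten)

text \<open>
  The induction step peels off one factor \<open>P\<close>, and the pentagon moves it past the other brackets.
\<close>

lemma tcat_assoc:
  assumes [simp]: "P \<in> Obj C"
  shows "tcat C P (n + m) k \<cdot> (tcat C P n m \<box> Id C (tpow C P k)) =
    tcat C P n (m + k) \<cdot> (Id C (tpow C P n) \<box> tcat C P m k) \<cdot>
      Assoc C (tpow C P n) (tpow C P m) (tpow C P k)"
proof (induction n rule: induct_nat_012)
  case 0
  have "Lunit C (tpow C P (m + k)) \<cdot> (Id C (Unit C) \<box> tcat C P m k) =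
      tcat C P m k \<cdot> Lunit C (tpow C P m \<box>\<^sub>o tpow C P k)"
    by (rule lunit_nat) simp
  from comp_precomp[OF this, of "Assoc C (Unit C) (tpow C P m) (tpow C P k)"] show ?case
    by (simp add: Lunit_ten)
next
  case 1
  show ?case
  proof (cases m)
    case 0
    have "tcat C P (Suc 0) k \<cdot> ((Id C P \<box> Lunit C (tpow C P k)) \<cdot> Assoc C P (Unit C) (tpow C P k)) =
        tcat C P (Suc 0) k \<cdot> (Runit C P \<box> Id C (tpow C P k))"
      by (subst triangle) simp_all
    then show ?thesis by (simp add: 0)
  qed simp
next
  case (ge2 n)
  let ?n = "tpow C P (Suc n)" and ?m = "tpow C P m" and ?k = "tpow C P k"
  let ?t = "Id C P \<box> tcat C P (Suc n + m) k"
  let ?u = "Id C P \<box> tcat C P (Suc n) (m + k)"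
  have "tcat C P (Suc (Suc n) + m) k \<cdot> (tcat C P (Suc (Suc n)) m \<box> Id C ?k) =
      ?t \<cdot> (Assoc C P (tpow C P (Suc n + m)) ?k \<cdot> ((Id C P \<box> tcat C P (Suc n) m) \<box> Id C ?k))
        \<cdot> (Assoc C P ?n ?m \<box> Id C ?k)"
    by simp
  also have "\<dots> = (Id C P \<box> (tcat C P (Suc n + m) k \<cdot> (tcat C P (Suc n) m \<box> Id C ?k))) \<cdot>
      Assoc C P (?n \<box>\<^sub>o ?m) ?k \<cdot> (Assoc C P ?n ?m \<box> Id C ?k)"
    by (subst Assoc_natural[of _ P _ _ "?n \<box>\<^sub>o ?m" _ _ ?k]) simp_all
  also have "\<dots> = (?u \<cdot> (Id C P \<box> (Id C ?n \<box> tcat C P m k))) \<cdot>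
      ((Id C P \<box> Assoc C ?n ?m ?k) \<cdot> Assoc C P (?n \<box>\<^sub>o ?m) ?k \<cdot> (Assoc C P ?n ?m \<box> Id C ?k))"
    unfolding ge2(2) by simp
  also have "\<dots> = ?u \<cdot> ((Id C P \<box> (Id C ?n \<box> tcat C P m k)) \<cdot> Assoc C P ?n (?m \<box>\<^sub>o ?k)) \<cdot>
      Assoc C (P \<box>\<^sub>o ?n) ?m ?k"
    by (subst pentagon) simp_all
  also have "\<dots> = ?u \<cdot> (Assoc C P ?n (tpow C P (m + k)) \<cdot> ((Id C P \<box> Id C ?n) \<box> tcat C P m k)) \<cdot>
      Assoc C (P \<box>\<^sub>o ?n) ?m ?k"
    by (subst Assoc_natural[of _ P _ _ ?n _ _ "?m \<box>\<^sub>o ?k"]) simp_all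
  finally show ?case by simp
qed

end


section \<open>Insertions into tensor powers\<close>

text \<open>
  The \<open>n\<close>-fold product of an arrow \<open>g\<close> from \<open>P\<close> into a monoid, as an arrow out of the \<open>n\<close>-th tensor
  power of \<open>P\<close>; bracketed like these powers.
\<close>

fun mult_pow :: "('o, 'm, 'x) abelian_monoidal_category_scheme \<Rightarrow> 'm \<Rightarrow> 'm \<Rightarrow> 'm \<Rightarrow> nat \<Rightarrow> 'm"
  where
    "mult_pow C \<mu> \<eta> g 0 = \<eta>"
  | "mult_pow C \<mu> \<eta> g (Suc 0) = g"
  | "mult_pow C \<mu> \<eta> g (Suc (Suc n)) = \<mu> \<cdot>\<^bsub>C\<^esub> (g \<box>\<^bsub>C\<^esub> mult_pow C \<mu> \<eta> g (Suc n))"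

context abelian_monoidal_category
begin

lemma Lunit_inverse_natural:
  assumes "f \<in> hom C X Y"
  shows "inverse_arr C (Lunit C Y) \<cdot> f = (Id C (Unit C) \<box> f) \<cdot> inverse_arr C (Lunit C X)"
proof (rule iso_cancel_left[of "Lunit C Y"])
  have [simp]: "f \<in> Arr C" "Dom C f = X" "Cod C f = Y" "X \<in> Obj C" "Y \<in> Obj C"
    using assms by auto
  show "Lunit C Y \<cdot> inverse_arr C (Lunit C Y) \<cdot> f =
      Lunit C Y \<cdot> (Id C (Unit C) \<box> f) \<cdot> inverse_arr C (Lunit C X)"
    using comp_precomp[OF lunit_nat[OF assms], of "inverse_arr C (Lunit C X)"] by simp
qed (use assms in auto)

lemma Runit_inverse_natural:
  assumes "f \<in> hom C X Y"
  shows "inverse_arr C (Runit C Y) \<cdot> f = (f \<box> Id C (Unit C)) \<cdot> inverse_arr C (Runit C X)"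
proof (rule iso_cancel_left[of "Runit C Y"])
  have [simp]: "f \<in> Arr C" "Dom C f = X" "Cod C f = Y" "X \<in> Obj C" "Y \<in> Obj C"
    using assms by auto
  show "Runit C Y \<cdot> inverse_arr C (Runit C Y) \<cdot> f =
      Runit C Y \<cdot> (f \<box> Id C (Unit C)) \<cdot> inverse_arr C (Runit C X)"
    using comp_precomp[OF runit_nat[OF assms], of "inverse_arr C (Runit C X)"] by simp
qed (use assms in auto)

lemma Lunit_inverse_ten:
  assumes [simp]: "X \<in> Obj C" "Y \<in> Obj C"
  shows "inverse_arr C (Lunit C (X \<box>\<^sub>o Y)) =
    Assoc C (Unit C) X Y \<cdot> (inverse_arr C (Lunit C X) \<box> Id C Y)"
proof (rule iso_cancel_left[of "Lunit C (X \<box>\<^sub>o Y)"])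
  show "Lunit C (X \<box>\<^sub>o Y) \<cdot> inverse_arr C (Lunit C (X \<box>\<^sub>o Y)) =
      Lunit C (X \<box>\<^sub>o Y) \<cdot> Assoc C (Unit C) X Y \<cdot> (inverse_arr C (Lunit C X) \<box> Id C Y)"
    using comp_precomp[OF Lunit_ten[of X Y], of "inverse_arr C (Lunit C X) \<box> Id C Y"] by simp
qed simp_all

lemma triangle_inverse:
  assumes [simp]: "X \<in> Obj C" "Y \<in> Obj C"
  shows "Id C X \<box> inverse_arr C (Lunit C Y) =
    Assoc C X (Unit C) Y \<cdot> (inverse_arr C (Runit C X) \<box> Id C Y)"
proof (rule iso_cancel_left[of "Id C X \<box> Lunit C Y"])
  show "(Id C X \<box> Lunit C Y) \<cdot> (Id C X \<box> inverse_arr C (Lunit C Y)) =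
      (Id C X \<box> Lunit C Y) \<cdot> Assoc C X (Unit C) Y \<cdot> (inverse_arr C (Runit C X) \<box> Id C Y)"
    using comp_precomp[OF triangle[of X Y], of "inverse_arr C (Runit C X) \<box> Id C Y"] by simp
qed simp_all

definition insert_unit :: "'o \<Rightarrow> 'm \<Rightarrow> nat \<Rightarrow> 'm"
  where "insert_unit P \<eta> n =
    tcat C P (Suc 0) n \<cdot> (\<eta> \<box> Id C (tpow C P n)) \<cdot> inverse_arr C (Lunit C (tpow C P n))"

definition insert_unit_at :: "'o \<Rightarrow> 'm \<Rightarrow> nat \<Rightarrow> nat \<Rightarrow> 'm"
  where "insert_unit_at P \<eta> i m =
    tcat C P i (Suc m) \<cdot> (Id C (tpow C P i) \<box> insert_unit P \<eta> m) \<cdot> inverse_arr C (tcat C P i m)"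

text \<open>
  The image of \<open>d\<close>, an arrow into the \<open>r\<close>-th tensor power, is placed between \<open>i\<close> factors on the left
  and \<open>b\<close> factors on the right.  Relations in a tensor power are pairs of such arrows with \<open>r = 2\<close>
  that are to become equal.
\<close>

definition plug :: "'o \<Rightarrow> nat \<Rightarrow> nat \<Rightarrow> 'm \<Rightarrow> nat \<Rightarrow> 'm"
  where "plug P i r d b =
    tcat C P i (r + b) \<cdot> (Id C (tpow C P i) \<box> (tcat C P r b \<cdot> (d \<box> Id C (tpow C P b))))"

lemma plug_typing [simp]:
  assumes "P \<in> Obj C" "d \<in> Arr C" "Cod C d = tpow C P r"
  shows "plug P i r d b \<in> Arr C"
    "Dom C (plug P i r d b) = tpow C P i \<box>\<^sub>o (Dom C d \<box>\<^sub>o tpow C P b)"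
    "Cod C (plug P i r d b) = tpow C P (i + (r + b))"
  using assms unfolding plug_def by simp_all

lemma plug_comp:
  assumes "P \<in> Obj C" "d \<in> Arr C" "Cod C d = tpow C P r" "e \<in> Arr C" "Cod C e = Dom C d"
  shows "plug P i r d b \<cdot> (Id C (tpow C P i) \<box> (e \<box> Id C (tpow C P b))) = plug P i r (d \<cdot> e) b"
  using assms unfolding plug_def by simp

text \<open>
  Concatenation with further factors on the right turns a relation at some position into a
  relation at the same position of a longer power.  What matters is that the arrow by which the
  right-hand side is precomposed does not involve \<open>d\<close>: if two choices of \<open>d\<close> are identified in the
  longer power, then so are the left-hand sides.
\<close>

lemma tcat_plug_left:
  assumes [simp]: "P \<in> Obj C" and d: "d \<in> hom C X (tpow C P r)"
  shows "tcat C P (i + (r + b)) k \<cdot> (plug P i r d b \<box> Id C (tpow C P k)) =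
    plug P i r d (b + k) \<cdot>
      (Id C (tpow C P i) \<box> ((Id C X \<box> tcat C P b k) \<cdot> Assoc C X (tpow C P b) (tpow C P k))) \<cdot>
      Assoc C (tpow C P i) (X \<box>\<^sub>o tpow C P b) (tpow C P k)"
proof -
  let ?i = "tpow C P i" and ?b = "tpow C P b" and ?k = "tpow C P k" and ?r = "tpow C P r"
  let ?e = "tcat C P r b \<cdot> (d \<box> Id C ?b)"
  have [simp]: "d \<in> Arr C" "Dom C d = X" "Cod C d = ?r" "X \<in> Obj C"
    using d by auto
  have "tcat C P (r + b) k \<cdot> (?e \<box> Id C ?k) =
      (tcat C P (r + b) k \<cdot> (tcat C P r b \<box> Id C ?k)) \<cdot> ((d \<box> Id C ?b) \<box> Id C ?k)"
    by simp
  also have "\<dots> = tcat C P r (b + k) \<cdot> (Id C ?r \<box> tcat C P b k) \<cdot>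
      (Assoc C ?r ?b ?k \<cdot> ((d \<box> Id C ?b) \<box> Id C ?k))"
    by (subst tcat_assoc) (simp_all add: add.assoc)
  also have "\<dots> = tcat C P r (b + k) \<cdot> (d \<box> Id C (tpow C P (b + k))) \<cdot> (Id C X \<box> tcat C P b k) \<cdot> Assoc C X ?b ?k"
    by (subst Assoc_natural[of _ X _ _ ?b _ _ ?k]) simp_all
  finally have inner: "tcat C P (r + b) k \<cdot> (?e \<box> Id C ?k) = \<dots>" .
  have "tcat C P (i + (r + b)) k \<cdot> (plug P i r d b \<box> Id C ?k) =
      (tcat C P (i + (r + b)) k \<cdot> (tcat C P i (r + b) \<box> Id C ?k)) \<cdot> ((Id C ?i \<box> ?e) \<box> Id C ?k)"
    unfolding plug_def by simp
  also have "\<dots> = tcat C P i (r + b + k) \<cdot> (Id C ?i \<box> tcat C P (r + b) k) \<cdot>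
      (Assoc C ?i (tpow C P (r + b)) ?k \<cdot> ((Id C ?i \<box> ?e) \<box> Id C ?k))"
    by (subst tcat_assoc) (simp_all add: add.assoc)
  also have "\<dots> = tcat C P i (r + b + k) \<cdot> (Id C ?i \<box> (tcat C P (r + b) k \<cdot> (?e \<box> Id C ?k))) \<cdot>
      Assoc C ?i (X \<box>\<^sub>o ?b) ?k"
    by (subst Assoc_natural[of _ ?i _ _ "X \<box>\<^sub>o ?b" _ _ ?k]) simp_all
  also have "\<dots> = plug P i r d (b + k) \<cdot> (Id C ?i \<box> ((Id C X \<box> tcat C P b k) \<cdot> Assoc C X ?b ?k)) \<cdot>
      Assoc C ?i (X \<box>\<^sub>o ?b) ?k"
    unfolding inner plug_def by (simp add: add.assoc)
  finally show ?thesis .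
qed

text \<open>
  The same with \<open>n\<close> further factors on the left, which shift the position by \<open>n\<close>.
\<close>

lemma tcat_plug_right:
  assumes [simp]: "P \<in> Obj C" and d: "d \<in> hom C X (tpow C P r)"
  shows "tcat C P n (i + (r + b)) \<cdot> (Id C (tpow C P n) \<box> plug P i r d b) =
    plug P (n + i) r d b \<cdot> (tcat C P n i \<box> Id C (X \<box>\<^sub>o tpow C P b)) \<cdot>
      inverse_arr C (Assoc C (tpow C P n) (tpow C P i) (X \<box>\<^sub>o tpow C P b))"
proof -
  let ?i = "tpow C P i" and ?b = "tpow C P b" and ?n = "tpow C P n" and ?r = "tpow C P r"
  let ?e = "tcat C P r b \<cdot> (d \<box> Id C ?b)"
  have [simp]: "d \<in> Arr C" "Dom C d = X" "Cod C d = ?r" "X \<in> Obj C"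
    using d by auto
  have "(tcat C P n (i + (r + b)) \<cdot> (Id C ?n \<box> plug P i r d b)) \<cdot> Assoc C ?n ?i (X \<box>\<^sub>o ?b) =
      tcat C P n (i + (r + b)) \<cdot> (Id C ?n \<box> tcat C P i (r + b)) \<cdot>
      ((Id C ?n \<box> (Id C ?i \<box> ?e)) \<cdot> Assoc C ?n ?i (X \<box>\<^sub>o ?b))"
    unfolding plug_def by simp
  also have "\<dots> = (tcat C P n (i + (r + b)) \<cdot> (Id C ?n \<box> tcat C P i (r + b)) \<cdot>
      Assoc C ?n ?i (tpow C P (r + b))) \<cdot> ((Id C ?n \<box> Id C ?i) \<box> ?e)"
    by (subst Assoc_natural[of _ ?n ?n _ ?i ?i _ "X \<box>\<^sub>o ?b", symmetric]) simp_all
  also have "\<dots> = plug P (n + i) r d b \<cdot> (tcat C P n i \<box> Id C (X \<box>\<^sub>o ?b))"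
    unfolding plug_def by (subst tcat_assoc[symmetric]) (simp_all add: add.assoc)
  finally have "((tcat C P n (i + (r + b)) \<cdot> (Id C ?n \<box> plug P i r d b)) \<cdot> Assoc C ?n ?i (X \<box>\<^sub>o ?b)) \<cdot>
      inverse_arr C (Assoc C ?n ?i (X \<box>\<^sub>o ?b)) = (plug P (n + i) r d b \<cdot> (tcat C P n i \<box> Id C (X \<box>\<^sub>o ?b))) \<cdot>
      inverse_arr C (Assoc C ?n ?i (X \<box>\<^sub>o ?b))"
    by simp
  then show ?thesis by (simp add: add.assoc)
qed

lemma mult_pow_tcat:
  assumes M: "is_monoid C M \<mu> \<eta>" and [simp]: "P \<in> Obj C" and g: "g \<in> hom C P M"
  shows "mult_pow C \<mu> \<eta> g n \<in> hom C (tpow C P n) M"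
    and "mult_pow C \<mu> \<eta> g (n + m) \<cdot> tcat C P n m = \<mu> \<cdot> (mult_pow C \<mu> \<eta> g n \<box> mult_pow C \<mu> \<eta> g m)"
proof -
  let ?g = "mult_pow C \<mu> \<eta> g"
  have [simp]: "M \<in> Obj C" "\<mu> \<in> Arr C" "Dom C \<mu> = M \<box>\<^sub>o M" "Cod C \<mu> = M"
    "\<eta> \<in> Arr C" "Dom C \<eta> = Unit C" "Cod C \<eta> = M" "g \<in> Arr C" "Dom C g = P" "Cod C g = M"
    using M g unfolding is_monoid_def by simp_all
  have assoc: "\<mu> \<cdot> (\<mu> \<box> Id C M) = \<mu> \<cdot> (Id C M \<box> \<mu>) \<cdot> Assoc C M M M"
    and unit: "\<mu> \<cdot> (\<eta> \<box> Id C M) = Lunit C M" "\<mu> \<cdot> (Id C M \<box> \<eta>) = Runit C M"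
    using M unfolding is_monoid_def by blast+
  have g_typing: "?g n \<in> hom C (tpow C P n) M" for n
    by (induction n rule: induct_nat_012) simp_all
  then show "?g n \<in> hom C (tpow C P n) M" .
  have [simp]: "?g n \<in> Arr C" "Dom C (?g n) = tpow C P n" "Cod C (?g n) = M" for n
    using g_typing by simp_all
  show "?g (n + m) \<cdot> tcat C P n m = \<mu> \<cdot> (?g n \<box> ?g m)"
  proof (induction n rule: induct_nat_012)
    case 0
    have "\<mu> \<cdot> (\<eta> \<box> ?g m) = (\<mu> \<cdot> (\<eta> \<box> Id C M)) \<cdot> (Id C (Unit C) \<box> ?g m)" by simp
    then show ?case using lunit_nat[of "?g m" "tpow C P m" M] by (simp add: unit)
  next
    case 1
    show ?case
    proof (cases m)
      case 0
      have "\<mu> \<cdot> (g \<box> \<eta>) = (\<mu> \<cdot> (Id C M \<box> \<eta>)) \<cdot> (g \<box> Id C (Unit C))" by simp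
      then show ?thesis using runit_nat[of g P M] by (simp add: unit 0)
    qed simp
  next
    case (ge2 n)
    let ?n = "tpow C P (Suc n)" and ?m = "tpow C P m"
    have "?g (Suc (Suc n) + m) \<cdot> tcat C P (Suc (Suc n)) m =
        \<mu> \<cdot> (g \<box> (?g (Suc n + m) \<cdot> tcat C P (Suc n) m)) \<cdot> Assoc C P ?n ?m"
      by simp
    also have "\<dots> = (\<mu> \<cdot> (Id C M \<box> \<mu>)) \<cdot> ((g \<box> (?g (Suc n) \<box> ?g m)) \<cdot> Assoc C P ?n ?m)"
      unfolding ge2 by simp
    also have "\<dots> = (\<mu> \<cdot> (Id C M \<box> \<mu>) \<cdot> Assoc C M M M) \<cdot> ((g \<box> ?g (Suc n)) \<box> ?g m)"
      by (subst Assoc_natural[of g P M _ ?n M _ ?m M, symmetric]) simp_all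
    also have "\<dots> = \<mu> \<cdot> (?g (Suc (Suc n)) \<box> ?g m)"
      unfolding assoc[symmetric] by simp
    finally show ?case .
  qed
qed

text \<open>
  The right-hand side sees \<open>d\<close> only through its composite with the \<open>r\<close>-fold product, so relations
  need only be checked at a single place.
\<close>

lemma mult_pow_plug:
  assumes "is_monoid C M \<mu> \<eta>" "P \<in> Obj C" "g \<in> hom C P M" "d \<in> hom C X (tpow C P r)"
  shows "mult_pow C \<mu> \<eta> g (i + (r + b)) \<cdot> plug P i r d b =
    \<mu> \<cdot> (mult_pow C \<mu> \<eta> g i \<box> (\<mu> \<cdot> ((mult_pow C \<mu> \<eta> g r \<cdot> d) \<box> mult_pow C \<mu> \<eta> g b)))"
proof -
  let ?g = "mult_pow C \<mu> \<eta> g"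
  let ?e = "tcat C P r b \<cdot> (d \<box> Id C (tpow C P b))"
  note g = mult_pow_tcat[OF assms(1-3)]
  have [simp]: "?g n \<in> Arr C" "Dom C (?g n) = tpow C P n" "Cod C (?g n) = M" for n
    using g(1)[of n] by simp_all
  have [simp]: "M \<in> Obj C" "\<mu> \<in> Arr C" "Dom C \<mu> = M \<box>\<^sub>o M" "Cod C \<mu> = M" "P \<in> Obj C"
      "d \<in> Arr C" "Dom C d = X" "Cod C d = tpow C P r"
    using assms unfolding is_monoid_def by simp_all
  have "?g (i + (r + b)) \<cdot> plug P i r d b =
      (?g (i + (r + b)) \<cdot> tcat C P i (r + b)) \<cdot> (Id C (tpow C P i) \<box> ?e)"
    unfolding plug_def by simp
  also have "\<dots> = \<mu> \<cdot> (?g i \<box> ((?g (r + b) \<cdot> tcat C P r b) \<cdot> (d \<box> Id C (tpow C P b))))"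
    unfolding g(2)[of i] by simp
  also have "\<dots> = \<mu> \<cdot> (?g i \<box> (\<mu> \<cdot> ((?g r \<cdot> d) \<box> ?g b)))"
    unfolding g(2) by simp
  finally show ?thesis .
qed

end

locale pointed_object = abelian_monoidal_category C
  for C :: "('o, 'm, 'x) abelian_monoidal_category_scheme" (structure) +
  fixes P :: 'o and \<eta> :: 'm
  assumes P [simp]: "P \<in> Obj C" and \<eta>: "\<eta> \<in> hom C (Unit C) P"
begin

lemma \<eta>_typing [simp]: "\<eta> \<in> Arr C" "Dom C \<eta> = Unit C" "Cod C \<eta> = P"
  using \<eta> by simp_all

lemma insert_unit_typing [simp]:
  "insert_unit P \<eta> n \<in> Arr C" "Dom C (insert_unit P \<eta> n) = tpow C P n"
  "Cod C (insert_unit P \<eta> n) = tpow C P (Suc n)"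
  unfolding insert_unit_def by simp_all

lemma insert_unit_at_typing [simp]:
  "insert_unit_at P \<eta> i n \<in> Arr C" "Dom C (insert_unit_at P \<eta> i n) = tpow C P (i + n)"
  "Cod C (insert_unit_at P \<eta> i n) = tpow C P (Suc (i + n))"
  unfolding insert_unit_at_def by simp_all

lemma insert_unit_0: "insert_unit P \<eta> 0 = \<eta>"
proof -
  have "insert_unit P \<eta> 0 = (Runit C P \<cdot> (\<eta> \<box> Id C (Unit C))) \<cdot> inverse_arr C (Lunit C (Unit C))"
    unfolding insert_unit_def by simp
  also have "\<dots> = \<eta>"
    by (subst runit_nat[of \<eta> "Unit C" P]) (simp_all add: Lunit_Unit)
  finally show ?thesis .
qed

lemma insert_unit_at_0: "insert_unit_at P \<eta> 0 n = insert_unit P \<eta> n"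
  using comp_precomp[OF lunit_nat[of "insert_unit P \<eta> n" "tpow C P n" "tpow C P (Suc n)"],
    of "inverse_arr C (Lunit C (tpow C P n))"]
  unfolding insert_unit_at_def by simp

lemma insert_unit_at_tcat:
  "insert_unit_at P \<eta> n k \<cdot> tcat C P n k = tcat C P n (Suc k) \<cdot> (Id C (tpow C P n) \<box> insert_unit P \<eta> k)"
  unfolding insert_unit_at_def by simp

lemma insert_unit_tcat:
  "insert_unit P \<eta> (n + m) \<cdot> tcat C P n m =
    tcat C P (Suc n) m \<cdot> (insert_unit P \<eta> n \<box> Id C (tpow C P m))"
proof -
  let ?n = "tpow C P n" and ?m = "tpow C P m" and ?I = "Unit C"
  have "insert_unit P \<eta> (n + m) \<cdot> tcat C P n m =
      tcat C P (Suc 0) (n + m) \<cdot> (\<eta> \<box> Id C (tpow C P (n + m))) \<cdot>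
      (inverse_arr C (Lunit C (tpow C P (n + m))) \<cdot> tcat C P n m)"
    unfolding insert_unit_def by simp
  also have "\<dots> = tcat C P (Suc 0) (n + m) \<cdot> (Id C P \<box> tcat C P n m) \<cdot>
      ((\<eta> \<box> (Id C ?n \<box> Id C ?m)) \<cdot> Assoc C ?I ?n ?m) \<cdot> (inverse_arr C (Lunit C ?n) \<box> Id C ?m)"
    by (subst Lunit_inverse_natural[of _ "?n \<box>\<^sub>o ?m"]) (simp_all add: Lunit_inverse_ten)
  also have "\<dots> = (tcat C P (Suc 0) (n + m) \<cdot> (Id C (tpow C P (Suc 0)) \<box> tcat C P n m) \<cdot> Assoc C (tpow C P (Suc 0)) ?n ?m) \<cdot>
      ((\<eta> \<box> Id C ?n) \<box> Id C ?m) \<cdot> (inverse_arr C (Lunit C ?n) \<box> Id C ?m)"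
    by (subst Assoc_natural[of \<eta> ?I P "Id C ?n" ?n ?n "Id C ?m" ?m ?m, symmetric]) simp_all
  also have "\<dots> = tcat C P (Suc n) m \<cdot> (insert_unit P \<eta> n \<box> Id C ?m)"
    unfolding insert_unit_def by (subst tcat_assoc[symmetric]) simp_all
  finally show ?thesis .
qed

text \<open>
  Inserting the unit in front of all factors shifts a relation by one position.  Among all
  positions for the unit this one never falls into the relation.
\<close>

lemma insert_unit_plug:
  assumes "d \<in> hom C X (tpow C P r)"
  shows "insert_unit P \<eta> (i + (r + b)) \<cdot> plug P i r d b =
    plug P (Suc i) r d b \<cdot> (insert_unit P \<eta> i \<box> Id C (X \<box>\<^sub>o tpow C P b))"
proof -
  let ?e = "tcat C P r b \<cdot> (d \<box> Id C (tpow C P b))"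
  have [simp]: "d \<in> Arr C" "Dom C d = X" "Cod C d = tpow C P r" "X \<in> Obj C"
    using assms by auto
  have "insert_unit P \<eta> (i + (r + b)) \<cdot> plug P i r d b =
      (insert_unit P \<eta> (i + (r + b)) \<cdot> tcat C P i (r + b)) \<cdot> (Id C (tpow C P i) \<box> ?e)"
    unfolding plug_def by simp
  also have "\<dots> = plug P (Suc i) r d b \<cdot> (insert_unit P \<eta> i \<box> Id C (X \<box>\<^sub>o tpow C P b))"
    unfolding insert_unit_tcat plug_def by simp
  finally show ?thesis .
qed

lemma mult_pow_insert_unit:
  assumes M: "is_monoid C M \<mu> \<eta>'" and g: "g \<in> hom C P M" "g \<cdot> \<eta> = \<eta>'"
  shows "mult_pow C \<mu> \<eta>' g (Suc n) \<cdot> insert_unit P \<eta> n = mult_pow C \<mu> \<eta>' g n"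
proof -
  let ?g = "mult_pow C \<mu> \<eta>' g"
  note G = mult_pow_tcat[OF M P g(1)]
  have [simp]: "?g n \<in> Arr C" "Dom C (?g n) = tpow C P n" "Cod C (?g n) = M" for n
    using G(1)[of n] by simp_all
  have [simp]: "M \<in> Obj C" "\<mu> \<in> Arr C" "Dom C \<mu> = M \<box>\<^sub>o M" "Cod C \<mu> = M"
    "g \<in> Arr C" "Dom C g = P" "Cod C g = M" "\<mu> \<cdot> (\<eta>' \<box> Id C M) = Lunit C M"
     "\<eta>' \<in> Arr C" "Dom C \<eta>' = Unit C" "Cod C \<eta>' = M"
    using M g(1) unfolding is_monoid_def by simp_all
  let ?l = "inverse_arr C (Lunit C (tpow C P n))"
  have "?g (Suc n) \<cdot> insert_unit P \<eta> n =
      (?g (Suc 0 + n) \<cdot> tcat C P (Suc 0) n) \<cdot> (\<eta> \<box> Id C (tpow C P n)) \<cdot> ?l"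
    unfolding insert_unit_def by simp
  also have "\<dots> = (\<mu> \<cdot> (\<eta>' \<box> Id C M)) \<cdot> (Id C (Unit C) \<box> ?g n) \<cdot> ?l"
    unfolding G(2) by (simp add: g(2) del: \<open>\<mu> \<cdot> (\<eta>' \<box> Id C M) = Lunit C M\<close>)
  also have "\<dots> = (Lunit C M \<cdot> (Id C (Unit C) \<box> ?g n)) \<cdot> ?l"
    by simp
  also have "\<dots> = ?g n"
    by (subst lunit_nat[of _ "tpow C P n"]) simp_all
  finally show ?thesis .
qed

text \<open>
  Inserting the unit in front of a factor, or behind it as in \<open>insert_unit_at_Suc_plug\<close>, amounts to
  plugging in one of two arrows from \<open>P\<close> to \<open>P \<box>\<^sub>o P\<close>.  This reduces the comparison of the two
  insertions to the comparison of these two arrows.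
\<close>

lemma insert_unit_at_plug:
  "insert_unit_at P \<eta> i (Suc b) \<cdot> plug P i (Suc 0) (Id C P) b =
    plug P i 2 ((\<eta> \<box> Id C P) \<cdot> inverse_arr C (Lunit C P)) b"
proof -
  have "insert_unit_at P \<eta> i (Suc b) \<cdot> plug P i (Suc 0) (Id C P) b =
      (insert_unit_at P \<eta> i (Suc b) \<cdot> tcat C P i (Suc b)) \<cdot> (Id C (tpow C P i) \<box> tcat C P (Suc 0) b)"
    unfolding plug_def by simp
  also have "\<dots> = tcat C P i (Suc (Suc b)) \<cdot>
      (Id C (tpow C P i) \<box> (insert_unit P \<eta> (Suc 0 + b) \<cdot> tcat C P (Suc 0) b))"
    unfolding insert_unit_at_tcat by simp
  also have "\<dots> = plug P i 2 (insert_unit P \<eta> (Suc 0)) b"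
    unfolding insert_unit_tcat plug_def by (simp add: numeral_2_eq_2)
  also have "insert_unit P \<eta> (Suc 0) = (\<eta> \<box> Id C P) \<cdot> inverse_arr C (Lunit C P)"
    unfolding insert_unit_def by simp
  finally show ?thesis .
qed

lemma tcat_insert_unit:
  "tcat C P (Suc 0) (Suc b) \<cdot> (Id C P \<box> insert_unit P \<eta> b) =
    tcat C P 2 b \<cdot> (((Id C P \<box> \<eta>) \<cdot> inverse_arr C (Runit C P)) \<box> Id C (tpow C P b))"
proof -
  let ?b = "tpow C P b" and ?I = "Unit C"
  have "tcat C P (Suc 0) (Suc b) \<cdot> (Id C P \<box> insert_unit P \<eta> b) =
      tcat C P (Suc 0) (Suc b) \<cdot> (Id C P \<box> tcat C P (Suc 0) b) \<cdot> (Id C P \<box> (\<eta> \<box> Id C ?b)) \<cdot>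
      (Id C P \<box> inverse_arr C (Lunit C ?b))"
    unfolding insert_unit_def by simp
  also have "\<dots> = tcat C P (Suc 0) (Suc b) \<cdot> (Id C P \<box> tcat C P (Suc 0) b) \<cdot>
      ((Id C P \<box> (\<eta> \<box> Id C ?b)) \<cdot> Assoc C P ?I ?b) \<cdot> (inverse_arr C (Runit C P) \<box> Id C ?b)"
    by (subst triangle_inverse) simp_all
  also have "\<dots> = (tcat C P (Suc 0) (Suc 0 + b) \<cdot> (Id C (tpow C P (Suc 0)) \<box> tcat C P (Suc 0) b) \<cdot>
      Assoc C (tpow C P (Suc 0)) (tpow C P (Suc 0)) ?b) \<cdot> ((Id C P \<box> \<eta>) \<box> Id C ?b) \<cdot>
      (inverse_arr C (Runit C P) \<box> Id C ?b)"
    by (subst Assoc_natural[of "Id C P" P P \<eta> ?I P "Id C ?b" ?b ?b, symmetric]) simp_all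
  also have "\<dots> = tcat C P 2 b \<cdot> (((Id C P \<box> \<eta>) \<cdot> inverse_arr C (Runit C P)) \<box> Id C ?b)"
    by (subst tcat_assoc[symmetric]) (simp_all add: numeral_2_eq_2)
  finally show ?thesis .
qed

lemma insert_unit_at_Suc_plug:
  "insert_unit_at P \<eta> (Suc i) b \<cdot> plug P i (Suc 0) (Id C P) b =
    plug P i 2 ((Id C P \<box> \<eta>) \<cdot> inverse_arr C (Runit C P)) b"
proof (rule iso_cancel_right[of "Assoc C (tpow C P i) P (tpow C P b)"])
  let ?i = "tpow C P i" and ?b = "tpow C P b"
  let ?c = "tcat C P i (Suc 0)"
  have "(insert_unit_at P \<eta> (Suc i) b \<cdot> plug P i (Suc 0) (Id C P) b) \<cdot> Assoc C ?i P ?b =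
      insert_unit_at P \<eta> (Suc i) b \<cdot>
        (tcat C P i (Suc 0 + b) \<cdot> (Id C ?i \<box> tcat C P (Suc 0) b) \<cdot> Assoc C ?i (tpow C P (Suc 0)) ?b)"
    unfolding plug_def by simp
  also have "\<dots> = (insert_unit_at P \<eta> (Suc i) b \<cdot> tcat C P (Suc i) b) \<cdot> (?c \<box> Id C ?b)"
    by (subst tcat_assoc[symmetric]) simp_all
  also have "\<dots> = (tcat C P (i + Suc 0) (Suc b) \<cdot> (?c \<box> Id C (tpow C P (Suc b)))) \<cdot>
      ((Id C ?i \<box> Id C P) \<box> insert_unit P \<eta> b)"
    unfolding insert_unit_at_tcat by simp
  also have "\<dots> = tcat C P i (Suc (Suc b)) \<cdot> (Id C ?i \<box> tcat C P (Suc 0) (Suc b)) \<cdot>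
      (Assoc C ?i P (tpow C P (Suc b)) \<cdot> ((Id C ?i \<box> Id C P) \<box> insert_unit P \<eta> b))"
    by (subst tcat_assoc) simp_all
  also have "\<dots> = tcat C P i (Suc (Suc b)) \<cdot>
      (Id C ?i \<box> (tcat C P (Suc 0) (Suc b) \<cdot> (Id C P \<box> insert_unit P \<eta> b))) \<cdot> Assoc C ?i P ?b"
    by (subst Assoc_natural[of _ ?i ?i _ P P _ ?b]) simp_all
  also have "\<dots> = plug P i 2 ((Id C P \<box> \<eta>) \<cdot> inverse_arr C (Runit C P)) b \<cdot> Assoc C ?i P ?b"
    unfolding tcat_insert_unit plug_def by (simp add: tpow_2)
  finally show "(insert_unit_at P \<eta> (Suc i) b \<cdot> plug P i (Suc 0) (Id C P) b) \<cdot> Assoc C ?i P ?b =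
      plug P i 2 ((Id C P \<box> \<eta>) \<cdot> inverse_arr C (Runit C P)) b \<cdot> Assoc C ?i P ?b" .
qed (simp_all add: tpow_2)

end


section \<open>Functors preserving sifted colimits\<close>

text \<open>
  Functors along which the universal property of the free monoid can be transported.  Reflexive
  coequalizers and sequential colimits are sifted colimits, whence the name.  Besides the
  identity, only composites of functors tensoring with a fixed object will occur.
\<close>

locale sifted_functor = abelian_category C
  for C :: "('o, 'm, 'x) preadditive_category_scheme" (structure) +
  fixes To :: "'o \<Rightarrow> 'o" and T :: "'m \<Rightarrow> 'm"
  assumes T_obj: "X \<in> Obj C \<Longrightarrow> To X \<in> Obj C"
    and T_hom: "f \<in> hom C X Y \<Longrightarrow> T f \<in> hom C (To X) (To Y)"
    and T_Id: "X \<in> Obj C \<Longrightarrow> T (Id C X) = Id C (To X)"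
    and T_comp: "f \<in> hom C X Y \<Longrightarrow> g \<in> hom C Y Z \<Longrightarrow> T (g \<cdot> f) = T g \<cdot> T f"
    and T_coequalizer: "is_reflexive_coequalizer C d0 d1 q \<Longrightarrow> is_coequalizer C (T d0) (T d1) (T q)"
    and T_seq_colimit: "is_seq_colimit C D \<phi> L j \<Longrightarrow>
      is_seq_colimit C (\<lambda>n. To (D n)) (\<lambda>n. T (\<phi> n)) (To L) (\<lambda>n. T (j n))"
begin

lemma T_typing:
  assumes "f \<in> Arr C"
  shows "T f \<in> Arr C" "Dom C (T f) = To (Dom C f)" "Cod C (T f) = To (Cod C f)"
  using T_hom[of f "Dom C f" "Cod C f"] assms by simp_all

lemma T_comp_arr:
  assumes "f \<in> Arr C" "g \<in> Arr C" "Dom C g = Cod C f"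
  shows "T (g \<cdot> f) = T g \<cdot> T f"
  using T_comp[of f "Dom C f" "Cod C f" g "Cod C g"] assms by simp

lemmas T_simps = T_obj T_typing T_Id T_comp_arr

text \<open>
  Functors preserve common sections.  Keeping the section in the conclusion makes the class
  closed under composition.
\<close>

lemma T_reflexive_coequalizer:
  assumes "is_reflexive_coequalizer C d0 d1 q"
  shows "is_reflexive_coequalizer C (T d0) (T d1) (T q)"
proof -
  note [simp] = T_simps
  obtain s where s: "s \<in> Arr C" "Dom C s = Cod C d0" "Cod C s = Dom C d0"
    "d0 \<cdot> s = Id C (Cod C d0)" "d1 \<cdot> s = Id C (Cod C d0)"
    and d: "d0 \<in> Arr C" "d1 \<in> Arr C" "Dom C d1 = Dom C d0" "Cod C d1 = Cod C d0"
    using assms unfolding is_reflexive_coequalizer_def is_coequalizer_def by auto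
  have "T d0 \<cdot> T s = T (d0 \<cdot> s)" "T d1 \<cdot> T s = T (d1 \<cdot> s)"
    using s(1-3) d by (simp_all del: s(4,5))
  then have "T d0 \<cdot> T s = Id C (To (Cod C d0))" "T d1 \<cdot> T s = Id C (To (Cod C d0))"
    using s d by simp_all
  moreover have "T s \<in> hom C (Cod C (T d0)) (Dom C (T d0))" "Cod C (T d0) = To (Cod C d0)"
    using s d by simp_all
  ultimately show ?thesis
    using T_coequalizer[OF assms] unfolding is_reflexive_coequalizer_def by (simp del: mem_hom) blast
qed

end

context abelian_category
begin

lemma sifted_id: "sifted_functor C (\<lambda>X. X) (\<lambda>f. f)"
  by unfold_locales (auto simp: is_reflexive_coequalizer_def)

lemma sifted_comp:
  assumes "sifted_functor C To T" "sifted_functor C So S"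
  shows "sifted_functor C (\<lambda>X. To (So X)) (\<lambda>f. T (S f))"
proof -
  interpret T: sifted_functor C To T by fact
  interpret S: sifted_functor C So S by fact
  show ?thesis
  proof unfold_locales
    fix f g X Y Z assume "f \<in> hom C X Y" "g \<in> hom C Y Z"
    then show "T (S (g \<cdot> f)) = T (S g) \<cdot> T (S f)"
      using S.T_hom T.T_comp S.T_comp by metis
  qed (use T.T_obj S.T_obj T.T_hom S.T_hom T.T_Id S.T_Id T.T_coequalizer S.T_reflexive_coequalizer
      T.T_seq_colimit S.T_seq_colimit in \<open>blast | metis\<close>)+
qed

end

locale free_monoid = abelian_monoidal_category C
  for C :: "('o, 'm, 'x) abelian_monoidal_category_scheme" (structure) +
  fixes V :: 'o
  assumes seq_colimits: "has_seq_colimits C"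
    and ten_seq_colimits: "ten_preserves_seq_colimits C"
    and ten_reflexive_coequalizers: "ten_preserves_reflexive_coequalizers C"
    and V_obj [simp]: "V \<in> Obj C"
begin

lemma sifted_ten:
  assumes [simp]: "A \<in> Obj C"
  shows "sifted_functor C (\<lambda>X. A \<box>\<^sub>o X) (\<lambda>f. Id C A \<box> f)"
    and "sifted_functor C (\<lambda>X. X \<box>\<^sub>o A) (\<lambda>f. f \<box> Id C A)"
proof -
  show "sifted_functor C (\<lambda>X. A \<box>\<^sub>o X) (\<lambda>f. Id C A \<box> f)"
    using ten_seq_colimits ten_reflexive_coequalizers
    by unfold_locales
      (simp_all add: ten_preserves_seq_colimits_def ten_preserves_reflexive_coequalizers_def)
  show "sifted_functor C (\<lambda>X. X \<box>\<^sub>o A) (\<lambda>f. f \<box> Id C A)"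
    using ten_seq_colimits ten_reflexive_coequalizers
    by unfold_locales
      (simp_all add: ten_preserves_seq_colimits_def ten_preserves_reflexive_coequalizers_def)
qed

lemma sifted_sandwich:
  "A \<in> Obj C \<Longrightarrow> B \<in> Obj C \<Longrightarrow> sifted_functor C (\<lambda>X. A \<box>\<^sub>o (X \<box>\<^sub>o B)) (\<lambda>f. sandwich C A f B)"
  unfolding sandwich_def using sifted_comp[OF sifted_ten(1) sifted_ten(2)] .

end


section \<open>The relations\<close>

context free_monoid
begin

abbreviation P :: 'o where "P \<equiv> Vplus C V"
abbreviation \<eta> :: 'm where "\<eta> \<equiv> in_unit C V"
abbreviation \<iota> :: 'm where "\<iota> \<equiv> in_V C V"

text \<open>
  By \<open>cokernel_is_reflexive_coequalizer\<close> these two arrows form a reflexive pair whose coequalizer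
  is the cokernel of \<open>tau C V\<close>.
\<close>

definition rel0 :: 'm
  where "rel0 = tau C V \<cdot> bi_pr1 C V (tpow C P 2) \<oplus> bi_pr2 C V (tpow C P 2)"

definition rel1 :: 'm
  where "rel1 = bi_pr2 C V (tpow C P 2)"

lemma P_typing [simp]: "P \<in> Obj C"
  "\<eta> \<in> Arr C" "Dom C \<eta> = Unit C" "Cod C \<eta> = P"
  "\<iota> \<in> Arr C" "Dom C \<iota> = V" "Cod C \<iota> = P"
  unfolding Vplus_def in_unit_def in_V_def by simp_all

sublocale pointed_object C P \<eta>
  by unfold_locales simp_all

lemma P_hom_ext:
  assumes "g \<in> hom C P Z" "h \<in> hom C P Z" "g \<cdot> \<eta> = h \<cdot> \<eta>" "g \<cdot> \<iota> = h \<cdot> \<iota>"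
  shows "g = h"
  using assms unfolding Vplus_def in_unit_def in_V_def
  by (intro bi_hom_ext[of "Unit C" V g Z h]) simp_all

lemma tau_typing [simp]: "tau C V \<in> Arr C" "Dom C (tau C V) = V" "Cod C (tau C V) = tpow C P 2"
  unfolding tau_def by (simp_all add: tpow_2)

lemma rel_typing [simp]:
  "rel0 \<in> Arr C" "Dom C rel0 = bi_obj C V (tpow C P 2)" "Cod C rel0 = tpow C P 2"
  "rel1 \<in> Arr C" "Dom C rel1 = bi_obj C V (tpow C P 2)" "Cod C rel1 = tpow C P 2"
  unfolding rel0_def rel1_def by simp_all

lemma rel_coequalizer: "is_reflexive_coequalizer C rel0 rel1 (coker C (tau C V))"
  using cokernel_is_reflexive_coequalizer[OF coker_is_cokernel[of "tau C V"]]
  unfolding rel0_def rel1_def by simp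

lemma rel_section:
  "rel0 \<cdot> bi_in2 C V (tpow C P 2) = Id C (tpow C P 2)"
  "rel1 \<cdot> bi_in2 C V (tpow C P 2) = Id C (tpow C P 2)"
  unfolding rel0_def rel1_def using reflexive_pair_of_arrow(2)[of "tau C V"] by simp_all

lemma sandwich_typing [simp]:
  assumes "A \<in> Obj C" "B \<in> Obj C" "f \<in> Arr C"
  shows "sandwich C A f B \<in> Arr C" "Dom C (sandwich C A f B) = A \<box>\<^sub>o (Dom C f \<box>\<^sub>o B)"
    "Cod C (sandwich C A f B) = A \<box>\<^sub>o (Cod C f \<box>\<^sub>o B)"
proof -
  have a: "f \<box> Id C B \<in> Arr C" using assms by simp
  show "sandwich C A f B \<in> Arr C" unfolding sandwich_def using assms a by simp
  show "Dom C (sandwich C A f B) = A \<box>\<^sub>o (Dom C f \<box>\<^sub>o B)" unfolding sandwich_def using assms by simp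
  show "Cod C (sandwich C A f B) = A \<box>\<^sub>o (Cod C f \<box>\<^sub>o B)" unfolding sandwich_def using assms by simp
qed

text \<open>
  The two descriptions of the relations agree: the image of the multilinear part is killed exactly
  if the reflexive pair, tensored on both sides, is coequalized.  The second description is the one
  that tensoring with further objects respects.
\<close>

lemma Rel_kills_iff:
  assumes [simp]: "A \<in> Obj C" "B \<in> Obj C" and g: "g \<in> hom C (A \<box>\<^sub>o (tpow C P 2 \<box>\<^sub>o B)) Z"
  shows "g \<cdot> Rel C V A B = Zero C (Dom C (Rel C V A B)) Z \<longleftrightarrow>
    g \<cdot> sandwich C A rel0 B = g \<cdot> sandwich C A rel1 B"
proof -
  let ?W = "A \<box>\<^sub>o (bi_obj C V (tpow C P 2) \<box>\<^sub>o B)"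
  have R: "Rel C V A B = im C (sandwich C A rel0 B \<cdot> ker C (sandwich C A rel1 B))"
    unfolding Rel_def multilinear_def rel0_def rel1_def Vn_def ..
  show ?thesis
    unfolding R
    by (rule coequalizes_iff_kills_im[of _ ?W _ _ "sandwich C A (bi_in2 C V (tpow C P 2)) B", symmetric])
      (use g in \<open>simp_all add: sandwich_def rel_section\<close>)
qed

lemma Rel_typing [simp]:
  assumes "A \<in> Obj C" "B \<in> Obj C"
  shows "Rel C V A B \<in> Arr C" "Cod C (Rel C V A B) = A \<box>\<^sub>o (tpow C P 2 \<box>\<^sub>o B)"
proof -
  have "Rel C V A B = im C (sandwich C A rel0 B \<cdot> ker C (sandwich C A rel1 B))"
    unfolding Rel_def multilinear_def rel0_def rel1_def Vn_def ..
  then show "Rel C V A B \<in> Arr C" "Cod C (Rel C V A B) = A \<box>\<^sub>o (tpow C P 2 \<box>\<^sub>o B)"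
    using assms by (simp_all add: im_def)
qed

abbreviation \<theta> :: "nat \<Rightarrow> nat \<Rightarrow> 'm"
  where "\<theta> i b \<equiv> plug P i 2 (Id C (tpow C P 2)) b"

lemma \<theta>_iso [simp]: "is_iso C (\<theta> i b)"
  unfolding plug_def by simp

lemma plug_\<theta>:
  assumes "d \<in> Arr C" "Cod C d = tpow C P 2"
  shows "plug P i 2 d b = \<theta> i b \<cdot> sandwich C (tpow C P i) d (tpow C P b)"
  unfolding sandwich_def using plug_comp[of P "Id C (tpow C P 2)" 2 d i b] assms by simp

lemma RelV_eq: "RelV C V (i + (2 + b)) i = \<theta> i b \<cdot> Rel C V (tpow C P i) (tpow C P b)"
  unfolding RelV_def Vcat_def Vn_def plug_def by simp

text \<open>
  The condition for an arrow out of the image under \<open>T\<close> of a tensor power to factor through the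
  image of the quotient map; sufficiency is \<open>quot_extend\<close>.
\<close>

definition descends :: "('m \<Rightarrow> 'm) \<Rightarrow> nat \<Rightarrow> 'm \<Rightarrow> bool"
  where "descends T n g \<longleftrightarrow>
    (\<forall>i b. n = i + (2 + b) \<longrightarrow> g \<cdot> T (plug P i 2 rel0 b) = g \<cdot> T (plug P i 2 rel1 b))"

definition relations :: "nat \<Rightarrow> 'm"
  where "relations n = copair C {i. i + 2 \<le> n} (\<lambda>i. Dom C (RelV C V n i)) (Vn C V n) (RelV C V n)"

lemma position_cases:
  fixes i n :: nat
  assumes "i + 2 \<le> n" obtains b where "n = i + (2 + b)"
  using assms that[of "n - i - 2"] by simp

lemma RelV_hom:
  assumes "i \<in> {i. i + 2 \<le> n}"
  shows "RelV C V n i \<in> hom C (Dom C (RelV C V n i)) (Vn C V n)"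
proof -
  obtain b where b: "n = i + (2 + b)" using assms position_cases by blast
  show ?thesis unfolding b RelV_eq Vn_def by simp
qed

lemma finite_positions: "finite {i. i + 2 \<le> (n::nat)}"
  by (rule finite_subset[of _ "{..n}"]) auto

lemma Vn_obj: "Vn C V n \<in> Obj C"
  unfolding Vn_def by simp

lemma relations_props:
  shows relations_typing [simp]: "relations n \<in> Arr C" "Cod C (relations n) = tpow C P n"
    and relations_factor: "i + 2 \<le> n \<Longrightarrow>
      \<exists>k\<in>hom C (Dom C (RelV C V n i)) (Dom C (relations n)). relations n \<cdot> k = RelV C V n i"
    and relations_in_ideal: "arrow_ideal (tpow C P n) N \<Longrightarrow>
      (\<And>i. i + 2 \<le> n \<Longrightarrow> RelV C V n i \<in> N) \<Longrightarrow> relations n \<in> N"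
proof -
  note * = copair_props[where J = "{i. i + 2 \<le> n}" and X = "\<lambda>i. Dom C (RelV C V n i)" and g = "RelV C V n"
      and Y = "Vn C V n", folded relations_def]
  note ** = finite_positions Vn_obj RelV_hom
  show "relations n \<in> Arr C" by (rule *(1)) (use ** in blast)+
  show "Cod C (relations n) = tpow C P n"
    unfolding Vn_def[symmetric] by (rule *(2)) (use ** in blast)+
  show "\<exists>k\<in>hom C (Dom C (RelV C V n i)) (Dom C (relations n)). relations n \<cdot> k = RelV C V n i"
    if "i + 2 \<le> n"
    by (rule *(3)) (use ** that in blast)+
  show "relations n \<in> N"
    if "arrow_ideal (tpow C P n) N" "\<And>i. i + 2 \<le> n \<Longrightarrow> RelV C V n i \<in> N"
    by (rule *(4)) (use ** that[folded Vn_def] in blast)+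
qed

lemma quot_eq: "quot C V n = coker C (relations n)"
  unfolding quot_def relations_def ..

lemma quot_typing [simp]:
  "quot C V n \<in> Arr C" "Dom C (quot C V n) = tpow C P n" "Cod C (quot C V n) = Vtilde C V n"
  by (simp_all add: quot_eq Vtilde_def)

lemma Vtilde_obj [simp]: "Vtilde C V n \<in> Obj C"
  using dom_cod_obj(2)[OF quot_typing(1)] by simp

lemma quot_descends: "descends (\<lambda>f. f) n (quot C V n)"
  unfolding descends_def
proof (intro allI impI)
  fix i b assume n: "n = i + (2 + b)"
  let ?A = "tpow C P i" and ?B = "tpow C P b"
  have "i + 2 \<le> n" using n by simp
  then have "\<exists>k\<in>hom C (Dom C (RelV C V n i)) (Dom C (relations n)). relations n \<cdot> k = RelV C V n i"
    by (rule relations_factor)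
  then obtain k where k: "k \<in> hom C (Dom C (RelV C V n i)) (Dom C (relations n))"
    "relations n \<cdot> k = RelV C V n i" ..
  have "(quot C V n \<cdot> relations n) \<cdot> k = Zero C (Dom C k) (Vtilde C V n)"
    using k(1) unfolding quot_eq Vtilde_def by simp
  then have "quot C V n \<cdot> RelV C V n i = Zero C (Dom C (RelV C V n i)) (Vtilde C V n)"
    using k by simp
  then have "(quot C V n \<cdot> \<theta> i b) \<cdot> Rel C V ?A ?B = Zero C (Dom C (Rel C V ?A ?B)) (Vtilde C V n)"
    unfolding n RelV_eq by simp
  then have "(quot C V n \<cdot> \<theta> i b) \<cdot> sandwich C ?A rel0 ?B = (quot C V n \<cdot> \<theta> i b) \<cdot> sandwich C ?A rel1 ?B"
    by (subst (asm) Rel_kills_iff) (simp_all add: n)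
  then show "quot C V n \<cdot> plug P i 2 rel0 b = quot C V n \<cdot> plug P i 2 rel1 b"
    by (simp add: plug_\<theta>[of rel0] plug_\<theta>[of rel1] n)
qed

text \<open>
  At a single position the relation is the tensored reflexive pair, whose coequalizer \<open>T\<close> preserves.
\<close>

lemma descends_factor:
  assumes "sifted_functor C To T" and g: "g \<in> hom C (To (tpow C P n)) Z"
    and "descends T n g" and n: "n = i + (2 + b)"
  obtains h where
    "h \<in> hom C (To (tpow C P i \<box>\<^sub>o (Cod C (coker C (tau C V)) \<box>\<^sub>o tpow C P b))) Z"
    "h \<cdot> T (sandwich C (tpow C P i) (coker C (tau C V)) (tpow C P b)) = g \<cdot> T (\<theta> i b)"
proof -
  interpret T: sifted_functor C To T by fact
  note [simp] = T.T_simps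
  let ?A = "tpow C P i" and ?B = "tpow C P b"
  interpret S: sifted_functor C "\<lambda>X. ?A \<box>\<^sub>o (X \<box>\<^sub>o ?B)" "\<lambda>f. sandwich C ?A f ?B"
    by (rule sifted_sandwich) simp_all
  have "g \<cdot> T (plug P i 2 rel0 b) = g \<cdot> T (plug P i 2 rel1 b)"
    using assms(3) n unfolding descends_def by blast
  then have "(g \<cdot> T (\<theta> i b)) \<cdot> T (sandwich C ?A rel0 ?B) = (g \<cdot> T (\<theta> i b)) \<cdot> T (sandwich C ?A rel1 ?B)"
    using g by (simp add: plug_\<theta>[of rel0] plug_\<theta>[of rel1] n)
  then obtain h where "h \<in> hom C (Cod C (T (sandwich C ?A (coker C (tau C V)) ?B))) (Cod C (g \<cdot> T (\<theta> i b)))"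
    "h \<cdot> T (sandwich C ?A (coker C (tau C V)) ?B) = g \<cdot> T (\<theta> i b)"
    using coequalizer_factor[OF T.T_coequalizer[OF S.T_reflexive_coequalizer[OF rel_coequalizer]],
        of "g \<cdot> T (\<theta> i b)"] g by (auto simp: n)
  then show thesis using that g by (simp add: n)
qed

lemma coker_tau_kills_Rel:
  assumes [simp]: "A \<in> Obj C" "B \<in> Obj C"
  defines "c \<equiv> sandwich C A (coker C (tau C V)) B"
  shows "c \<cdot> Rel C V A B = Zero C (Dom C (Rel C V A B)) (Cod C c)"
proof -
  interpret S: sifted_functor C "\<lambda>X. A \<box>\<^sub>o (X \<box>\<^sub>o B)" "\<lambda>f. sandwich C A f B"
    by (rule sifted_sandwich) simp_all
  have "c \<cdot> sandwich C A rel0 B = c \<cdot> sandwich C A rel1 B"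
    using S.T_coequalizer[OF rel_coequalizer] unfolding is_coequalizer_def c_def by blast
  then show ?thesis
    by (subst Rel_kills_iff) (simp_all add: c_def)
qed

lemma quot_coequalizer:
  fixes n :: nat
  defines "p1 \<equiv> bi_pr1 C (Dom C (relations n)) (tpow C P n)"
    and "p2 \<equiv> bi_pr2 C (Dom C (relations n)) (tpow C P n)"
  shows "is_reflexive_coequalizer C (relations n \<cdot> p1 \<oplus> p2) p2 (quot C V n)"
  unfolding quot_eq p1_def p2_def
  using cokernel_is_reflexive_coequalizer[OF coker_is_cokernel[of "relations n"]] by simp

lemma quot_epi:
  assumes "sifted_functor C To T" "g \<in> hom C (To (Vtilde C V n)) Z" "h \<in> hom C (To (Vtilde C V n)) Z"
    and "g \<cdot> T (quot C V n) = h \<cdot> T (quot C V n)"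
  shows "g = h"
proof -
  interpret T: sifted_functor C To T by fact
  show ?thesis
    using coequalizer_epi[OF T.T_coequalizer[OF quot_coequalizer]] assms(2-4)
    by (simp add: T.T_simps)
qed

text \<open>
  The relations at all positions together are the image of one arrow, \<open>relations n\<close>, whose cokernel
  is the coequalizer of a reflexive pair; \<open>T\<close> preserves this coequalizer, so it remains to see that
  \<open>g\<close> coequalizes the image of that pair.  Since \<open>T\<close> need not be additive, this cannot be split into
  one condition for each position by linearity.  Instead consider the arrows \<open>h\<close> that \<open>g\<close> absorbs:
  adding a composite of \<open>h\<close> to the argument of \<open>g\<close> has no effect.  Absorbing several summands one after the
  other shows that they form an ideal.  A single relation is absorbed because \<open>g\<close>, by
  \<open>descends_factor\<close>, factors through the image of an arrow that kills the relation.
\<close>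

lemma quot_extend:
  assumes "sifted_functor C To T" and g: "g \<in> hom C (To (tpow C P n)) Z" and "descends T n g"
  obtains h where "h \<in> hom C (To (Vtilde C V n)) Z" "h \<cdot> T (quot C V n) = g"
proof -
  interpret T: sifted_functor C To T by fact
  note [simp] = T.T_simps
  let ?X = "tpow C P n"
  have gT [simp]: "g \<in> Arr C" "Dom C g = To ?X" "Cod C g = Z" using g by simp_all
  define N where "N = {h. h \<in> Arr C \<and> Cod C h = ?X \<and>
    (\<forall>k x. k \<in> Arr C \<longrightarrow> x \<in> hom C (Dom C k) ?X \<longrightarrow> Cod C k = Dom C h \<longrightarrow>
      g \<cdot> T (x \<oplus> h \<cdot> k) = g \<cdot> T x)}"
  have ideal: "arrow_ideal ?X N"
    unfolding arrow_ideal_def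
  proof (intro conjI ballI impI)
    fix f assume f: "f \<in> N"
    then have [simp]: "f \<in> Arr C" "Cod C f = ?X" unfolding N_def by simp_all
    show "f \<in> Arr C" "Cod C f = ?X" by simp_all
    show "f \<cdot> k \<in> N" if "k \<in> Arr C" "Cod C k = Dom C f" for k
      using f that unfolding N_def by simp
    fix h assume h: "h \<in> N" and dom: "Dom C h = Dom C f"
    then have [simp]: "h \<in> Arr C" "Cod C h = ?X" "Dom C h = Dom C f" unfolding N_def by simp_all
    have "g \<cdot> T (x \<oplus> (f \<oplus> h) \<cdot> k) = g \<cdot> T x"
      if k: "k \<in> Arr C" and x: "x \<in> hom C (Dom C k) ?X" and kf: "Cod C k = Dom C f" for k x
    proof -
      have [simp]: "x \<in> Arr C" "Dom C x = Dom C k" "Cod C x = ?X" using x by simp_all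
      \<comment> \<open>First \<open>h\<close> is absorbed at the argument \<open>x \<oplus> f \<cdot> k\<close>, then \<open>f\<close> at the argument \<open>x\<close>.\<close>
      have "x \<oplus> (f \<oplus> h) \<cdot> k = (x \<oplus> f \<cdot> k) \<oplus> h \<cdot> k"
        using k kf add_assoc[of x "Dom C k" ?X "f \<cdot> k" "h \<cdot> k"] by (simp add: comp_distrib)
      moreover have "x \<oplus> f \<cdot> k \<in> hom C (Dom C k) ?X" using k kf by simp
      then have "g \<cdot> T ((x \<oplus> f \<cdot> k) \<oplus> h \<cdot> k) = g \<cdot> T (x \<oplus> f \<cdot> k)"
        using h k kf unfolding N_def by (simp del: mem_hom)
      moreover have "g \<cdot> T (x \<oplus> f \<cdot> k) = g \<cdot> T x"
        using f k kf x unfolding N_def by (simp del: mem_hom)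
      ultimately show ?thesis by simp
    qed
    then show "f \<oplus> h \<in> N" unfolding N_def by (simp del: mem_hom)
  next
    show "Zero C W ?X \<in> N" if "W \<in> Obj C" for W
      using that unfolding N_def by simp
  qed
  have "RelV C V n i \<in> N" if i: "i + 2 \<le> n" for i
  proof -
    obtain b where n: "n = i + (2 + b)" using i position_cases by blast
    let ?A = "tpow C P i" and ?B = "tpow C P b"
    let ?R = "Rel C V ?A ?B" and ?c = "sandwich C ?A (coker C (tau C V)) ?B"
    obtain h where h: "h \<in> Arr C" "Dom C h = Cod C (T ?c)" "Cod C h = Z" "h \<cdot> T ?c = g \<cdot> T (\<theta> i b)"
      using descends_factor[OF assms n] by (auto simp: n)
    have "g \<cdot> T (x \<oplus> (\<theta> i b \<cdot> ?R) \<cdot> k) = g \<cdot> T x"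
      if k: "k \<in> Arr C" and x: "x \<in> hom C (Dom C k) ?X" and kR: "Cod C k = Dom C ?R" for k x
    proof -
      have [simp]: "x \<in> Arr C" "Dom C x = Dom C k" "Cod C x = ?X" using x by simp_all
      \<comment> \<open>The factorization of \<open>g\<close> lives on the threefold product, so \<open>x\<close> is moved there first.\<close>
      obtain y where y: "y \<in> Arr C" "Dom C y = Dom C k" "Cod C y = Dom C (\<theta> i b)" "\<theta> i b \<cdot> y = x"
        using that[of "inverse_arr C (\<theta> i b) \<cdot> x"] by (simp add: n)
      have "?c \<cdot> ?R \<cdot> k = (?c \<cdot> ?R) \<cdot> k"
        using k kR by simp
      then have "?c \<cdot> ?R \<cdot> k = Zero C (Dom C k) (Cod C ?c)"
        unfolding coker_tau_kills_Rel[OF tpow_obj[OF P] tpow_obj[OF P]] using k kR by simp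
      then have c: "?c \<cdot> (y \<oplus> ?R \<cdot> k) = ?c \<cdot> y"
        using y k kR comp_distrib(1)[of y "?R \<cdot> k" ?c] by simp
      have "x \<oplus> (\<theta> i b \<cdot> ?R) \<cdot> k = \<theta> i b \<cdot> (y \<oplus> ?R \<cdot> k)"
        using y k kR by (simp add: comp_distrib)
      then have "g \<cdot> T (x \<oplus> (\<theta> i b \<cdot> ?R) \<cdot> k) = (g \<cdot> T (\<theta> i b)) \<cdot> T (y \<oplus> ?R \<cdot> k)"
        using y k kR by (simp add: n)
      also have "\<dots> = (h \<cdot> T ?c) \<cdot> T (y \<oplus> ?R \<cdot> k)"
        by (simp only: h(4))
      also have "\<dots> = h \<cdot> T (?c \<cdot> (y \<oplus> ?R \<cdot> k))"
        using y k kR h(1-3) by (simp add: n)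
      also have "\<dots> = (h \<cdot> T ?c) \<cdot> T y"
        unfolding c using y k kR h(1-3) by (simp add: n)
      also have "\<dots> = (g \<cdot> T (\<theta> i b)) \<cdot> T y"
        by (simp only: h(4))
      also have "\<dots> = g \<cdot> T (\<theta> i b \<cdot> y)"
        using y(1-3) by (simp add: n)
      finally show ?thesis using y by simp
    qed
    then show ?thesis
      unfolding N_def n RelV_eq by simp
  qed
  then have rel_N: "relations n \<in> N"
    using relations_in_ideal[OF ideal] by blast
  let ?p1 = "bi_pr1 C (Dom C (relations n)) ?X" and ?p2 = "bi_pr2 C (Dom C (relations n)) ?X"
  have "g \<cdot> T (?p2 \<oplus> relations n \<cdot> ?p1) = g \<cdot> T ?p2"
    using rel_N unfolding N_def by simp
  moreover have "?p2 \<oplus> relations n \<cdot> ?p1 = relations n \<cdot> ?p1 \<oplus> ?p2"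
    by (rule add_comm[of _ "bi_obj C (Dom C (relations n)) ?X" ?X]) simp_all
  ultimately have "g \<cdot> T (relations n \<cdot> ?p1 \<oplus> ?p2) = g \<cdot> T ?p2"
    by simp
  then show thesis
    using coequalizer_factor[OF T.T_coequalizer[OF quot_coequalizer], of g n] that by auto
qed

end


section \<open>The colimit\<close>

context free_monoid
begin

lemma tau_add:
  "((\<iota> \<box> \<eta>) \<cdot> inverse_arr C (Runit C V)) \<oplus> tau C V = (\<eta> \<box> \<iota>) \<cdot> inverse_arr C (Lunit C V)"
  unfolding tau_def by (rule add_sub) simp_all

text \<open>
  The two ways of inserting the unit next to a factor differ by \<open>tau C V\<close> on the summand \<open>V\<close>, and
  agree on the unit summand because the left and right unit isomorphisms of the unit object
  coincide.
\<close>

lemma coker_tau_units: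
  "coker C (tau C V) \<cdot> (\<eta> \<box> Id C P) \<cdot> inverse_arr C (Lunit C P) =
    coker C (tau C V) \<cdot> (Id C P \<box> \<eta>) \<cdot> inverse_arr C (Runit C P)"
proof (rule P_hom_ext)
  let ?q = "coker C (tau C V)"
  have [simp]: "?q \<in> Arr C" "Dom C ?q = P \<box>\<^sub>o P" by (simp_all add: tpow_2)
  let ?l = "\<lambda>X. inverse_arr C (Lunit C X)" and ?r = "\<lambda>X. inverse_arr C (Runit C X)"
  show "?q \<cdot> (\<eta> \<box> Id C P) \<cdot> ?l P \<in> hom C P (Cod C ?q)" "?q \<cdot> (Id C P \<box> \<eta>) \<cdot> ?r P \<in> hom C P (Cod C ?q)"
    by simp_all
  have l: "?l P \<cdot> f = (Id C (Unit C) \<box> f) \<cdot> ?l (Dom C f)" if "f \<in> Arr C" "Cod C f = P" for f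
    using Lunit_inverse_natural[of f "Dom C f" P] that by simp
  have r: "?r P \<cdot> f = (f \<box> Id C (Unit C)) \<cdot> ?r (Dom C f)" if "f \<in> Arr C" "Cod C f = P" for f
    using Runit_inverse_natural[of f "Dom C f" P] that by simp
  show "(?q \<cdot> (\<eta> \<box> Id C P) \<cdot> ?l P) \<cdot> \<eta> = (?q \<cdot> (Id C P \<box> \<eta>) \<cdot> ?r P) \<cdot> \<eta>"
    by (simp add: l r Lunit_Unit)
  have "?q \<cdot> (\<eta> \<box> \<iota>) \<cdot> ?l V = ?q \<cdot> ((\<iota> \<box> \<eta>) \<cdot> ?r V \<oplus> tau C V)"
    by (simp only: tau_add)
  also have "\<dots> = ?q \<cdot> (\<iota> \<box> \<eta>) \<cdot> ?r V"
    by (subst comp_distrib(1)) (simp_all add: tpow_2)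
  finally show "(?q \<cdot> (\<eta> \<box> Id C P) \<cdot> ?l P) \<cdot> \<iota> = (?q \<cdot> (Id C P \<box> \<eta>) \<cdot> ?r P) \<cdot> \<iota>"
    by (simp add: l r)
qed

lemma quot_insert_unit_at_Suc:
  "quot C V (Suc (i + Suc b)) \<cdot> insert_unit_at P \<eta> (Suc i) b =
    quot C V (Suc (i + Suc b)) \<cdot> insert_unit_at P \<eta> i (Suc b)"
proof (rule iso_cancel_right[of "plug P i (Suc 0) (Id C P) b"])
  let ?n = "Suc (i + Suc b)"
  let ?q = "coker C (tau C V)"
  let ?l = "(\<eta> \<box> Id C P) \<cdot> inverse_arr C (Lunit C P)" and ?r = "(Id C P \<box> \<eta>) \<cdot> inverse_arr C (Runit C P)"
  let ?s = "\<lambda>f. sandwich C (tpow C P i) f (tpow C P b)"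
  have [simp]: "?q \<in> Arr C" "Dom C ?q = P \<box>\<^sub>o P" by (simp_all add: tpow_2)
  have n: "?n = i + (2 + b)" by simp
  have "quot C V ?n \<in> hom C (tpow C P ?n) (Vtilde C V ?n)" by simp
  from descends_factor[OF sifted_id this quot_descends n]
  obtain h where h: "h \<in> Arr C" "Dom C h = Cod C (?s ?q)" "h \<cdot> ?s ?q = quot C V ?n \<cdot> \<theta> i b"
    by auto
  have plug: "quot C V ?n \<cdot> plug P i 2 d b = h \<cdot> ?s (?q \<cdot> d)" if "d \<in> hom C P (P \<box>\<^sub>o P)" for d
  proof -
    have d: "d \<in> Arr C" "Dom C d = P" "Cod C d = P \<box>\<^sub>o P" using that by simp_all
    have "quot C V ?n \<cdot> plug P i 2 d b = (quot C V ?n \<cdot> \<theta> i b) \<cdot> ?s d"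
      using d by (simp add: plug_\<theta>[of d] tpow_2)
    also have "\<dots> = (h \<cdot> ?s ?q) \<cdot> ?s d"
      by (simp only: h(3))
    also have "\<dots> = h \<cdot> ?s (?q \<cdot> d)"
      using d h(1,2) by (simp add: sandwich_def)
    finally show ?thesis .
  qed
  show "(quot C V ?n \<cdot> insert_unit_at P \<eta> (Suc i) b) \<cdot> plug P i (Suc 0) (Id C P) b =
      (quot C V ?n \<cdot> insert_unit_at P \<eta> i (Suc b)) \<cdot> plug P i (Suc 0) (Id C P) b"
    using plug[of ?l] plug[of ?r]
    by (simp add: insert_unit_at_plug insert_unit_at_Suc_plug coker_tau_units)
  show "is_iso C (plug P i (Suc 0) (Id C P) b)"
    unfolding plug_def by simp
qed simp_all

lemma quot_insert_unit_at:
  "i \<le> n \<Longrightarrow> quot C V (Suc n) \<cdot> insert_unit_at P \<eta> i (n - i) = quot C V (Suc n) \<cdot> insert_unit P \<eta> n"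
proof (induction i)
  case 0
  then show ?case by (simp add: insert_unit_at_0)
next
  case (Suc i)
  then have "n = i + Suc (n - Suc i)" "n - i = Suc (n - Suc i)" by simp_all
  then show ?case using quot_insert_unit_at_Suc[of i "n - Suc i"] Suc by simp
qed

lemma eta_eq: "i \<le> n \<Longrightarrow> eta C V n i = insert_unit_at P \<eta> i (n - i)"
  unfolding eta_def insert_unit_at_def insert_unit_def Vcat_def Vn_def by simp

text \<open>
  The position of the unit does not matter, so the unit may be put in front, where it only shifts
  the relations.
\<close>

lemma eta_tilde_props:
  shows eta_tilde_typing [simp]: "eta_tilde C V n \<in> Arr C"
      "Dom C (eta_tilde C V n) = Vtilde C V n" "Cod C (eta_tilde C V n) = Vtilde C V (Suc n)"
    and eta_tilde_quot: "eta_tilde C V n \<cdot> quot C V n = quot C V (Suc n) \<cdot> insert_unit P \<eta> n"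
proof -
  let ?g = "quot C V (Suc n) \<cdot> insert_unit P \<eta> n"
  have "descends (\<lambda>f. f) n ?g"
    unfolding descends_def
  proof (intro allI impI)
    fix i b assume n: "n = i + (2 + b)"
    have *: "?g \<cdot> plug P i 2 d b = (quot C V (Suc n) \<cdot> plug P (Suc i) 2 d b) \<cdot>
        (insert_unit P \<eta> i \<box> Id C (Dom C d \<box>\<^sub>o tpow C P b))"
      if "d \<in> Arr C" "Cod C d = tpow C P 2" for d
    proof -
      have "?g \<cdot> plug P i 2 d b = quot C V (Suc n) \<cdot> (insert_unit P \<eta> (i + (2 + b)) \<cdot> plug P i 2 d b)"
        using that n by simp
      also have "\<dots> = (quot C V (Suc n) \<cdot> plug P (Suc i) 2 d b) \<cdot>
          (insert_unit P \<eta> i \<box> Id C (Dom C d \<box>\<^sub>o tpow C P b))"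
        using that n by (subst insert_unit_plug[of d "Dom C d" 2]) simp_all
      finally show ?thesis .
    qed
    have "Suc n = Suc i + (2 + b)" using n by simp
    then have "quot C V (Suc n) \<cdot> plug P (Suc i) 2 rel0 b = quot C V (Suc n) \<cdot> plug P (Suc i) 2 rel1 b"
      using quot_descends[of "Suc n"] unfolding descends_def by blast
    then show "?g \<cdot> plug P i 2 rel0 b = ?g \<cdot> plug P i 2 rel1 b"
      by (simp only: * rel_typing)
  qed
  moreover have "?g \<in> hom C (tpow C P n) (Vtilde C V (Suc n))"
    by simp
  ultimately obtain h where h: "h \<in> hom C (Vtilde C V n) (Vtilde C V (Suc n))" "h \<cdot> quot C V n = ?g"
    using quot_extend[OF sifted_id] by blast
  have "\<exists>!g. g \<in> hom C (Vtilde C V n) (Vtilde C V (Suc n)) \<and>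
      (\<forall>i\<le>n. g \<cdot> quot C V n = quot C V (Suc n) \<cdot> eta C V n i)"
  proof (rule ex1I[of _ h])
    show "h \<in> hom C (Vtilde C V n) (Vtilde C V (Suc n)) \<and>
        (\<forall>i\<le>n. h \<cdot> quot C V n = quot C V (Suc n) \<cdot> eta C V n i)"
      using h by (simp add: eta_eq quot_insert_unit_at)
    fix g assume g: "g \<in> hom C (Vtilde C V n) (Vtilde C V (Suc n)) \<and>
        (\<forall>i\<le>n. g \<cdot> quot C V n = quot C V (Suc n) \<cdot> eta C V n i)"
    then have "g \<cdot> quot C V n = quot C V (Suc n) \<cdot> eta C V n 0" by blast
    then have "g \<cdot> quot C V n = h \<cdot> quot C V n"
      using h(2) quot_insert_unit_at[of 0 n] by (simp add: eta_eq)
    with g show "g = h" using quot_epi[OF sifted_id _ h(1)] by blast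
  qed
  from theI'[OF this] have *: "eta_tilde C V n \<in> hom C (Vtilde C V n) (Vtilde C V (Suc n))"
    "eta_tilde C V n \<cdot> quot C V n = quot C V (Suc n) \<cdot> eta C V n 0"
    unfolding eta_tilde_def by blast+
  show "eta_tilde C V n \<in> Arr C"
      "Dom C (eta_tilde C V n) = Vtilde C V n" "Cod C (eta_tilde C V n) = Vtilde C V (Suc n)"
    using *(1) by simp_all
  show "eta_tilde C V n \<cdot> quot C V n = quot C V (Suc n) \<cdot> insert_unit P \<eta> n"
    using *(2) quot_insert_unit_at[of 0 n] by (simp add: eta_eq)
qed

abbreviation Fr :: 'o where "Fr \<equiv> free_obj C V"

lemma free_colimit: "is_seq_colimit C (Vtilde C V) (eta_tilde C V) Fr (free_in C V)"
proof -
  have "is_sequence C (Vtilde C V) (eta_tilde C V)"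
    unfolding is_sequence_def by simp
  then have "\<exists>d. case d of (L, j) \<Rightarrow> is_seq_colimit C (Vtilde C V) (eta_tilde C V) L j"
    using seq_colimits unfolding has_seq_colimits_def by auto
  from someI_ex[OF this] show ?thesis
    unfolding free_obj_def free_in_def seq_colimit_def by (simp add: case_prod_unfold)
qed

lemma free_in_typing [simp]:
  "free_in C V n \<in> Arr C" "Dom C (free_in C V n) = Vtilde C V n" "Cod C (free_in C V n) = Fr"
  "free_in C V (Suc n) \<cdot> eta_tilde C V n = free_in C V n" "Fr \<in> Obj C"
  using free_colimit unfolding is_seq_colimit_def is_cocone_def by simp_all

text \<open>
  The canonical arrow from the \<open>n\<close>-th tensor power of \<open>Vplus C V\<close> to the free monoid.
\<close>

definition word :: "nat \<Rightarrow> 'm"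
  where "word n = free_in C V n \<cdot> quot C V n"

lemma word_typing [simp]: "word n \<in> Arr C" "Dom C (word n) = tpow C P n" "Cod C (word n) = Fr"
  unfolding word_def by simp_all

lemma word_insert_unit_at:
  assumes "i \<le> n"
  shows "word (Suc n) \<cdot> insert_unit_at P \<eta> i (n - i) = word n"
proof -
  have "word (Suc n) \<cdot> insert_unit_at P \<eta> i (n - i) =
      free_in C V (Suc n) \<cdot> (quot C V (Suc n) \<cdot> insert_unit_at P \<eta> i (n - i))"
    unfolding word_def using assms by simp
  also have "\<dots> = (free_in C V (Suc n) \<cdot> eta_tilde C V n) \<cdot> quot C V n"
    unfolding quot_insert_unit_at[OF assms] eta_tilde_quot[symmetric]
    by (rule comp_reassoc[symmetric]) simp_all
  finally show ?thesis unfolding word_def by simp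
qed

lemma word_insert_unit: "word (Suc n) \<cdot> insert_unit P \<eta> n = word n"
  using word_insert_unit_at[of 0 n] by (simp add: insert_unit_at_0)

lemma word_plug: "word (i + (2 + b)) \<cdot> plug P i 2 rel0 b = word (i + (2 + b)) \<cdot> plug P i 2 rel1 b"
proof -
  have "quot C V (i + (2 + b)) \<cdot> plug P i 2 rel0 b = quot C V (i + (2 + b)) \<cdot> plug P i 2 rel1 b"
    using quot_descends unfolding descends_def by blast
  then show ?thesis unfolding word_def by simp
qed

lemma word_jointly_epi:
  assumes "sifted_functor C To T" "g \<in> hom C (To Fr) Z" "h \<in> hom C (To Fr) Z"
    and "\<And>n. g \<cdot> T (word n) = h \<cdot> T (word n)"
  shows "g = h"
proof -
  interpret T: sifted_functor C To T by fact
  note [simp] = T.T_simps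
  have [simp]: "g \<in> Arr C" "Dom C g = To Fr" "Cod C g = Z" "h \<in> Arr C" "Dom C h = To Fr" "Cod C h = Z"
    using assms(2,3) by simp_all
  have "g \<cdot> T (free_in C V n) = h \<cdot> T (free_in C V n)" for n
    by (rule quot_epi[OF assms(1), of _ n Z])
      (use assms(4)[of n] in \<open>simp_all add: word_def\<close>)
  then show ?thesis
    using seq_colimit_jointly_epi[OF T.T_seq_colimit[OF free_colimit] assms(2,3)] by blast
qed

text \<open>
  The universal property of the free monoid as an object: an arrow out of its image under \<open>T\<close> is a
  family of arrows out of the images of the tensor powers that respects the relations and is
  compatible with inserting the unit.  Uniqueness is \<open>word_jointly_epi\<close>.
\<close>

lemma word_extend:
  assumes "sifted_functor C To T" and Z: "Z \<in> Obj C" and g: "\<And>n. g n \<in> hom C (To (tpow C P n)) Z"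
    and rel: "\<And>i b. g (i + (2 + b)) \<cdot> T (plug P i 2 rel0 b) = g (i + (2 + b)) \<cdot> T (plug P i 2 rel1 b)"
    and unit: "\<And>n. g (Suc n) \<cdot> T (insert_unit P \<eta> n) = g n"
  obtains h where "h \<in> hom C (To Fr) Z" "\<And>n. h \<cdot> T (word n) = g n"
proof -
  interpret T: sifted_functor C To T by fact
  note [simp] = T.T_simps
  have [simp]: "g n \<in> Arr C" "Dom C (g n) = To (tpow C P n)" "Cod C (g n) = Z" for n
    using g by simp_all
  have "\<exists>k. k \<in> hom C (To (Vtilde C V n)) Z \<and> k \<cdot> T (quot C V n) = g n" for n
  proof -
    have "descends T n (g n)"
      using rel unfolding descends_def by blast
    then show ?thesis using quot_extend[OF assms(1) g] by blast
  qed
  then obtain k where "\<forall>n. k n \<in> hom C (To (Vtilde C V n)) Z \<and> k n \<cdot> T (quot C V n) = g n"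
    using choice[of "\<lambda>n k. k \<in> hom C (To (Vtilde C V n)) Z \<and> k \<cdot> T (quot C V n) = g n"] by blast
  then have k [simp]: "k n \<in> Arr C" "Dom C (k n) = To (Vtilde C V n)" "Cod C (k n) = Z"
    and kq: "k n \<cdot> T (quot C V n) = g n" for n
    by simp_all
  have step: "k (Suc n) \<cdot> T (eta_tilde C V n) = k n" for n
  proof (rule quot_epi[OF assms(1)])
    have "(k (Suc n) \<cdot> T (eta_tilde C V n)) \<cdot> T (quot C V n) = k (Suc n) \<cdot> T (eta_tilde C V n \<cdot> quot C V n)"
      by simp
    also have "\<dots> = (k (Suc n) \<cdot> T (quot C V (Suc n))) \<cdot> T (insert_unit P \<eta> n)"
      unfolding eta_tilde_quot by simp
    finally show "(k (Suc n) \<cdot> T (eta_tilde C V n)) \<cdot> T (quot C V n) = k n \<cdot> T (quot C V n)"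
      unfolding kq unit .
  qed simp_all
  then have "is_cocone C (\<lambda>n. To (Vtilde C V n)) (\<lambda>n. T (eta_tilde C V n)) Z k"
    using Z unfolding is_cocone_def by simp
  then obtain h where h: "h \<in> hom C (To Fr) Z" "\<And>n. h \<cdot> T (free_in C V n) = k n"
    using seq_colimit_factor[OF T.T_seq_colimit[OF free_colimit]] by blast
  have "h \<cdot> T (word n) = (h \<cdot> T (free_in C V n)) \<cdot> T (quot C V n)" for n
    using h(1) unfolding word_def by simp
  then show thesis using that h by (simp only: kq)
qed


section \<open>The multiplication\<close>

text \<open>
  One tensor factor after the other is replaced by tensor powers.
\<close>

lemma word_jointly_epi2:
  assumes "g \<in> hom C (Fr \<box>\<^sub>o Fr) Z" "h \<in> hom C (Fr \<box>\<^sub>o Fr) Z"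
    and eq: "\<And>n k. g \<cdot> (word n \<box> word k) = h \<cdot> (word n \<box> word k)"
  shows "g = h"
proof (rule word_jointly_epi[OF sifted_ten(2)[of Fr]])
  have [simp]: "g \<in> Arr C" "Dom C g = Fr \<box>\<^sub>o Fr" "Cod C g = Z" "h \<in> Arr C" "Dom C h = Fr \<box>\<^sub>o Fr" "Cod C h = Z"
    using assms(1,2) by simp_all
  show "g \<cdot> (word n \<box> Id C Fr) = h \<cdot> (word n \<box> Id C Fr)" for n
    by (rule word_jointly_epi[OF sifted_ten(1)[of "tpow C P n"], of _ Z]) (simp_all add: eq)
qed (use assms in simp_all)

lemma word_jointly_epi3:
  assumes "g \<in> hom C ((Fr \<box>\<^sub>o Fr) \<box>\<^sub>o Fr) Z" "h \<in> hom C ((Fr \<box>\<^sub>o Fr) \<box>\<^sub>o Fr) Z"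
    and eq: "\<And>n m k. g \<cdot> ((word n \<box> word m) \<box> word k) = h \<cdot> ((word n \<box> word m) \<box> word k)"
  shows "g = h"
proof (rule word_jointly_epi[OF sifted_comp[OF sifted_ten(2)[of Fr] sifted_ten(2)[of Fr]]])
  have [simp]: "g \<in> Arr C" "Dom C g = (Fr \<box>\<^sub>o Fr) \<box>\<^sub>o Fr" "Cod C g = Z"
    "h \<in> Arr C" "Dom C h = (Fr \<box>\<^sub>o Fr) \<box>\<^sub>o Fr" "Cod C h = Z"
    using assms(1,2) by simp_all
  have 2: "g \<cdot> ((word n \<box> word m) \<box> Id C Fr) = h \<cdot> ((word n \<box> word m) \<box> Id C Fr)" for n m
    by (rule word_jointly_epi[OF sifted_ten(1)[of "tpow C P n \<box>\<^sub>o tpow C P m"], of _ Z]) (simp_all add: eq)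
  show "g \<cdot> ((word n \<box> Id C Fr) \<box> Id C Fr) = h \<cdot> ((word n \<box> Id C Fr) \<box> Id C Fr)" for n
    by (rule word_jointly_epi[OF sifted_comp[OF sifted_ten(2)[of Fr] sifted_ten(1)[of "tpow C P n"]], of _ Z])
      (simp_all add: 2)
qed (use assms in simp_all)

text \<open>
  The product is constructed in two steps.  Here the first factor is already the free monoid while
  the second one is still a tensor power.
\<close>

lemma ex_mult_left:
  "\<exists>h. h \<in> hom C (Fr \<box>\<^sub>o tpow C P k) Fr \<and>
    (\<forall>n. h \<cdot> (word n \<box> Id C (tpow C P k)) = word (n + k) \<cdot> tcat C P n k)"
proof -
  have rel: "(word (i + (2 + b) + k) \<cdot> tcat C P (i + (2 + b)) k) \<cdot> (plug P i 2 rel0 b \<box> Id C (tpow C P k)) =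
      (word (i + (2 + b) + k) \<cdot> tcat C P (i + (2 + b)) k) \<cdot> (plug P i 2 rel1 b \<box> Id C (tpow C P k))" for i b
  proof -
    let ?X = "bi_obj C V (tpow C P 2)"
    let ?N = "(Id C (tpow C P i) \<box> ((Id C ?X \<box> tcat C P b k) \<cdot> Assoc C ?X (tpow C P b) (tpow C P k))) \<cdot>
      Assoc C (tpow C P i) (?X \<box>\<^sub>o tpow C P b) (tpow C P k)"
    have *: "(word (i + (2 + b) + k) \<cdot> tcat C P (i + (2 + b)) k) \<cdot> (plug P i 2 d b \<box> Id C (tpow C P k)) =
        (word (i + (2 + (b + k))) \<cdot> plug P i 2 d (b + k)) \<cdot> ?N" if "d \<in> hom C ?X (tpow C P 2)" for d
    proof -
      have [simp]: "d \<in> Arr C" "Dom C d = ?X" "Cod C d = tpow C P 2" using that by simp_all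
      have "(word (i + (2 + b) + k) \<cdot> tcat C P (i + (2 + b)) k) \<cdot> (plug P i 2 d b \<box> Id C (tpow C P k)) =
          word (i + (2 + b) + k) \<cdot> (tcat C P (i + (2 + b)) k \<cdot> (plug P i 2 d b \<box> Id C (tpow C P k)))"
        by (rule comp_reassoc) simp_all
      also have "\<dots> = word (i + (2 + b) + k) \<cdot> (plug P i 2 d (b + k) \<cdot> ?N)"
        by (subst tcat_plug_left[OF P that]) (rule refl)
      also have "\<dots> = (word (i + (2 + (b + k))) \<cdot> plug P i 2 d (b + k)) \<cdot> ?N"
        by (subst comp_reassoc) (simp_all add: add.assoc)
      finally show ?thesis .
    qed
    have "rel0 \<in> hom C ?X (tpow C P 2)" "rel1 \<in> hom C ?X (tpow C P 2)" by simp_all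
    then show ?thesis by (simp only: * word_plug)
  qed
  have unit: "(word (Suc n + k) \<cdot> tcat C P (Suc n) k) \<cdot> (insert_unit P \<eta> n \<box> Id C (tpow C P k)) =
      word (n + k) \<cdot> tcat C P n k" for n
  proof -
    have "(word (Suc n + k) \<cdot> tcat C P (Suc n) k) \<cdot> (insert_unit P \<eta> n \<box> Id C (tpow C P k)) =
        word (Suc (n + k)) \<cdot> (tcat C P (Suc n) k \<cdot> (insert_unit P \<eta> n \<box> Id C (tpow C P k)))"
      by simp
    also have "\<dots> = (word (Suc (n + k)) \<cdot> insert_unit P \<eta> (n + k)) \<cdot> tcat C P n k"
      unfolding insert_unit_tcat[symmetric] by simp
    finally show ?thesis unfolding word_insert_unit .
  qed
  obtain h where "h \<in> hom C (Fr \<box>\<^sub>o tpow C P k) Fr"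
    "\<And>n. h \<cdot> (word n \<box> Id C (tpow C P k)) = word (n + k) \<cdot> tcat C P n k"
    by (rule word_extend[OF sifted_ten(2)[of "tpow C P k"],
          where Z = Fr and g = "\<lambda>n. word (n + k) \<cdot> tcat C P n k"])
      (use rel unit in \<open>simp_all only: free_in_typing tpow_obj P\<close>, simp)
  then show ?thesis by blast
qed

text \<open>
  In the second step the conditions on the second factor are tested on words in the first factor,
  where the product is concatenation.
\<close>

lemma ex_mult:
  "\<exists>m. m \<in> hom C (Fr \<box>\<^sub>o Fr) Fr \<and> (\<forall>n k. m \<cdot> (word n \<box> word k) = word (n + k) \<cdot> tcat C P n k)"
proof -
  obtain h where "\<forall>k. h k \<in> hom C (Fr \<box>\<^sub>o tpow C P k) Fr \<and>
      (\<forall>n. h k \<cdot> (word n \<box> Id C (tpow C P k)) = word (n + k) \<cdot> tcat C P n k)"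
    using choice[of "\<lambda>k h. h \<in> hom C (Fr \<box>\<^sub>o tpow C P k) Fr \<and>
      (\<forall>n. h \<cdot> (word n \<box> Id C (tpow C P k)) = word (n + k) \<cdot> tcat C P n k)"] ex_mult_left by blast
  then have h [simp]: "h k \<in> Arr C" "Dom C (h k) = Fr \<box>\<^sub>o tpow C P k" "Cod C (h k) = Fr"
    and hw: "h k \<cdot> (word n \<box> Id C (tpow C P k)) = word (n + k) \<cdot> tcat C P n k" for n k
    by simp_all
  have hd: "(h k \<cdot> (Id C Fr \<box> d)) \<cdot> (word n \<box> Id C (Dom C d)) =
      word (n + k) \<cdot> (tcat C P n k \<cdot> (Id C (tpow C P n) \<box> d))"
    if "d \<in> Arr C" "Cod C d = tpow C P k" for d n k
  proof -
    have "(h k \<cdot> (Id C Fr \<box> d)) \<cdot> (word n \<box> Id C (Dom C d)) =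
        (h k \<cdot> (word n \<box> Id C (tpow C P k))) \<cdot> (Id C (tpow C P n) \<box> d)"
      using that by simp
    then show ?thesis using that by (simp add: hw)
  qed
  have rel: "h (i + (2 + b)) \<cdot> (Id C Fr \<box> plug P i 2 rel0 b) =
      h (i + (2 + b)) \<cdot> (Id C Fr \<box> plug P i 2 rel1 b)" for i b
  proof -
    let ?X = "bi_obj C V (tpow C P 2)" and ?k = "i + (2 + b)"
    let ?W = "tpow C P i \<box>\<^sub>o (?X \<box>\<^sub>o tpow C P b)"
    have *: "(h ?k \<cdot> (Id C Fr \<box> plug P i 2 d b)) \<cdot> (word n \<box> Id C ?W) =
        (word (n + i + (2 + b)) \<cdot> plug P (n + i) 2 d b) \<cdot> (tcat C P n i \<box> Id C (?X \<box>\<^sub>o tpow C P b)) \<cdot>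
        inverse_arr C (Assoc C (tpow C P n) (tpow C P i) (?X \<box>\<^sub>o tpow C P b))"
      if "d \<in> hom C ?X (tpow C P 2)" for d n
    proof -
      have [simp]: "d \<in> Arr C" "Dom C d = ?X" "Cod C d = tpow C P 2" using that by simp_all
      have "(h ?k \<cdot> (Id C Fr \<box> plug P i 2 d b)) \<cdot> (word n \<box> Id C (Dom C (plug P i 2 d b))) =
          word (n + ?k) \<cdot> (tcat C P n ?k \<cdot> (Id C (tpow C P n) \<box> plug P i 2 d b))"
        by (rule hd) simp_all
      also have "\<dots> = (word (n + i + (2 + b)) \<cdot> plug P (n + i) 2 d b) \<cdot>
          (tcat C P n i \<box> Id C (?X \<box>\<^sub>o tpow C P b)) \<cdot>
          inverse_arr C (Assoc C (tpow C P n) (tpow C P i) (?X \<box>\<^sub>o tpow C P b))"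
        unfolding tcat_plug_right[OF P that] by (simp add: add.assoc)
      finally show ?thesis by simp
    qed
    show ?thesis
    proof (rule word_jointly_epi[OF sifted_ten(2)[of ?W]])
      fix n
      have "rel0 \<in> hom C ?X (tpow C P 2)" "rel1 \<in> hom C ?X (tpow C P 2)" by simp_all
      then show "(h ?k \<cdot> (Id C Fr \<box> plug P i 2 rel0 b)) \<cdot> (word n \<box> Id C ?W) =
          (h ?k \<cdot> (Id C Fr \<box> plug P i 2 rel1 b)) \<cdot> (word n \<box> Id C ?W)"
        by (simp only: * word_plug)
    qed simp_all
  qed
  have unit: "h (Suc k) \<cdot> (Id C Fr \<box> insert_unit P \<eta> k) = h k" for k
  proof (rule word_jointly_epi[OF sifted_ten(2)[of "tpow C P k"]])
    fix n
    have "(h (Suc k) \<cdot> (Id C Fr \<box> insert_unit P \<eta> k)) \<cdot> (word n \<box> Id C (tpow C P k)) =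
        word (n + Suc k) \<cdot> (tcat C P n (Suc k) \<cdot> (Id C (tpow C P n) \<box> insert_unit P \<eta> k))"
      using hd[of "insert_unit P \<eta> k" "Suc k" n] by simp
    also have "\<dots> = (word (Suc (n + k)) \<cdot> insert_unit_at P \<eta> n (n + k - n)) \<cdot> tcat C P n k"
      unfolding insert_unit_at_tcat[symmetric] by simp
    also have "\<dots> = h k \<cdot> (word n \<box> Id C (tpow C P k))"
      by (subst word_insert_unit_at) (simp_all add: hw)
    finally show "(h (Suc k) \<cdot> (Id C Fr \<box> insert_unit P \<eta> k)) \<cdot> (word n \<box> Id C (tpow C P k)) =
        h k \<cdot> (word n \<box> Id C (tpow C P k))" .
  qed simp_all
  obtain m where m: "m \<in> hom C (Fr \<box>\<^sub>o Fr) Fr" "\<And>k. m \<cdot> (Id C Fr \<box> word k) = h k"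
    by (rule word_extend[OF sifted_ten(1)[of Fr], where Z = Fr and g = h])
      (use rel unit in \<open>simp_all only: free_in_typing\<close>, simp)
  have "m \<cdot> (word n \<box> word k) = word (n + k) \<cdot> tcat C P n k" for n k
  proof -
    have "m \<cdot> (word n \<box> word k) = (m \<cdot> (Id C Fr \<box> word k)) \<cdot> (word n \<box> Id C (tpow C P k))"
      using m(1) by simp
    then show ?thesis by (simp only: m(2) hw)
  qed
  with m(1) show ?thesis by blast
qed

abbreviation \<mu> :: 'm where "\<mu> \<equiv> free_mult C V"

lemma free_mult_props:
  shows free_mult_typing [simp]: "\<mu> \<in> Arr C" "Dom C \<mu> = Fr \<box>\<^sub>o Fr" "Cod C \<mu> = Fr"
    and free_mult_word: "\<mu> \<cdot> (word n \<box> word k) = word (n + k) \<cdot> tcat C P n k"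
proof -
  let ?prop = "\<lambda>m. m \<in> hom C (Fr \<box>\<^sub>o Fr) Fr \<and> (\<forall>n k. m \<cdot> (word n \<box> word k) = word (n + k) \<cdot> tcat C P n k)"
  have "\<mu> = (THE m. ?prop m)"
    unfolding free_mult_def word_def Vcat_def by simp
  moreover have "\<exists>!m. ?prop m"
    using ex_mult word_jointly_epi2[where Z = Fr] by (metis (no_types, lifting))
  ultimately have "?prop \<mu>"
    using theI'[of ?prop] by simp
  then show "\<mu> \<in> Arr C" "Dom C \<mu> = Fr \<box>\<^sub>o Fr" "Cod C \<mu> = Fr"
    "\<mu> \<cdot> (word n \<box> word k) = word (n + k) \<cdot> tcat C P n k"
    by simp_all
qed

lemma free_unit_eq: "free_unit C V = word 0"
  unfolding free_unit_def word_def ..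

lemma free_gen_eq: "free_gen C V = word (Suc 0) \<cdot> \<iota>"
  unfolding free_gen_def word_def by simp

text \<open>
  Tested on words, the monoid laws are the coherence of concatenation.
\<close>

lemma free_is_monoid: "is_monoid C Fr \<mu> (free_unit C V)"
  unfolding is_monoid_def free_unit_eq
proof (intro conjI)
  show "\<mu> \<cdot> (\<mu> \<box> Id C Fr) = \<mu> \<cdot> (Id C Fr \<box> \<mu>) \<cdot> Assoc C Fr Fr Fr"
  proof (rule word_jointly_epi3)
    fix n m k
    have "(\<mu> \<cdot> (\<mu> \<box> Id C Fr)) \<cdot> ((word n \<box> word m) \<box> word k) =
        \<mu> \<cdot> ((word (n + m) \<cdot> tcat C P n m) \<box> word k)"
      by (simp add: free_mult_word)
    also have "\<dots> = (\<mu> \<cdot> (word (n + m) \<box> word k)) \<cdot> (tcat C P n m \<box> Id C (tpow C P k))"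
      by simp
    also have "\<dots> = word (n + m + k) \<cdot> (tcat C P (n + m) k \<cdot> (tcat C P n m \<box> Id C (tpow C P k)))"
      unfolding free_mult_word by simp
    also have "\<dots> = (word (n + (m + k)) \<cdot> tcat C P n (m + k)) \<cdot> (Id C (tpow C P n) \<box> tcat C P m k) \<cdot>
        Assoc C (tpow C P n) (tpow C P m) (tpow C P k)"
      by (subst tcat_assoc) (simp_all add: add.assoc)
    also have "\<dots> = (\<mu> \<cdot> (word n \<box> (word (m + k) \<cdot> tcat C P m k))) \<cdot>
        Assoc C (tpow C P n) (tpow C P m) (tpow C P k)"
      unfolding free_mult_word[of n "m + k", symmetric] by simp
    also have "\<dots> = (\<mu> \<cdot> (Id C Fr \<box> \<mu>)) \<cdot> ((word n \<box> (word m \<box> word k)) \<cdot>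
        Assoc C (tpow C P n) (tpow C P m) (tpow C P k))"
      unfolding free_mult_word[symmetric] by simp
    also have "\<dots> = (\<mu> \<cdot> (Id C Fr \<box> \<mu>)) \<cdot> (Assoc C Fr Fr Fr \<cdot> ((word n \<box> word m) \<box> word k))"
      by (subst Assoc_natural[of _ "tpow C P n" Fr _ "tpow C P m" Fr _ "tpow C P k" Fr]) simp_all
    finally show "(\<mu> \<cdot> (\<mu> \<box> Id C Fr)) \<cdot> ((word n \<box> word m) \<box> word k) =
        (\<mu> \<cdot> (Id C Fr \<box> \<mu>) \<cdot> Assoc C Fr Fr Fr) \<cdot> ((word n \<box> word m) \<box> word k)"
      by simp
  qed simp_all
  show "\<mu> \<cdot> (word 0 \<box> Id C Fr) = Lunit C Fr"
  proof (rule word_jointly_epi[OF sifted_ten(1)[of "Unit C"]])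
    show "(\<mu> \<cdot> (word 0 \<box> Id C Fr)) \<cdot> (Id C (Unit C) \<box> word k) = Lunit C Fr \<cdot> (Id C (Unit C) \<box> word k)" for k
      using free_mult_word[of 0 k] lunit_nat[of "word k" "tpow C P k" Fr] by simp
  qed simp_all
  show "\<mu> \<cdot> (Id C Fr \<box> word 0) = Runit C Fr"
  proof (rule word_jointly_epi[OF sifted_ten(2)[of "Unit C"]])
    show "(\<mu> \<cdot> (Id C Fr \<box> word 0)) \<cdot> (word k \<box> Id C (Unit C)) = Runit C Fr \<cdot> (word k \<box> Id C (Unit C))" for k
      using free_mult_word[of k 0] runit_nat[of "word k" "tpow C P k" Fr] by (simp add: tcat_0_right)
  qed simp_all
qed simp_all


section \<open>The universal property\<close>

text \<open>
  Both unit laws of the monoid give \<open>g \<cdot> \<iota>\<close>, so the two terms of \<open>tau C V\<close> have the same image.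
\<close>

lemma mult_pow_kills_tau:
  assumes M: "is_monoid C M \<mu>' \<eta>'" and g: "g \<in> hom C P M" "g \<cdot> \<eta> = \<eta>'"
  shows "mult_pow C \<mu>' \<eta>' g 2 \<cdot> tau C V = Zero C V M"
proof -
  let ?l = "inverse_arr C (Lunit C V)" and ?r = "inverse_arr C (Runit C V)"
  let ?f = "g \<cdot> \<iota>" and ?G = "mult_pow C \<mu>' \<eta>' g 2"
  have [simp]: "M \<in> Obj C" "\<mu>' \<in> Arr C" "Dom C \<mu>' = M \<box>\<^sub>o M" "Cod C \<mu>' = M"
    "\<eta>' \<in> Arr C" "Dom C \<eta>' = Unit C" "Cod C \<eta>' = M" "g \<in> Arr C" "Dom C g = P" "Cod C g = M"
    using M g(1) unfolding is_monoid_def by simp_all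
  have unit: "\<mu>' \<cdot> (\<eta>' \<box> Id C M) = Lunit C M" "\<mu>' \<cdot> (Id C M \<box> \<eta>') = Runit C M"
    using M unfolding is_monoid_def by blast+
  have G: "?G = \<mu>' \<cdot> (g \<box> g)" by (simp add: numeral_2_eq_2)
  have [simp]: "?G \<in> Arr C" "Dom C ?G = P \<box>\<^sub>o P" "Cod C ?G = M"
    by (simp_all add: G)
  have "?G \<cdot> (\<eta> \<box> \<iota>) \<cdot> ?l = ((\<mu>' \<cdot> (\<eta>' \<box> Id C M)) \<cdot> (Id C (Unit C) \<box> ?f)) \<cdot> ?l"
    by (simp add: G g(2))
  also have "\<dots> = ?f"
    unfolding unit using lunit_nat[of ?f V M] by simp
  finally have l: "?G \<cdot> (\<eta> \<box> \<iota>) \<cdot> ?l = ?f" .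
  have "?G \<cdot> (\<iota> \<box> \<eta>) \<cdot> ?r = ((\<mu>' \<cdot> (Id C M \<box> \<eta>')) \<cdot> (?f \<box> Id C (Unit C))) \<cdot> ?r"
    by (simp add: G g(2))
  also have "\<dots> = ?f"
    unfolding unit using runit_nat[of ?f V M] by simp
  finally have r: "?G \<cdot> (\<iota> \<box> \<eta>) \<cdot> ?r = ?f" .
  have "?f \<oplus> ?G \<cdot> tau C V = ?G \<cdot> (((\<iota> \<box> \<eta>) \<cdot> ?r) \<oplus> tau C V)"
    by (subst comp_distrib(1)) (simp_all add: r tpow_2)
  also have "\<dots> = ?f"
    unfolding tau_add by (rule l)
  finally have "?f \<oplus> ?G \<cdot> tau C V = ?f \<oplus> Zero C V M"
    by simp
  then show ?thesis
    using add_cancel_left[of ?f V M "?G \<cdot> tau C V" "Zero C V M"] by (simp add: tpow_2)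
qed

text \<open>
  The extension multiplies out words: its value on the \<open>n\<close>-th tensor power is the \<open>n\<close>-fold product of
  the arrow given by the unit of \<open>M\<close> and by \<open>f\<close>.  A homomorphism is determined by \<open>f\<close> because a word is
  the product of its letters.
\<close>

lemma ex_extension:
  assumes M: "is_monoid C M \<mu>' \<eta>'" and f: "f \<in> hom C V M"
  shows "\<exists>!h. is_monoid_hom C Fr \<mu> (free_unit C V) M \<mu>' \<eta>' h \<and> h \<cdot> free_gen C V = f"
proof -
  have [simp]: "M \<in> Obj C" "\<mu>' \<in> Arr C" "Dom C \<mu>' = M \<box>\<^sub>o M" "Cod C \<mu>' = M"
    "\<eta>' \<in> Arr C" "Dom C \<eta>' = Unit C" "Cod C \<eta>' = M" "f \<in> Arr C" "Dom C f = V" "Cod C f = M"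
    using M f unfolding is_monoid_def by simp_all
  define g where "g = \<eta>' \<cdot> bi_pr1 C (Unit C) V \<oplus> f \<cdot> bi_pr2 C (Unit C) V"
  have g: "g \<in> hom C P M" "g \<cdot> \<eta> = \<eta>'" "g \<cdot> \<iota> = f"
    unfolding g_def Vplus_def in_unit_def in_V_def by (simp_all add: comp_distrib)
  then have [simp]: "g \<in> Arr C" "Dom C g = P" "Cod C g = M" by simp_all
  let ?G = "mult_pow C \<mu>' \<eta>' g"
  note G = mult_pow_tcat[OF M P g(1)]
  have [simp]: "?G n \<in> Arr C" "Dom C (?G n) = tpow C P n" "Cod C (?G n) = M" for n
    using G(1)[of n] by simp_all
  have G_rel: "?G 2 \<cdot> rel0 = ?G 2 \<cdot> rel1"
    unfolding rel0_def rel1_def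
    by (subst comp_distrib(1)) (simp_all add: comp_precomp[OF mult_pow_kills_tau[OF M g(1,2)]] del: mult_pow.simps)
  have rel: "?G (i + (2 + b)) \<cdot> plug P i 2 rel0 b = ?G (i + (2 + b)) \<cdot> plug P i 2 rel1 b" for i b
    using mult_pow_plug[OF M P g(1), of rel0 "Dom C rel0" 2 i b]
      mult_pow_plug[OF M P g(1), of rel1 "Dom C rel1" 2 i b] G_rel by simp
  have unit: "?G (Suc n) \<cdot> insert_unit P \<eta> n = ?G n" for n
    by (rule mult_pow_insert_unit[OF M g(1,2)])
  obtain h where h: "h \<in> hom C Fr M" and hw: "\<And>n. h \<cdot> word n = ?G n"
    using word_extend[OF sifted_id, of M ?G] G(1) rel unit by (metis \<open>M \<in> Obj C\<close>)
  have [simp]: "h \<in> Arr C" "Dom C h = Fr" "Cod C h = M" using h by simp_all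
  have "h \<cdot> \<mu> = \<mu>' \<cdot> (h \<box> h)"
  proof (rule word_jointly_epi2)
    fix n k
    have "(h \<cdot> \<mu>) \<cdot> (word n \<box> word k) = (h \<cdot> word (n + k)) \<cdot> tcat C P n k"
      by (simp add: free_mult_word)
    then show "(h \<cdot> \<mu>) \<cdot> (word n \<box> word k) = (\<mu>' \<cdot> (h \<box> h)) \<cdot> (word n \<box> word k)"
      by (simp add: hw G(2))
  qed simp_all
  moreover have "h \<cdot> free_gen C V = (h \<cdot> word (Suc 0)) \<cdot> \<iota>"
    unfolding free_gen_eq by simp
  ultimately have h_hom: "is_monoid_hom C Fr \<mu> (free_unit C V) M \<mu>' \<eta>' h \<and> h \<cdot> free_gen C V = f"
    unfolding is_monoid_hom_def free_unit_eq using h hw g(3) by simp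
  moreover have "k = h" if k: "is_monoid_hom C Fr \<mu> (free_unit C V) M \<mu>' \<eta>' k \<and> k \<cdot> free_gen C V = f" for k
  proof (rule word_jointly_epi[OF sifted_id])
    have [simp]: "k \<in> Arr C" "Dom C k = Fr" "Cod C k = M" and k\<mu>: "k \<cdot> \<mu> = \<mu>' \<cdot> (k \<box> k)"
      and k0: "k \<cdot> word 0 = \<eta>'" and kf: "k \<cdot> word (Suc 0) \<cdot> \<iota> = f"
      using k unfolding is_monoid_hom_def free_unit_eq free_gen_eq by simp_all
    have k1: "k \<cdot> word (Suc 0) = g"
    proof (rule P_hom_ext)
      have "word (Suc 0) \<cdot> \<eta> = word 0"
        using word_insert_unit[of 0] by (simp add: insert_unit_0)
      then show "(k \<cdot> word (Suc 0)) \<cdot> \<eta> = g \<cdot> \<eta>"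
        by (simp add: k0 g(2))
      show "(k \<cdot> word (Suc 0)) \<cdot> \<iota> = g \<cdot> \<iota>"
        by (simp add: kf g(3))
    qed (use g(1) in simp_all)
    have "k \<cdot> word n = ?G n" for n
    proof (induction n rule: induct_nat_012)
      case (ge2 n)
      have "word (Suc (Suc n)) = \<mu> \<cdot> (word (Suc 0) \<box> word (Suc n))"
        using free_mult_word[of "Suc 0" "Suc n"] by simp
      then have "k \<cdot> word (Suc (Suc n)) = (k \<cdot> \<mu>) \<cdot> (word (Suc 0) \<box> word (Suc n))"
        by simp
      also have "\<dots> = \<mu>' \<cdot> ((k \<cdot> word (Suc 0)) \<box> (k \<cdot> word (Suc n)))"
        unfolding k\<mu> by simp
      finally show ?case by (simp add: k1 ge2)
    qed (simp_all add: k0 k1)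
    then show "k \<cdot> word n = h \<cdot> word n" for n by (simp add: hw)
    show "k \<in> hom C Fr M" "h \<in> hom C Fr M" by simp_all
  qed
  ultimately show ?thesis by blast
qed

end

theorem mainTheorem7:
  fixes C :: "('o, 'm, 'x) abelian_monoidal_category_scheme" and V :: 'o
  assumes "abelian_monoidal_category C"
    and "has_seq_colimits C"
    and "ten_preserves_seq_colimits C"
    and "ten_preserves_reflexive_coequalizers C"
    and "V \<in> Obj C"
  shows "is_free_monoid C V (free_obj C V) (free_mult C V) (free_unit C V) (free_gen C V)"
proof -
  interpret free_monoid C V
    using assms by (intro free_monoid.intro free_monoid_axioms.intro)
  show ?thesis
    unfolding is_free_monoid_def
  proof (intro conjI allI impI ballI)
    show "free_gen C V \<in> hom C V (free_obj C V)"
      by (simp add: free_gen_eq)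
  qed (rule free_is_monoid, rule ex_extension)
qed

end
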